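(* Let $\mathcal A$ be a unimodular Lie algebra of dimension $m=2n-1\ge 3$ that possesses some contact form. If there exist $\alpha,\beta\in\mathcal A^*$ such that $(d\alpha,d\beta)$ is generic, then on $\mathcal B_{\mathcal A}^*$, the dual space of the secondary algebra $\mathcal B_{\mathcal A}$ of $\mathcal A$, there exists some non-flat generic linear Poisson pair.
   Context: Lie algebras are finite-dimensional over $\mathbb K=\mathbb R$ or $\mathbb C$. $\mathcal A$ is unimodular if $\mathrm{tr}[a,\cdot]=0$ for all $a\in\mathcal A$. For $\alpha\in\mathcal A^*$, $d\alpha(a,b)=-\alpha([a,b])$. A contact form on $\mathcal A$ ($\dim\mathcal A=2n-1$) is $\rho\in\mathcal A^*$ with $\rho\wedge(d\rho)^{n-1}\neq0$. A couple $(\beta,\beta_1)$ of $2$-forms on a vector space of dimension $2n-1\ge3$ is generic if $(s\beta+t\beta_1)^{n-1}\neq0$ for all $(s,t)\in\mathbb C^2\setminus\{0\}$ (complexifying in the real case). Secondary algebra: $\mathcal B_{\mathcal A}=\mathcal A\times\mathcal A\times\mathbb K$ with bracket $[(v,v',s),(w,w',t)]=([v,w],\,[v,w']-[w,v']+tv'-sw',\,0)$; its dimension is $2m+1$. Linear Poisson pair on the dual $\mathcal B^*$ of a Lie algebra $\mathcal B$: a couple $(\Lambda,\Lambda_1)$ where $\Lambda$ is the Lie–Poisson structure of $\mathcal B^*$ ($\Lambda(a,b)=[a,b]$ for $a,b\in\mathcal B$ regarded as linear functions) and $\Lambda_1$ is the constant bi-vector given by some $\beta\in\Lambda^2\mathcal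 B^*$ with $d\beta=0$. When $\dim\mathcal B=2N-1\ge 3$, it is generic at a point $p$ if $(s\Lambda+t\Lambda_1)^{N-1}(p)\ne0$ for all $(s,t)\in\mathbb C^2\setminus\{0\}$; flat at $p$ if in some local coordinates around $p$ (smooth if $\mathbb K=\mathbb R$, holomorphic if $\mathbb K=\mathbb C$) both bi-vectors have constant coefficients. The pair is generic if it is generic at some point, and flat if it is flat at every generic point. *)

theory Defs
  imports "HOL-Analysis.Analysis" "HOL-Combinatorics.Permutations"
begin

section \<open>The ground field\<close>

text \<open>
  The axioms say that \<open>to_complex\<close> is an isometric homomorphism of unital real algebras into
  the complex numbers. Its range is therefore either the reals or everything (lemma
  \<open>range_to_complex\<close> below), so the members of this class are exactly the fields of real and of
  complex numbers.
\<close>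

class real_or_complex = real_normed_field +
  fixes to_complex :: "'a \<Rightarrow> complex"
  assumes to_complex_add: "to_complex (x + y) = to_complex x + to_complex y"
    and to_complex_mult: "to_complex (x * y) = to_complex x * to_complex y"
    and to_complex_one: "to_complex 1 = 1"
    and to_complex_scaleR: "to_complex (r *\<^sub>R x) = r *\<^sub>R to_complex x"
    and norm_to_complex: "norm (to_complex x) = norm x"

instantiation real :: real_or_complex
begin
definition to_complex_real :: "real \<Rightarrow> complex" where "to_complex_real = complex_of_real"
instance by standard (auto simp: to_complex_real_def scaleR_conv_of_real)
end

instantiation complex :: real_or_complex
begin
definition to_complex_complex :: "complex \<Rightarrow> complex" where "to_complex_complex = (\<lambda>z. z)"
instance by standard (auto simp: to_complex_complex_def)
end

lemma range_to_complex:
  "range (to_complex :: 'k::real_or_complex \<Rightarrow> complex) = \<real>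
    \<or> range (to_complex :: 'k \<Rightarrow> complex) = UNIV"
proof (cases "range (to_complex :: 'k \<Rightarrow> complex) \<subseteq> \<real>")
  case True
  have "of_real r = to_complex (r *\<^sub>R (1::'k))" for r
    using to_complex_scaleR[of r "1::'k"] by (simp add: to_complex_one scaleR_conv_of_real[of _ "1::complex"])
  with True show ?thesis by (metis Reals_cases rangeI subsetI subset_antisym)
next
  case False
  then have "\<exists>x :: 'k. to_complex x \<notin> \<real>" by blast
  then obtain x :: 'k where x: "Im (to_complex x) \<noteq> 0"
    by (auto simp: complex_is_Real_iff)
  have "z \<in> range (to_complex :: 'k \<Rightarrow> complex)" for z
  proof -
    define b where "b = Im z / Im (to_complex x)"
    have "z = to_complex ((Re z - b * Re (to_complex x)) *\<^sub>R (1::'k) + b *\<^sub>R x)"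
      using x by (simp add: b_def to_complex_add to_complex_scaleR to_complex_one complex_eq_iff)
    then show ?thesis by blast
  qed
  then show ?thesis by blast
qed

section \<open>Lie algebras and exterior forms\<close>

locale lie_algebra = finite_dimensional_vector_space scl bas
  for scl :: "'k::field \<Rightarrow> 'a::ab_group_add \<Rightarrow> 'a" and bas :: "'a set" +
  fixes bracket :: "'a \<Rightarrow> 'a \<Rightarrow> 'a"
  assumes linear_bracket_left: "Vector_Spaces.linear scl scl (\<lambda>a. bracket a b)"
    and linear_bracket_right: "Vector_Spaces.linear scl scl (bracket a)"
    and bracket_same: "bracket a a = 0"
    and jacobi: "bracket a (bracket b c) + bracket b (bracket c a) + bracket c (bracket a b) = 0"

definition dual_space :: "('k::field \<Rightarrow> 'a::ab_group_add \<Rightarrow> 'a) \<Rightarrow> ('a \<Rightarrow> 'k) set"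
  where "dual_space scl = {\<alpha>. Vector_Spaces.linear scl (*) \<alpha>}"

definition trace_on ::
  "('k::field \<Rightarrow> 'a::ab_group_add \<Rightarrow> 'a) \<Rightarrow> 'a set \<Rightarrow> ('a \<Rightarrow> 'a) \<Rightarrow> 'k"
  where "trace_on scl bas f = (\<Sum>b\<in>bas. module.representation scl bas (f b) b)"

definition unimodular ::
  "('k::field \<Rightarrow> 'a::ab_group_add \<Rightarrow> 'a) \<Rightarrow> 'a set \<Rightarrow> ('a \<Rightarrow> 'a \<Rightarrow> 'a) \<Rightarrow> bool"
  where "unimodular scl bas bracket \<longleftrightarrow> (\<forall>a. trace_on scl bas (bracket a) = 0)"

definition two_form ::
  "('k::field \<Rightarrow> 'a::ab_group_add \<Rightarrow> 'a) \<Rightarrow> ('a \<Rightarrow> 'a \<Rightarrow> 'k) \<Rightarrow> bool"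
  where "two_form scl \<omega> \<longleftrightarrow>
    (\<forall>b. Vector_Spaces.linear scl (*) (\<lambda>a. \<omega> a b)) \<and>
    (\<forall>a. Vector_Spaces.linear scl (*) (\<omega> a)) \<and>
    (\<forall>a. \<omega> a a = 0)"

text \<open>The differential of left-invariant forms (Chevalley--Eilenberg), in degrees 1 and 2.\<close>

definition d_one :: "('a \<Rightarrow> 'a \<Rightarrow> 'a) \<Rightarrow> ('a \<Rightarrow> 'k::field) \<Rightarrow> 'a \<Rightarrow> 'a \<Rightarrow> 'k"
  where "d_one bracket \<alpha> a b = - \<alpha> (bracket a b)"

definition d_two :: "('a \<Rightarrow> 'a \<Rightarrow> 'a) \<Rightarrow> ('a \<Rightarrow> 'a \<Rightarrow> 'k::field) \<Rightarrow> 'a \<Rightarrow> 'a \<Rightarrow> 'a \<Rightarrow> 'k"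
  where "d_two bracket \<omega> a b c =
    - \<omega> (bracket a b) c + \<omega> (bracket a c) b - \<omega> (bracket b c) a"

text \<open>
  A form of degree \<open>k\<close> is represented by a function of a sequence of vectors that only looks at
  the entries \<open>0, \<dots>, k - 1\<close>. The value field \<open>'k\<close> need not be the ground field: complex-valued
  forms on a real vector space are the elements of the complexified exterior powers of its dual.
\<close>

definition wedge ::
  "nat \<Rightarrow> nat \<Rightarrow> ((nat \<Rightarrow> 'a) \<Rightarrow> 'k::field_char_0) \<Rightarrow> ((nat \<Rightarrow> 'a) \<Rightarrow> 'k) \<Rightarrow> (nat \<Rightarrow> 'a) \<Rightarrow> 'k"
  where "wedge k l \<theta> \<eta> v =
    (\<Sum>\<sigma> | \<sigma> permutes {..<k + l}.
       of_int (sign \<sigma>) * \<theta> (\<lambda>i. v (\<sigma> i)) * \<eta> (\<lambda>i. v (\<sigma> (k + i)))) / (fact k * fact l)"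

primrec two_form_power :: "('a \<Rightarrow> 'a \<Rightarrow> 'k::field_char_0) \<Rightarrow> nat \<Rightarrow> (nat \<Rightarrow> 'a) \<Rightarrow> 'k"
  where
    "two_form_power \<omega> 0 = (\<lambda>v. 1)"
  | "two_form_power \<omega> (Suc k) = wedge 2 (2 * k) (\<lambda>v. \<omega> (v 0) (v 1)) (two_form_power \<omega> k)"

definition contact_form ::
  "('k::field_char_0 \<Rightarrow> 'a::ab_group_add \<Rightarrow> 'a) \<Rightarrow> ('a \<Rightarrow> 'a \<Rightarrow> 'a) \<Rightarrow> ('a \<Rightarrow> 'k) \<Rightarrow> bool"
  where "contact_form scl bracket \<rho> \<longleftrightarrow> \<rho> \<in> dual_space scl \<and>
    (\<exists>n\<ge>1. vector_space.dim scl UNIV = 2 * n - 1 \<and>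
      (\<exists>v. wedge 1 (2 * (n - 1)) (\<lambda>v. \<rho> (v 0)) (two_form_power (d_one bracket \<rho>) (n - 1)) v \<noteq> 0))"

text \<open>
  For \<open>s, t\<close> complex, \<open>s \<beta> + t \<beta>\<^sub>1\<close> is taken as a complex-valued form. A nonzero
  complex-valued multilinear form on a real vector space is the same thing as a nonzero complex
  multilinear form on its complexification.
\<close>

definition generic_couple ::
  "('k::real_or_complex \<Rightarrow> 'a::ab_group_add \<Rightarrow> 'a) \<Rightarrow> ('a \<Rightarrow> 'a \<Rightarrow> 'k) \<Rightarrow> ('a \<Rightarrow> 'a \<Rightarrow> 'k) \<Rightarrow> bool"
  where "generic_couple scl \<beta> \<beta>\<^sub>1 \<longleftrightarrow> two_form scl \<beta> \<and> two_form scl \<beta>\<^sub>1 \<and>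
    (\<exists>n\<ge>2. vector_space.dim scl UNIV = 2 * n - 1 \<and>
      (\<forall>s t :: complex. (s, t) \<noteq> (0, 0) \<longrightarrow>
        (\<exists>v. two_form_power (\<lambda>a b. s * to_complex (\<beta> a b) + t * to_complex (\<beta>\<^sub>1 a b)) (n - 1) v
             \<noteq> 0)))"

section \<open>The secondary algebra\<close>

definition secondary_scale ::
  "('k::field \<Rightarrow> 'a::ab_group_add \<Rightarrow> 'a) \<Rightarrow> 'k \<Rightarrow> 'a \<times> 'a \<times> 'k \<Rightarrow> 'a \<times> 'a \<times> 'k"
  where "secondary_scale scl c = (\<lambda>(v, v', s). (scl c v, scl c v', c * s))"

definition secondary_bracket ::
  "('k::field \<Rightarrow> 'a::ab_group_add \<Rightarrow> 'a) \<Rightarrow> ('a \<Rightarrow> 'a \<Rightarrow> 'a) \<Rightarrow>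
   'a \<times> 'a \<times> 'k \<Rightarrow> 'a \<times> 'a \<times> 'k \<Rightarrow> 'a \<times> 'a \<times> 'k"
  where "secondary_bracket scl bracket = (\<lambda>(v, v', s) (w, w', t).
    (bracket v w, bracket v w' - bracket w v' + scl t v' - scl s w', 0))"

lemma lie_algebra_secondary:
  fixes scl :: "'k::field \<Rightarrow> 'a::ab_group_add \<Rightarrow> 'a"
  assumes "lie_algebra scl bas bracket"
  shows "\<exists>B. lie_algebra (secondary_scale scl) B (secondary_bracket scl bracket)"
    and "vector_space.dim (secondary_scale scl) UNIV = 2 * vector_space.dim scl UNIV + 1"
proof -
  interpret lie_algebra scl bas bracket by fact
  interpret P: finite_dimensional_vector_space_prod scl "(*) :: 'k \<Rightarrow> 'k \<Rightarrow> 'k" bas "{1}"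
    by unfold_locales
  interpret Q: finite_dimensional_vector_space_prod scl P.scale bas P.Basis_pair
    by unfold_locales
  have scale: "secondary_scale scl = Q.scale"
    by (auto simp: secondary_scale_def P.scale_def Q.scale_def fun_eq_iff)
  have left: "bracket (x + y) z = bracket x z + bracket y z"
    "bracket (scl c x) z = scl c (bracket x z)" for x y z c
    using linear_bracket_left[of z] by (simp_all add: Vector_Spaces.linear_iff)
  have right: "bracket z (x + y) = bracket z x + bracket z y"
    "bracket z (scl c x) = scl c (bracket z x)" for x y z c
    using linear_bracket_right[of z] by (simp_all add: Vector_Spaces.linear_iff)
  have zero: "bracket 0 x = 0" "bracket x 0 = 0" for x
    using left(2)[of 0 0 x] right(2)[of x 0 0] by simp_all
  have skew: "bracket x y = - bracket y x" for x y
    using bracket_same[of "x + y", unfolded left right]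
    by (simp add: bracket_same eq_neg_iff_add_eq_0 add.commute)
  have minus: "bracket (- x) y = - bracket x y" "bracket y (- x) = - bracket y x" for x y
    using left(1)[of x "- x" y] right(1)[of y x "- x"] by (simp_all add: zero eq_neg_iff_add_eq_0 add.commute)
  have diff: "bracket (x - y) z = bracket x z - bracket y z"
    "bracket z (x - y) = bracket z x - bracket z y" for x y z
    using left(1)[of x "- y" z] right(1)[of z x "- y"] by (simp_all add: minus)
  have jac: "bracket (bracket x y) z = bracket x (bracket y z) - bracket y (bracket x z)" for x y z
    using jacobi[of x y z] skew[of z "bracket x y"] skew[of z x] by (simp add: minus algebra_simps)
  note bracket_simps = left right zero diff jac
  show "\<exists>B. lie_algebra (secondary_scale scl) B (secondary_bracket scl bracket)"
  proof (intro exI lie_algebra.intro lie_algebra_axioms.intro)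
    show "finite_dimensional_vector_space (secondary_scale scl) Q.Basis_pair"
      unfolding scale by (rule Q.p.finite_dimensional_vector_space_axioms)
    show "Vector_Spaces.linear (secondary_scale scl) (secondary_scale scl)
      (\<lambda>a. secondary_bracket scl bracket a b)" for b
      unfolding Vector_Spaces.linear_iff using Q.p.vector_space_axioms
      by (auto simp: scale[symmetric] secondary_scale_def secondary_bracket_def bracket_simps
          scale_left_distrib scale_right_distrib scale_right_diff_distrib mult.commute
          split: prod.splits)
    show "Vector_Spaces.linear (secondary_scale scl) (secondary_scale scl)
      (secondary_bracket scl bracket a)" for a
      unfolding Vector_Spaces.linear_iff using Q.p.vector_space_axioms
      by (auto simp: scale[symmetric] secondary_scale_def secondary_bracket_def bracket_simps
          scale_left_distrib scale_right_distrib scale_right_diff_distrib mult.commute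
          split: prod.splits)
    show "secondary_bracket scl bracket a a = 0" for a
      by (auto simp: secondary_bracket_def bracket_same zero_prod_def split: prod.splits)
    show "secondary_bracket scl bracket a (secondary_bracket scl bracket b c) +
      secondary_bracket scl bracket b (secondary_bracket scl bracket c a) +
      secondary_bracket scl bracket c (secondary_bracket scl bracket a b) = 0" for a b c
    proof (cases a; cases b; cases c; clarify)
      fix u u' r v v' s w w' t
      have [simp]: "bracket w v = - bracket v w" "bracket w u = - bracket u w" "bracket v u = - bracket u v"
        by (rule skew)+
      show "secondary_bracket scl bracket (u, u', r) (secondary_bracket scl bracket (v, v', s) (w, w', t)) +
        secondary_bracket scl bracket (v, v', s) (secondary_bracket scl bracket (w, w', t) (u, u', r)) +
        secondary_bracket scl bracket (w, w', t) (secondary_bracket scl bracket (u, u', r) (v, v', s)) = 0"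
        using jacobi[of u v w]
        by (auto simp: secondary_bracket_def zero_prod_def bracket_simps minus algebra_simps)
    qed
  qed
  show "vector_space.dim (secondary_scale scl) UNIV = 2 * vector_space.dim scl UNIV + 1"
    using Q.dim_Times[of UNIV UNIV] P.dim_Times[of UNIV UNIV]
    by (simp add: scale dimension_eq_1)
qed

section \<open>Smooth functions and local coordinates\<close>

text \<open>
  Both spaces on which calculus is done below, the dual of a finite-dimensional vector space and
  the space of \<open>N\<close>-tuples, are finite-dimensional linear subspaces \<open>W\<close> of some function space
  \<open>'i \<Rightarrow> 'k\<close>; the topology of pointwise convergence induces on \<open>W\<close> its usual topology.

  For \<open>U\<close> open in \<open>W\<close>, a function on \<open>U\<close> is of class \<open>C\<^sup>k\<close> iff its iterated directional
  derivatives up to order \<open>k\<close> exist and are continuous. The derivatives are taken with respect to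
  the ground field, so over the complex numbers smooth means holomorphic.
\<close>

definition has_directional_derivative ::
  "(('i \<Rightarrow> 'k::real_normed_field) \<Rightarrow> 'k) \<Rightarrow> ('i \<Rightarrow> 'k) \<Rightarrow> ('i \<Rightarrow> 'k) \<Rightarrow> 'k \<Rightarrow> bool"
  where "has_directional_derivative f q w D \<longleftrightarrow>
    ((\<lambda>h. f (\<lambda>i. q i + h * w i)) has_field_derivative D) (at 0)"

primrec Ck_on ::
  "nat \<Rightarrow> ('i \<Rightarrow> 'k::real_normed_field) set \<Rightarrow> ('i \<Rightarrow> 'k) set \<Rightarrow> (('i \<Rightarrow> 'k) \<Rightarrow> 'k) \<Rightarrow> bool"
  where
    "Ck_on 0 W U f \<longleftrightarrow> continuous_on U f"
  | "Ck_on (Suc k) W U f \<longleftrightarrow> continuous_on U f \<and>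
      (\<forall>w\<in>W. \<exists>g. (\<forall>q\<in>U. has_directional_derivative f q w (g q)) \<and> Ck_on k W U g)"

definition smooth_on_open ::
  "('i \<Rightarrow> 'k::real_normed_field) set \<Rightarrow> ('i \<Rightarrow> 'k) set \<Rightarrow> (('i \<Rightarrow> 'k) \<Rightarrow> 'k) \<Rightarrow> bool"
  where "smooth_on_open W U f \<longleftrightarrow> openin (top_of_set W) U \<and> (\<forall>k. Ck_on k W U f)"

definition tuple_space :: "nat \<Rightarrow> (nat \<Rightarrow> 'k::zero) set"
  where "tuple_space N = {y. \<forall>i\<ge>N. y i = 0}"

definition local_coordinates ::
  "('k::real_normed_field \<Rightarrow> 'b::ab_group_add \<Rightarrow> 'b) \<Rightarrow> ('b \<Rightarrow> 'k) \<Rightarrow> ('b \<Rightarrow> 'k) set \<Rightarrow>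
   (('b \<Rightarrow> 'k) \<Rightarrow> nat \<Rightarrow> 'k) \<Rightarrow> bool"
  where "local_coordinates scl p U x \<longleftrightarrow> p \<in> U \<and>
    (\<exists>V \<psi>. U \<subseteq> dual_space scl \<and> V \<subseteq> tuple_space (vector_space.dim scl UNIV) \<and>
      homeomorphism U V x \<psi> \<and>
      (\<forall>i. smooth_on_open (dual_space scl) U (\<lambda>q. x q i)) \<and>
      (\<forall>b. smooth_on_open (tuple_space (vector_space.dim scl UNIV)) V (\<lambda>y. \<psi> y b)))"

section \<open>Bi-vectors and linear Poisson pairs on a dual space\<close>

text \<open>
  The cotangent space of the dual at any point is the bidual, that is the vector space
  \<open>'b\<close> itself. Hence the differential of a function at \<open>q\<close> is a vector of \<open>'b\<close>, and a bi-vector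
  at \<open>q\<close> is an alternating bilinear form on \<open>'b\<close>.
\<close>

definition differential ::
  "('k::real_normed_field \<Rightarrow> 'b::ab_group_add \<Rightarrow> 'b) \<Rightarrow> (('b \<Rightarrow> 'k) \<Rightarrow> 'k) \<Rightarrow> ('b \<Rightarrow> 'k) \<Rightarrow> 'b"
  where "differential scl f q =
    (THE a. \<forall>w\<in>dual_space scl. has_directional_derivative f q w (w a))"

type_synonym ('b, 'k) bivector_field = "('b \<Rightarrow> 'k) \<Rightarrow> 'b \<Rightarrow> 'b \<Rightarrow> 'k"

definition lie_poisson :: "('b \<Rightarrow> 'b \<Rightarrow> 'b) \<Rightarrow> ('b, 'k) bivector_field"
  where "lie_poisson bracket q a b = q (bracket a b)"

definition linear_poisson_pair ::
  "('k::field \<Rightarrow> 'b::ab_group_add \<Rightarrow> 'b) \<Rightarrow> ('b \<Rightarrow> 'b \<Rightarrow> 'b) \<Rightarrow>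
   ('b, 'k) bivector_field \<Rightarrow> ('b, 'k) bivector_field \<Rightarrow> bool"
  where "linear_poisson_pair scl bracket \<Lambda> \<Lambda>\<^sub>1 \<longleftrightarrow> \<Lambda> = lie_poisson bracket \<and>
    (\<exists>\<beta>. two_form scl \<beta> \<and> (\<forall>a b c. d_two bracket \<beta> a b c = 0) \<and> \<Lambda>\<^sub>1 = (\<lambda>q. \<beta>))"

definition generic_at ::
  "('k::real_or_complex \<Rightarrow> 'b::ab_group_add \<Rightarrow> 'b) \<Rightarrow>
   ('b, 'k) bivector_field \<Rightarrow> ('b, 'k) bivector_field \<Rightarrow> ('b \<Rightarrow> 'k) \<Rightarrow> bool"
  where "generic_at scl \<Lambda> \<Lambda>\<^sub>1 p \<longleftrightarrow> generic_couple scl (\<Lambda> p) (\<Lambda>\<^sub>1 p)"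

definition constant_coefficients ::
  "('k::real_normed_field \<Rightarrow> 'b::ab_group_add \<Rightarrow> 'b) \<Rightarrow> ('b, 'k) bivector_field \<Rightarrow>
   ('b \<Rightarrow> 'k) set \<Rightarrow> (('b \<Rightarrow> 'k) \<Rightarrow> nat \<Rightarrow> 'k) \<Rightarrow> bool"
  where "constant_coefficients scl \<Lambda> U x \<longleftrightarrow>
    (\<forall>i < vector_space.dim scl UNIV. \<forall>j < vector_space.dim scl UNIV.
      (\<lambda>q. \<Lambda> q (differential scl (\<lambda>r. x r i) q) (differential scl (\<lambda>r. x r j) q))
        constant_on U)"

definition flat_at ::
  "('k::real_normed_field \<Rightarrow> 'b::ab_group_add \<Rightarrow> 'b) \<Rightarrow>
   ('b, 'k) bivector_field \<Rightarrow> ('b, 'k) bivector_field \<Rightarrow> ('b \<Rightarrow> 'k) \<Rightarrow> bool"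
  where "flat_at scl \<Lambda> \<Lambda>\<^sub>1 p \<longleftrightarrow> (\<exists>U x. local_coordinates scl p U x \<and>
    constant_coefficients scl \<Lambda> U x \<and> constant_coefficients scl \<Lambda>\<^sub>1 U x)"

definition generic_pair ::
  "('k::real_or_complex \<Rightarrow> 'b::ab_group_add \<Rightarrow> 'b) \<Rightarrow>
   ('b, 'k) bivector_field \<Rightarrow> ('b, 'k) bivector_field \<Rightarrow> bool"
  where "generic_pair scl \<Lambda> \<Lambda>\<^sub>1 \<longleftrightarrow> (\<exists>p\<in>dual_space scl. generic_at scl \<Lambda> \<Lambda>\<^sub>1 p)"

definition flat_pair ::
  "('k::real_or_complex \<Rightarrow> 'b::ab_group_add \<Rightarrow> 'b) \<Rightarrow>
   ('b, 'k) bivector_field \<Rightarrow> ('b, 'k) bivector_field \<Rightarrow> bool"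
  where "flat_pair scl \<Lambda> \<Lambda>\<^sub>1 \<longleftrightarrow>
    (\<forall>p\<in>dual_space scl. generic_at scl \<Lambda> \<Lambda>\<^sub>1 p \<longrightarrow> flat_at scl \<Lambda> \<Lambda>\<^sub>1 p)"

end

theory Submission
  imports Defs "Jordan_Normal_Form.Determinant" "HOL-Library.Function_Algebras"
    "HOL-Computational_Algebra.Fundamental_Theorem_Algebra"
begin

text \<open>
  Write \<open>B = A \<times> A \<times> K\<close> for the secondary algebra and \<open>m = 2 n - 1\<close> for the dimension of \<open>A\<close>. The
  second bivector will be the value \<open>\<Lambda>(q)\<close> of the Lie--Poisson structure at a point \<open>q = (q\<^sub>0, q\<^sub>1, 0)\<close>
  of \<open>B\<^sup>*\<close>; it is exact, hence closed. The point of genericity is \<open>p = (0, p\<^sub>1, 0)\<close>. Along the pencil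
  \<open>\<Lambda>(s p + t q)\<close> one always deals with Lie--Poisson forms at points \<open>(x, y, 0)\<close>, where \<open>x = t q\<^sub>0\<close> and
  \<open>y = s p\<^sub>1 + t q\<^sub>1\<close>.

  Genericity. In odd dimension a skew form has a nonzero top power iff its kernel is a line
  (\<open>kernel_line_of_two_form_power\<close>, \<open>two_form_power_nonzero_of_kernel_line\<close>). Suppose that the kernel of
  \<open>dy\<close> is a line, spanned by \<open>c\<close>. If \<open>y(c) \<noteq> 0\<close>, so that \<open>y\<close> is a contact form, the kernel of the form at
  \<open>(x, y, 0)\<close> is a line for every \<open>x\<close>. If \<open>y(c) = 0\<close>, then \<open>y\<close> is \<open>y \<circ> ad v\<^sub>0\<close> for some \<open>v\<^sub>0\<close>, and by the
  Jacobi identity \<open>ad v\<^sub>0\<close> scales \<open>dy\<close> by the factor 1. The trace identity \<open>conformal_trace\<close> together with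
  unimodularity then gives \<open>[v\<^sub>0, c] = e c\<close> with \<open>2 e = - (m - 1)\<close>, in particular \<open>e \<noteq> 0\<close>, and the kernel
  is again a line as soon as \<open>x(c) \<noteq> 0\<close> (\<open>secondary_kernel_line\<close>). So one needs a pair \<open>(p\<^sub>1, q\<^sub>1)\<close> with
  \<open>(dp\<^sub>1, dq\<^sub>1)\<close> generic and a \<open>q\<^sub>0\<close> that does not vanish on the kernels of the non-contact members of
  the complex pencil. Take \<open>q\<^sub>1 = \<beta>\<close> and let \<open>p\<^sub>1\<close> be \<open>\<alpha>\<close> plus a small multiple of the given contact form;
  by compactness the pair stays generic, and \<open>p\<^sub>1\<close> is a contact form (\<open>contact_perturbation\<close>). Being
  contact is the nonvanishing of a determinant, so only finitely many members of the pencil through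
  \<open>p\<^sub>1\<close> fail, and a point \<open>q\<^sub>0\<close> of the moment curve avoids finitely many kernels (\<open>moment_functional\<close>).

  Non-flatness. Flat coordinates around \<open>p\<close> give, by differentiating the constant coefficients, linear
  maps \<open>N\<^sub>b\<close> of \<open>B\<close> for \<open>b\<close> in \<open>B\<^sup>*\<close>, with symmetric Christoffel symbols, such that for every \<open>z = p + t q\<close>
    \<open>z([N\<^sub>b u, w]) + z([u, N\<^sub>b w]) + b([u, w]) = 0\<close>
  (\<open>flat_connection\<close>). If \<open>b = z \<circ> ad u\<close>, then \<open>N\<^sub>b + ad u\<close> is infinitesimally symplectic for the form at
  \<open>z\<close>, and the trace identity yields \<open>tr N\<^sub>b = - tr (ad u)\<close> (\<open>flat_connection_trace\<close>). On the secondary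
  algebra \<open>tr (ad u)\<close> is \<open>- m\<close> times the last component of \<open>u\<close>, and it can be read off from \<open>b\<close>: with \<open>R\<^sub>t\<close>
  the Reeb vector of \<open>p\<^sub>1 + t q\<^sub>1\<close>, the result is
    \<open>tr N\<^sub>b = - m b(0, R\<^sub>t, 0)\<close>
  for every \<open>b\<close> that vanishes on the kernel of the form at \<open>p + t q\<close> (\<open>flat_secondary_trace\<close>). The left-hand
  side does not involve \<open>t\<close>. For two values of \<open>t\<close> the Reeb vectors are linearly independent, because
  a generic pair of 2-forms has no common kernel vector (\<open>no_common_kernel_vector\<close>); hence some \<open>b\<close> vanishes
  on both kernels and takes different values at the two vectors \<open>(0, R\<^sub>t, 0)\<close>. This is a contradiction.
\<close>

section \<open>Linear algebra in coordinates\<close>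

text \<open>
  Vectors and matrices are functions on the natural numbers that are only inspected below the
  dimension: the dimension varies in the arguments, and complex coordinates of a real Lie algebra
  need the same vocabulary.
\<close>

definition kernel_vec :: "nat \<Rightarrow> (nat \<Rightarrow> nat \<Rightarrow> 'f::field) \<Rightarrow> (nat \<Rightarrow> 'f) \<Rightarrow> bool"
  where "kernel_vec d W u \<longleftrightarrow> (\<forall>i<d. (\<Sum>j<d. W i j * u j) = 0)"

definition nonsingular :: "nat \<Rightarrow> (nat \<Rightarrow> nat \<Rightarrow> 'f::field) \<Rightarrow> bool"
  where "nonsingular d W \<longleftrightarrow> (\<forall>u. kernel_vec d W u \<longrightarrow> (\<forall>j<d. u j = 0))"

definition skew_matrix :: "nat \<Rightarrow> (nat \<Rightarrow> nat \<Rightarrow> 'f::field) \<Rightarrow> bool"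
  where "skew_matrix d W \<longleftrightarrow> (\<forall>i<d. \<forall>j<d. W i j = - W j i)"

definition kernel_line :: "nat \<Rightarrow> (nat \<Rightarrow> nat \<Rightarrow> 'f::field) \<Rightarrow> (nat \<Rightarrow> 'f) \<Rightarrow> bool"
  where "kernel_line d W c \<longleftrightarrow> kernel_vec d W c \<and> (\<exists>j<d. c j \<noteq> 0) \<and>
    (\<forall>u. kernel_vec d W u \<longrightarrow> (\<exists>l. \<forall>j<d. u j = l * c j))"

lemma kernel_vec_mat:
  "kernel_vec d W u \<longleftrightarrow> mat d d (\<lambda>(i, j). W i j) *\<^sub>v vec d u = 0\<^sub>v d"
  by (auto simp: kernel_vec_def Matrix.vec_eq_iff scalar_prod_def atLeast0LessThan)

lemma nonsingular_det: "nonsingular d W \<longleftrightarrow> Determinant.det (mat d d (\<lambda>(i, j). W i j)) \<noteq> 0"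
proof -
  have "Determinant.det (mat d d (\<lambda>(i, j). W i j)) = 0 \<longleftrightarrow>
      (\<exists>v. v \<in> carrier_vec d \<and> v \<noteq> 0\<^sub>v d \<and> mat d d (\<lambda>(i, j). W i j) *\<^sub>v v = 0\<^sub>v d)"
    by (rule det_0_iff_vec_prod_zero_field) simp
  also have "\<dots> \<longleftrightarrow> (\<exists>u. kernel_vec d W u \<and> (\<exists>j<d. u j \<noteq> 0))"
  proof
    assume "\<exists>v. v \<in> carrier_vec d \<and> v \<noteq> 0\<^sub>v d \<and> mat d d (\<lambda>(i, j). W i j) *\<^sub>v v = 0\<^sub>v d"
    then obtain v :: "'a Matrix.vec" where
      v: "v \<in> carrier_vec d" "v \<noteq> 0\<^sub>v d" "mat d d (\<lambda>(i, j). W i j) *\<^sub>v v = 0\<^sub>v d"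
      by blast
    have eq: "vec d (vec_index v) = v" using v(1) by (intro eq_vecI) auto
    then have "kernel_vec d W (vec_index v)" using v(3) by (simp only: kernel_vec_mat)
    moreover have "\<exists>j<d. vec_index v j \<noteq> 0"
    proof (rule ccontr)
      assume "\<not> ?thesis"
      then have "v = 0\<^sub>v d" using v(1) by (intro eq_vecI) auto
      with v(2) show False by simp
    qed
    ultimately show "\<exists>u. kernel_vec d W u \<and> (\<exists>j<d. u j \<noteq> 0)" by blast
  next
    assume "\<exists>u. kernel_vec d W u \<and> (\<exists>j<d. u j \<noteq> 0)"
    then obtain u j where u: "kernel_vec d W u" "j < d" "u j \<noteq> 0" by blast
    have "vec d u \<noteq> 0\<^sub>v d" using u(2,3) by (metis index_vec index_zero_vec(1))
    then show "\<exists>v. v \<in> carrier_vec d \<and> v \<noteq> 0\<^sub>v d \<and> mat d d (\<lambda>(i, j). W i j) *\<^sub>v v = 0\<^sub>v d"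
      using u(1) by (intro exI[of _ "vec d u"]) (simp add: kernel_vec_mat)
  qed
  finally show ?thesis unfolding nonsingular_def by blast
qed

lemma nonsingular_inverse:
  assumes "nonsingular d W"
  obtains T where "\<And>i k. i < d \<Longrightarrow> k < d \<Longrightarrow> (\<Sum>j<d. W i j * T j k) = (if i = k then 1 else 0)"
    and "\<And>i k. i < d \<Longrightarrow> k < d \<Longrightarrow> (\<Sum>j<d. T i j * W j k) = (if i = k then 1 else 0)"
proof -
  let ?A = "mat d d (\<lambda>(i, j). W i j)"
  have "?A \<in> Units (ring_mat TYPE('a) d ())"
    using assms by (intro det_non_zero_imp_unit) (auto simp: nonsingular_det)
  then obtain B where B: "B \<in> carrier_mat d d" "?A * B = 1\<^sub>m d" "B * ?A = 1\<^sub>m d"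
    by (auto simp: Units_def ring_mat_def)
  show thesis
  proof (rule that[of "\<lambda>i j. B $$ (i, j)"])
    fix i k assume ik: "i < d" "k < d"
    show "(\<Sum>j<d. W i j * B $$ (j, k)) = (if i = k then 1 else 0)"
      using arg_cong[OF B(2), of "\<lambda>M. M $$ (i, k)"] B(1) ik
      by (simp add: scalar_prod_def atLeast0LessThan)
    show "(\<Sum>j<d. B $$ (i, j) * W j k) = (if i = k then 1 else 0)"
      using arg_cong[OF B(3), of "\<lambda>M. M $$ (i, k)"] B(1) ik
      by (simp add: scalar_prod_def atLeast0LessThan)
  qed
qed

lemma right_inverse_nonsingular_transpose:
  assumes "\<And>i k. i < d \<Longrightarrow> k < d \<Longrightarrow> (\<Sum>j<d. T i j * W j k) = (if i = k then 1 else (0::'f::field))"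
  shows "nonsingular d W"
  unfolding nonsingular_def kernel_vec_def
proof (intro allI impI)
  fix u i assume u: "\<forall>i<d. (\<Sum>j<d. W i j * u j) = 0" and i: "i < d"
  have "u i = (\<Sum>k<d. (if i = k then 1 else 0) * u k)"
    using i by (simp add: if_distrib[of "\<lambda>x. x * _"] cong: if_cong)
  also have "\<dots> = (\<Sum>k<d. (\<Sum>j<d. T i j * W j k) * u k)"
    using assms i by (intro sum.cong) auto
  also have "\<dots> = (\<Sum>j<d. T i j * (\<Sum>k<d. W j k * u k))"
    by (simp add: sum_distrib_left sum_distrib_right mult.assoc) (rule sum.swap)
  also have "\<dots> = 0" using u by (intro sum.neutral) auto
  finally show "u i = 0" .
qed

lemma underdetermined_system:
  fixes A :: "nat \<Rightarrow> nat \<Rightarrow> 'f::field"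
  assumes "r < d"
  obtains u where "\<exists>j<d. u j \<noteq> 0" and "\<And>i. i < r \<Longrightarrow> (\<Sum>j<d. A i j * u j) = 0"
proof -
  define W where "W = (\<lambda>i j. if i < r then A i j else 0)"
  have "\<not> nonsingular d W"
  proof
    assume "nonsingular d W"
    then obtain T where T: "\<And>i k. i < d \<Longrightarrow> k < d \<Longrightarrow> (\<Sum>j<d. W i j * T j k) = (if i = k then 1 else 0)"
      and "\<And>i k. i < d \<Longrightarrow> k < d \<Longrightarrow> (\<Sum>j<d. T i j * W j k) = (if i = k then 1 else 0)"
      by (rule nonsingular_inverse) (rule that)
    show False using T[of r r] assms by (simp add: W_def)
  qed
  then obtain u where u: "kernel_vec d W u" "\<exists>j<d. u j \<noteq> 0" by (auto simp: nonsingular_def)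
  have "(\<Sum>j<d. A i j * u j) = 0" if "i < r" for i
  proof -
    have "(\<Sum>j<d. W i j * u j) = 0" using u(1) that assms by (simp add: kernel_vec_def)
    with that show ?thesis by (simp add: W_def)
  qed
  with u(2) show thesis by (rule that)
qed

text \<open>
  The determinant is a polynomial in the parameter, and it is not the zero polynomial.
\<close>

lemma singular_parameters_finite:
  fixes M :: "nat \<Rightarrow> nat \<Rightarrow> 'f::field poly"
  assumes "nonsingular d (\<lambda>i j. poly (M i j) z\<^sub>0)"
  shows "finite {z. \<not> nonsingular d (\<lambda>i j. poly (M i j) z)}"
proof -
  let ?D = "Determinant.det (mat d d (\<lambda>(i, j). M i j))"
  have ev: "Determinant.det (mat d d (\<lambda>(i, j). poly (M i j) z)) = poly ?D z" for z
  proof -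
    interpret comm_ring_hom "\<lambda>p::'f poly. poly p z" by standard auto
    have "map_mat (\<lambda>p. poly p z) (mat d d (\<lambda>(i, j). M i j)) = mat d d (\<lambda>(i, j). poly (M i j) z)"
      by auto
    then show ?thesis using hom_det[of "mat d d (\<lambda>(i, j). M i j)"] by simp
  qed
  have "?D \<noteq> 0" using assms ev[of z\<^sub>0] by (auto simp: nonsingular_det)
  then have "finite {z. poly ?D z = 0}" by (rule poly_roots_finite)
  then show ?thesis by (simp add: nonsingular_det ev)
qed

text \<open>
  Transposition multiplies the determinant of a skew matrix by \<open>(-1)\<^sup>d\<close>.
\<close>

lemma odd_skew_singular:
  fixes W :: "nat \<Rightarrow> nat \<Rightarrow> 'f::field_char_0"
  assumes "skew_matrix d W" "odd d"
  obtains c where "kernel_vec d W c" "\<exists>j<d. c j \<noteq> 0"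
proof -
  let ?A = "mat d d (\<lambda>(i, j). W i j)"
  have "transpose_mat ?A = (-1) \<cdot>\<^sub>m ?A"
  proof (rule eq_matI)
    fix i j assume "i < dim_row ((-1) \<cdot>\<^sub>m ?A)" "j < dim_col ((-1) \<cdot>\<^sub>m ?A)"
    then have ij: "i < d" "j < d" by auto
    then have "W j i = - W i j" using assms(1) unfolding skew_matrix_def by blast
    with ij show "transpose_mat ?A $$ (i, j) = ((-1) \<cdot>\<^sub>m ?A) $$ (i, j)" by simp
  qed auto
  then have "Determinant.det (transpose_mat ?A) = - Determinant.det ?A"
    using assms(2) by (simp add: det_smult)
  then have "Determinant.det ?A + Determinant.det ?A = 0"
    by (simp only: det_transpose[of ?A d, simplified] eq_neg_iff_add_eq_0)
  then have "2 * Determinant.det ?A = 0" by (simp only: mult_2)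
  then have "Determinant.det ?A = 0" by simp
  then have "\<not> nonsingular d W" by (simp add: nonsingular_det)
  then show thesis using that by (auto simp: nonsingular_def)
qed

lemma sum_delta_mult:
  fixes f :: "nat \<Rightarrow> 'f::field"
  assumes "i < d"
  shows "(\<Sum>k<d. (if i = k then 1 else 0) * f k) = f i"
    and "(\<Sum>k<d. f k * (if k = i then 1 else 0)) = f i"
    and "(\<Sum>k<d. f k * (if i = k then 1 else 0)) = f i"
proof -
  have *: "(\<Sum>k<d. if k = i then f k else 0) = f i" using assms by simp
  show "(\<Sum>k<d. (if i = k then 1 else 0) * f k) = f i"
    by (rule trans[OF _ *], rule sum.cong) auto
  show "(\<Sum>k<d. f k * (if k = i then 1 else 0)) = f i"
    by (rule trans[OF _ *], rule sum.cong) auto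
  show "(\<Sum>k<d. f k * (if i = k then 1 else 0)) = f i"
    by (rule trans[OF _ *], rule sum.cong) auto
qed

lemma skew_matrixD: "skew_matrix d W \<Longrightarrow> i < d \<Longrightarrow> j < d \<Longrightarrow> W i j = - W j i"
  unfolding skew_matrix_def by blast

lemma skew_kernel_left:
  assumes "skew_matrix d W" "kernel_vec d W c" "j < d"
  shows "(\<Sum>i<d. c i * W i j) = 0"
proof -
  have "(\<Sum>i<d. c i * W i j) = (\<Sum>i<d. - (W j i * c i))"
  proof (rule sum.cong)
    fix i assume "i \<in> {..<d}"
    then have "W i j = - W j i" using skew_matrixD[OF assms(1) _ assms(3)] by blast
    then show "c i * W i j = - (W j i * c i)" by (metis mult.commute mult_minus_right)
  qed simp
  also have "\<dots> = 0" using assms by (simp add: sum_negf kernel_vec_def)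
  finally show ?thesis .
qed

lemma exists_dual_vector:
  fixes c :: "nat \<Rightarrow> 'f::field"
  assumes "\<exists>j<d. c j \<noteq> 0"
  obtains a where "(\<Sum>i<d. a i * c i) = 1"
proof -
  obtain j where j: "j < d" "c j \<noteq> 0" using assms by blast
  have "(\<Sum>i<d. (if i = j then 1 / c j else 0) * c i) = (\<Sum>i<d. if i = j then 1 else 0)"
    using j by (intro sum.cong) auto
  also have "\<dots> = 1" using j by simp
  finally show thesis by (rule that)
qed

text \<open>
  Adding the square of a functional that does not vanish on the kernel fills the kernel of a skew
  matrix: pairing a kernel vector of the sum with \<open>c\<close> shows that \<open>a\<close> vanishes on it. This turns the
  contact condition into the nonvanishing of a determinant.
\<close>

lemma contact_matrix_nonsingular:
  assumes sk: "skew_matrix d W" and ker: "\<And>u. kernel_vec d W u \<Longrightarrow> (\<Sum>i<d. a i * u i) = 0 \<Longrightarrow> (\<forall>j<d. u j = 0)"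
    and c: "kernel_vec d W c" "(\<Sum>i<d. a i * c i) \<noteq> 0"
  shows "nonsingular d (\<lambda>i j. W i j + a i * a j)"
  unfolding nonsingular_def
proof (intro allI impI)
  fix u j assume u: "kernel_vec d (\<lambda>i j. W i j + a i * a j) u" and j: "j < d"
  define s where "s = (\<Sum>j<d. a j * u j)"
  have eq: "(\<Sum>j<d. W i j * u j) + a i * s = 0" if "i < d" for i
    using u that unfolding kernel_vec_def by (simp add: ring_distribs sum.distrib sum_distrib_left mult.assoc s_def)
  have "0 = (\<Sum>i<d. c i * ((\<Sum>j<d. W i j * u j) + a i * s))"
    by (rule sym, rule sum.neutral) (auto simp: eq)
  also have "\<dots> = (\<Sum>i<d. \<Sum>j<d. c i * W i j * u j) + (\<Sum>i<d. a i * c i) * s"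
    unfolding distrib_left sum.distrib sum_distrib_left sum_distrib_right by (simp add: mult_ac)
  also have "(\<Sum>i<d. \<Sum>j<d. c i * W i j * u j) = (\<Sum>j<d. (\<Sum>i<d. c i * W i j) * u j)"
    by (simp add: sum_distrib_right) (rule sum.swap)
  also have "\<dots> = 0" using skew_kernel_left[OF sk c(1)] by (intro sum.neutral) auto
  finally have s: "s = 0" using c(2) by simp
  then have "kernel_vec d W u" using eq by (simp add: kernel_vec_def)
  then show "u j = 0" using ker s[unfolded s_def] j by blast
qed

text \<open>
  The inverse on a complement of the kernel: \<open>a\<close> normalises \<open>c\<close>, and \<open>T\<close> inverts \<open>W\<close> up to the
  projections along \<open>c\<close> and \<open>a\<close>. It comes from the inverse of the nonsingular matrix \<open>W + a a\<^sup>T\<close>.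
\<close>

lemma skew_pseudo_inverse:
  fixes W :: "nat \<Rightarrow> nat \<Rightarrow> 'f::field"
  assumes sk: "skew_matrix d W" and c: "kernel_line d W c" and a: "(\<Sum>i<d. a i * c i) = 1"
  obtains T where "\<And>i k. i < d \<Longrightarrow> k < d \<Longrightarrow> (\<Sum>j<d. W i j * T j k) = (if i = k then 1 else 0) - a i * c k"
    and "\<And>i k. i < d \<Longrightarrow> k < d \<Longrightarrow> (\<Sum>j<d. T i j * W j k) = (if i = k then 1 else 0) - c i * a k"
proof -
  let ?M = "\<lambda>i j. W i j + a i * a j"
  have kc: "kernel_vec d W c" using c by (simp add: kernel_line_def)
  have "nonsingular d ?M"
  proof (rule contact_matrix_nonsingular[OF sk _ kc])
    fix u assume u: "kernel_vec d W u" "(\<Sum>i<d. a i * u i) = 0"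
    obtain l where l: "\<And>j. j < d \<Longrightarrow> u j = l * c j" using c u(1) by (auto simp: kernel_line_def)
    have "(\<Sum>i<d. a i * u i) = l * (\<Sum>i<d. a i * c i)"
      by (simp add: l sum_distrib_left mult_ac)
    with u(2) a have "l = 0" by simp
    with l show "\<forall>j<d. u j = 0" by simp
  qed (simp add: a)
  then obtain T where T: "\<And>i k. i < d \<Longrightarrow> k < d \<Longrightarrow> (\<Sum>j<d. ?M i j * T j k) = (if i = k then 1 else 0)"
    and T': "\<And>i k. i < d \<Longrightarrow> k < d \<Longrightarrow> (\<Sum>j<d. T i j * ?M j k) = (if i = k then 1 else 0)"
    by (rule nonsingular_inverse) (rule that)
  have Mc: "(\<Sum>k<d. ?M j k * c k) = a j" if "j < d" for j
  proof -
    have "(\<Sum>k<d. ?M j k * c k) = (\<Sum>k<d. W j k * c k) + a j * (\<Sum>k<d. a k * c k)"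
      by (simp add: ring_distribs sum.distrib sum_distrib_left mult.assoc)
    then show ?thesis using kc that a by (simp add: kernel_vec_def)
  qed
  have cM: "(\<Sum>i<d. c i * ?M i j) = a j" if "j < d" for j
  proof -
    have "(\<Sum>i<d. c i * ?M i j) = (\<Sum>i<d. c i * W i j) + (\<Sum>i<d. a i * c i) * a j"
      unfolding ring_distribs sum.distrib sum_distrib_right by (simp add: mult_ac)
    then show ?thesis using skew_kernel_left[OF sk kc that] a by simp
  qed
  have Ta: "(\<Sum>j<d. T i j * a j) = c i" if "i < d" for i
  proof -
    have "(\<Sum>j<d. T i j * a j) = (\<Sum>j<d. T i j * (\<Sum>k<d. ?M j k * c k))"
      using Mc by (intro sum.cong) auto
    also have "\<dots> = (\<Sum>k<d. (\<Sum>j<d. T i j * ?M j k) * c k)"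
      unfolding sum_distrib_left sum_distrib_right mult.assoc by (rule sum.swap)
    also have "\<dots> = (\<Sum>k<d. (if i = k then 1 else 0) * c k)"
      using T' that by (intro sum.cong) auto
    also have "\<dots> = c i" using sum_delta_mult(1)[OF that] .
    finally show ?thesis .
  qed
  have aT: "(\<Sum>j<d. a j * T j k) = c k" if "k < d" for k
  proof -
    have "(\<Sum>j<d. a j * T j k) = (\<Sum>j<d. (\<Sum>i<d. c i * ?M i j) * T j k)"
      using cM by (intro sum.cong) auto
    also have "\<dots> = (\<Sum>i<d. c i * (\<Sum>j<d. ?M i j * T j k))"
      unfolding sum_distrib_left sum_distrib_right mult.assoc by (rule sum.swap)
    also have "\<dots> = (\<Sum>i<d. c i * (if i = k then 1 else 0))"
      using T that by (intro sum.cong) auto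
    also have "\<dots> = c k" using sum_delta_mult(2)[OF that] .
    finally show ?thesis .
  qed
  show thesis
  proof (rule that[of T])
    fix i k assume ik: "i < d" "k < d"
    have "(if i = k then 1 else 0) = (\<Sum>j<d. ?M i j * T j k)" using T ik by simp
    also have "\<dots> = (\<Sum>j<d. W i j * T j k) + a i * (\<Sum>j<d. a j * T j k)"
      by (simp add: ring_distribs sum.distrib sum_distrib_left mult.assoc)
    finally show "(\<Sum>j<d. W i j * T j k) = (if i = k then 1 else 0) - a i * c k"
      using aT ik by simp
    have "(if i = k then 1 else 0) = (\<Sum>j<d. T i j * ?M j k)" using T' ik by simp
    also have "\<dots> = (\<Sum>j<d. T i j * W j k) + (\<Sum>j<d. T i j * a j) * a k"
      by (simp add: ring_distribs sum.distrib sum_distrib_right mult.assoc)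
    finally show "(\<Sum>j<d. T i j * W j k) = (if i = k then 1 else 0) - c i * a k"
      using Ta ik by simp
  qed
qed

lemma skew_image_eq_annihilator:
  fixes W :: "nat \<Rightarrow> nat \<Rightarrow> 'f::field"
  assumes sk: "skew_matrix d W" and c: "kernel_line d W c" and b: "(\<Sum>i<d. b i * c i) = 0"
  obtains u where "\<And>i. i < d \<Longrightarrow> (\<Sum>j<d. W i j * u j) = b i"
proof -
  obtain a where a: "(\<Sum>i<d. a i * c i) = 1"
    using exists_dual_vector[of d c] c by (auto simp: kernel_line_def)
  obtain T where T: "\<And>i k. i < d \<Longrightarrow> k < d \<Longrightarrow> (\<Sum>j<d. W i j * T j k) = (if i = k then 1 else 0) - a i * c k"
    and "\<And>i k. i < d \<Longrightarrow> k < d \<Longrightarrow> (\<Sum>j<d. T i j * W j k) = (if i = k then 1 else 0) - c i * a k"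
    by (rule skew_pseudo_inverse[OF sk c a]) (rule that)
  show thesis
  proof (rule that[of "\<lambda>j. \<Sum>k<d. T j k * b k"])
    fix i assume i: "i < d"
    have "(\<Sum>j<d. W i j * (\<Sum>k<d. T j k * b k)) = (\<Sum>k<d. (\<Sum>j<d. W i j * T j k) * b k)"
      unfolding sum_distrib_left sum_distrib_right mult.assoc by (rule sum.swap)
    also have "\<dots> = (\<Sum>k<d. (if i = k then 1 else 0) * b k - a i * (b k * c k))"
      using T i by (intro sum.cong) (auto simp: ring_distribs)
    also have "\<dots> = b i - a i * (\<Sum>k<d. b k * c k)"
      unfolding sum_subtractf sum_delta_mult(1)[OF i] by (simp add: sum_distrib_left)
    finally show "(\<Sum>j<d. W i j * (\<Sum>k<d. T j k * b k)) = b i" using b by simp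
  qed
qed

text \<open>
  If \<open>P\<close> scales the form \<open>W\<close> infinitesimally by \<open>t\<close>, it preserves the kernel line, and on the quotient,
  where the form is symplectic, twice its trace is \<open>t\<close> times the dimension. Contracting the hypothesis
  with a pseudo-inverse of \<open>W\<close> gives this without quotients. The identity is used twice: it shows
  that an eigenvalue is nonzero (genericity), and it computes the trace of a flat connection.
\<close>

lemma conformal_trace:
  fixes W P :: "nat \<Rightarrow> nat \<Rightarrow> 'f::field"
  assumes sk: "skew_matrix d W" and c: "kernel_line d W c"
    and conf: "\<And>i j. i < d \<Longrightarrow> j < d \<Longrightarrow> (\<Sum>k<d. P k i * W k j + W i k * P k j) = t * W i j"
  obtains e where "\<And>i. i < d \<Longrightarrow> (\<Sum>j<d. P i j * c j) = e * c i"
    and "2 * ((\<Sum>i<d. P i i) - e) = t * (of_nat d - 1)"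
proof -
  have kc: "kernel_vec d W c" using c by (simp add: kernel_line_def)
  have "kernel_vec d W (\<lambda>k. \<Sum>j<d. P k j * c j)"
    unfolding kernel_vec_def
  proof (intro allI impI)
    fix i assume i: "i < d"
    have "(\<Sum>k<d. W i k * (\<Sum>j<d. P k j * c j)) = (\<Sum>j<d. (\<Sum>k<d. W i k * P k j) * c j)"
      unfolding sum_distrib_left sum_distrib_right mult.assoc by (rule sum.swap)
    also have "\<dots> = (\<Sum>j<d. t * (W i j * c j) - (\<Sum>k<d. P k i * (W k j * c j)))"
    proof (rule sum.cong)
      fix j assume "j \<in> {..<d}"
      then have "(\<Sum>k<d. W i k * P k j) = t * W i j - (\<Sum>k<d. P k i * W k j)"
        using conf[of i j] i unfolding sum.distrib by (simp add: algebra_simps)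
      then show "(\<Sum>k<d. W i k * P k j) * c j = t * (W i j * c j) - (\<Sum>k<d. P k i * (W k j * c j))"
        by (simp add: ring_distribs sum_distrib_right mult.assoc)
    qed simp
    also have "\<dots> = t * (\<Sum>j<d. W i j * c j) - (\<Sum>j<d. \<Sum>k<d. P k i * (W k j * c j))"
      unfolding sum_subtractf sum_distrib_left ..
    also have "(\<Sum>j<d. \<Sum>k<d. P k i * (W k j * c j)) = (\<Sum>k<d. P k i * (\<Sum>j<d. W k j * c j))"
      unfolding sum_distrib_left by (rule sum.swap)
    also have "\<dots> = 0" using kc by (simp add: kernel_vec_def)
    finally show "(\<Sum>k<d. W i k * (\<Sum>j<d. P k j * c j)) = 0"
      using kc i by (simp add: kernel_vec_def)
  qed
  then have "\<exists>e. \<forall>i<d. (\<Sum>j<d. P i j * c j) = e * c i"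
    using c unfolding kernel_line_def by (elim conjE allE impE) assumption+
  then obtain e where e: "\<And>i. i < d \<Longrightarrow> (\<Sum>j<d. P i j * c j) = e * c i" by blast
  obtain a where a: "(\<Sum>i<d. a i * c i) = 1"
    using exists_dual_vector[of d c] c by (auto simp: kernel_line_def)
  obtain T where T: "\<And>i k. i < d \<Longrightarrow> k < d \<Longrightarrow> (\<Sum>j<d. W i j * T j k) = (if i = k then 1 else 0) - a i * c k"
    and T': "\<And>i k. i < d \<Longrightarrow> k < d \<Longrightarrow> (\<Sum>j<d. T i j * W j k) = (if i = k then 1 else 0) - c i * a k"
    by (rule skew_pseudo_inverse[OF sk c a]) (rule that)
  have ePc: "(\<Sum>k<d. a k * (\<Sum>j<d. P k j * c j)) = e"
  proof -
    have "(\<Sum>k<d. a k * (\<Sum>j<d. P k j * c j)) = (\<Sum>k<d. e * (a k * c k))"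
      by (intro sum.cong refl) (simp add: e)
    then have "(\<Sum>k<d. a k * (\<Sum>j<d. P k j * c j)) = e * (\<Sum>k<d. a k * c k)"
      by (simp only: sum_distrib_left)
    then show ?thesis using a by simp
  qed
  \<comment> \<open>both halves of the hypothesis contribute the trace on the quotient by the kernel\<close>
  have first: "(\<Sum>i<d. \<Sum>j<d. (\<Sum>k<d. P k i * W k j) * T j i) = (\<Sum>i<d. P i i) - e"
  proof -
    have "(\<Sum>i<d. \<Sum>j<d. (\<Sum>k<d. P k i * W k j) * T j i)
        = (\<Sum>i<d. \<Sum>k<d. P k i * (\<Sum>j<d. W k j * T j i))"
      unfolding sum_distrib_left sum_distrib_right mult.assoc
      by (rule sum.cong[OF refl]) (rule sum.swap)
    also have "\<dots> = (\<Sum>i<d. \<Sum>k<d. P k i * (if k = i then 1 else 0) - a k * (P k i * c i))"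
      using T by (intro sum.cong refl) (auto simp: ring_distribs)
    also have "\<dots> = (\<Sum>i<d. P i i) - (\<Sum>i<d. \<Sum>k<d. a k * (P k i * c i))"
      unfolding sum_subtractf by (intro arg_cong2[of _ _ _ _ "(-)"] sum.cong refl sum_delta_mult(2)) auto
    also have "(\<Sum>i<d. \<Sum>k<d. a k * (P k i * c i)) = (\<Sum>k<d. a k * (\<Sum>j<d. P k j * c j))"
      unfolding sum_distrib_left by (rule sum.swap)
    finally show ?thesis using ePc by simp
  qed
  have second: "(\<Sum>i<d. \<Sum>j<d. (\<Sum>k<d. W i k * P k j) * T j i) = (\<Sum>i<d. P i i) - e"
  proof -
    have "(\<Sum>i<d. \<Sum>j<d. (\<Sum>k<d. W i k * P k j) * T j i)
        = (\<Sum>i<d. \<Sum>j<d. \<Sum>k<d. P k j * (T j i * W i k))"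
      unfolding sum_distrib_right by (intro sum.cong refl) (simp add: mult_ac)
    also have "\<dots> = (\<Sum>j<d. \<Sum>i<d. \<Sum>k<d. P k j * (T j i * W i k))" by (rule sum.swap)
    also have "\<dots> = (\<Sum>j<d. \<Sum>k<d. P k j * (\<Sum>i<d. T j i * W i k))"
      unfolding sum_distrib_left by (intro sum.cong refl sum.swap)
    also have "\<dots> = (\<Sum>j<d. \<Sum>k<d. P k j * (if k = j then 1 else 0) - a k * (P k j * c j))"
      using T' by (intro sum.cong refl) (auto simp: ring_distribs)
    also have "\<dots> = (\<Sum>j<d. P j j) - (\<Sum>j<d. \<Sum>k<d. a k * (P k j * c j))"
      unfolding sum_subtractf by (intro arg_cong2[of _ _ _ _ "(-)"] sum.cong refl sum_delta_mult(2)) auto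
    also have "(\<Sum>j<d. \<Sum>k<d. a k * (P k j * c j)) = (\<Sum>k<d. a k * (\<Sum>j<d. P k j * c j))"
      unfolding sum_distrib_left by (rule sum.swap)
    finally show ?thesis using ePc by simp
  qed
  have "2 * ((\<Sum>i<d. P i i) - e) = (\<Sum>i<d. \<Sum>j<d. (\<Sum>k<d. P k i * W k j + W i k * P k j) * T j i)"
    unfolding sum.distrib distrib_right first second by simp
  also have "\<dots> = (\<Sum>i<d. \<Sum>j<d. t * (W i j * T j i))"
    using conf by (intro sum.cong refl) (auto simp: mult.assoc)
  also have "\<dots> = t * (\<Sum>i<d. \<Sum>j<d. W i j * T j i)" by (simp add: sum_distrib_left)
  also have "(\<Sum>i<d. \<Sum>j<d. W i j * T j i) = (\<Sum>i<d. 1 - a i * c i)"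
    using T by (intro sum.cong refl) auto
  also have "\<dots> = of_nat d - 1" using a by (simp add: sum_subtractf)
  finally show thesis using that e by blast
qed

section \<open>Powers of 2-forms\<close>

text \<open>
  The map \<open>h\<close> embeds the ground field into the field of values: it is the identity for ordinary forms
  and the inclusion into the complex numbers for complexified ones. A form ignores all arguments
  from position \<open>k\<close> on.
\<close>

definition multilinear_form ::
  "('k \<Rightarrow> 'v::ab_group_add \<Rightarrow> 'v) \<Rightarrow> ('k \<Rightarrow> 'f::field_char_0) \<Rightarrow> nat \<Rightarrow> ((nat \<Rightarrow> 'v) \<Rightarrow> 'f) \<Rightarrow> bool"
  where "multilinear_form scl h k \<theta> \<longleftrightarrow>
    (\<forall>v w. (\<forall>i<k. v i = w i) \<longrightarrow> \<theta> v = \<theta> w) \<and>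
    (\<forall>j<k. \<forall>v a b. \<theta> (v(j := a + b)) = \<theta> (v(j := a)) + \<theta> (v(j := b))) \<and>
    (\<forall>j<k. \<forall>v c a. \<theta> (v(j := scl c a)) = h c * \<theta> (v(j := a)))"

definition alternating_form :: "nat \<Rightarrow> ((nat \<Rightarrow> 'v) \<Rightarrow> 'f::field_char_0) \<Rightarrow> bool"
  where "alternating_form k \<theta> \<longleftrightarrow>
    (\<forall>v \<sigma>. \<sigma> permutes {..<k} \<longrightarrow> \<theta> (\<lambda>i. v (\<sigma> i)) = of_int (sign \<sigma>) * \<theta> v)"

lemma multilinear_formD:
  assumes "multilinear_form scl h k \<theta>"
  shows "(\<And>i. i < k \<Longrightarrow> v i = w i) \<Longrightarrow> \<theta> v = \<theta> w"
    and "j < k \<Longrightarrow> \<theta> (v(j := a + b)) = \<theta> (v(j := a)) + \<theta> (v(j := b))"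
    and "j < k \<Longrightarrow> \<theta> (v(j := scl c a)) = h c * \<theta> (v(j := a))"
  using assms unfolding multilinear_form_def by blast+

lemma multilinear_form_zero:
  assumes "multilinear_form scl h k \<theta>" "j < k"
  shows "\<theta> (v(j := 0)) = 0"
  using multilinear_formD(2)[OF assms, of v 0 0] by simp

lemma multilinear_form_sum:
  assumes "multilinear_form scl h k \<theta>" "j < k" "finite I"
  shows "\<theta> (v(j := \<Sum>i\<in>I. scl (c i) (x i))) = (\<Sum>i\<in>I. h (c i) * \<theta> (v(j := x i)))"
  using assms(3)
  by induction (simp_all add: multilinear_form_zero[OF assms(1,2)] multilinear_formD(2)[OF assms(1,2)]
      multilinear_formD(3)[OF assms(1,2)] del: fun_upd_apply)

lemma alternating_form_repeated:
  assumes "alternating_form k \<theta>" "i < k" "j < k" "i \<noteq> j" "v i = v j"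
  shows "\<theta> v = 0"
proof -
  have "Transposition.transpose i j permutes {..<k}" using assms by (intro permutes_swap_id) auto
  then have "\<theta> (\<lambda>l. v (Transposition.transpose i j l)) = of_int (sign (Transposition.transpose i j)) * \<theta> v"
    using assms(1) unfolding alternating_form_def by blast
  moreover have "(\<lambda>l. v (Transposition.transpose i j l)) = v"
    using assms(5) by (auto simp: Transposition.transpose_def fun_eq_iff)
  ultimately have "\<theta> v = - \<theta> v" using assms(4) by (simp add: sign_swap_id)
  then have "\<theta> v + \<theta> v = 0" by (simp only: eq_neg_iff_add_eq_0)
  then show ?thesis by (simp only: mult_2[symmetric] mult_eq_0_iff) simp
qed

lemma wedge_split_slot:
  fixes \<sigma> :: "nat \<Rightarrow> nat" and j k :: nat
  assumes "\<sigma> permutes S"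
  shows "(\<lambda>i. (v(j := a)) (\<sigma> i)) = (\<lambda>i. v (\<sigma> i))(inv_into UNIV \<sigma> j := a)"
    and "inv_into UNIV \<sigma> j < k \<Longrightarrow> (\<lambda>i. (v(j := a)) (\<sigma> (k + i))) = (\<lambda>i. v (\<sigma> (k + i)))"
    and "k \<le> inv_into UNIV \<sigma> j \<Longrightarrow>
      (\<lambda>i. (v(j := a)) (\<sigma> (k + i))) = (\<lambda>i. v (\<sigma> (k + i)))(inv_into UNIV \<sigma> j - k := a)"
proof -
  have eq: "\<sigma> i = j \<longleftrightarrow> i = inv_into UNIV \<sigma> j" for i
    using permutes_inverses[OF assms] by metis
  show "(\<lambda>i. (v(j := a)) (\<sigma> i)) = (\<lambda>i. v (\<sigma> i))(inv_into UNIV \<sigma> j := a)"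
    by (auto simp: fun_eq_iff eq)
  show "inv_into UNIV \<sigma> j < k \<Longrightarrow> (\<lambda>i. (v(j := a)) (\<sigma> (k + i))) = (\<lambda>i. v (\<sigma> (k + i)))"
    by (auto simp: fun_eq_iff eq)
  show "k \<le> inv_into UNIV \<sigma> j \<Longrightarrow>
      (\<lambda>i. (v(j := a)) (\<sigma> (k + i))) = (\<lambda>i. v (\<sigma> (k + i)))(inv_into UNIV \<sigma> j - k := a)"
    by (auto simp: fun_eq_iff eq)
qed

lemma permutes_inv_less:
  assumes "\<sigma> permutes {..<n}" "j < n"
  shows "inv_into UNIV \<sigma> j < (n::nat)"
  using permutes_in_image[OF permutes_inv[OF assms(1)], of j] assms(2) by simp

lemma permutes_less:
  assumes "\<sigma> permutes {..<n}" "j < n"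
  shows "\<sigma> j < (n::nat)"
  using permutes_in_image[OF assms(1), of j] assms(2) by simp

lemma multilinear_form_wedge:
  fixes \<theta> \<eta> :: "(nat \<Rightarrow> 'v::ab_group_add) \<Rightarrow> 'f::field_char_0"
  assumes \<theta>: "multilinear_form scl h k \<theta>" and \<eta>: "multilinear_form scl h l \<eta>"
  shows "multilinear_form scl h (k + l) (wedge k l \<theta> \<eta>)"
  unfolding multilinear_form_def
proof (intro conjI allI impI)
  fix v w :: "nat \<Rightarrow> 'v" assume vw: "\<forall>i<k + l. v i = w i"
  show "wedge k l \<theta> \<eta> v = wedge k l \<theta> \<eta> w"
    unfolding wedge_def
  proof (intro arg_cong2[of _ _ _ _ "(/)"] sum.cong refl)
    fix \<sigma> assume "\<sigma> \<in> {\<sigma>. \<sigma> permutes {..<k + l}}"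
    then have \<sigma>: "\<sigma> permutes {..<k + l}" by simp
    have "\<theta> (\<lambda>i. v (\<sigma> i)) = \<theta> (\<lambda>i. w (\<sigma> i))"
      by (rule multilinear_formD(1)[OF \<theta>]) (use vw permutes_less[OF \<sigma>] in auto)
    moreover have "\<eta> (\<lambda>i. v (\<sigma> (k + i))) = \<eta> (\<lambda>i. w (\<sigma> (k + i)))"
      by (rule multilinear_formD(1)[OF \<eta>]) (use vw permutes_less[OF \<sigma>] in auto)
    ultimately show "of_int (sign \<sigma>) * \<theta> (\<lambda>i. v (\<sigma> i)) * \<eta> (\<lambda>i. v (\<sigma> (k + i))) =
      of_int (sign \<sigma>) * \<theta> (\<lambda>i. w (\<sigma> i)) * \<eta> (\<lambda>i. w (\<sigma> (k + i)))" by simp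
  qed
next
  fix j v a b assume j: "j < k + l"
  have "of_int (sign \<sigma>) * \<theta> (\<lambda>i. (v(j := a + b)) (\<sigma> i)) * \<eta> (\<lambda>i. (v(j := a + b)) (\<sigma> (k + i)))
     = of_int (sign \<sigma>) * \<theta> (\<lambda>i. (v(j := a)) (\<sigma> i)) * \<eta> (\<lambda>i. (v(j := a)) (\<sigma> (k + i)))
     + of_int (sign \<sigma>) * \<theta> (\<lambda>i. (v(j := b)) (\<sigma> i)) * \<eta> (\<lambda>i. (v(j := b)) (\<sigma> (k + i)))"
    if \<sigma>: "\<sigma> permutes {..<k + l}" for \<sigma>
  proof (cases "inv_into UNIV \<sigma> j < k")
    case True
    show ?thesis
      unfolding wedge_split_slot(1)[OF \<sigma>] wedge_split_slot(2)[OF \<sigma> True]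
        multilinear_formD(2)[OF \<theta> True] by (simp only: ring_distribs)
  next
    case False
    then have ge: "k \<le> inv_into UNIV \<sigma> j" by simp
    have less: "inv_into UNIV \<sigma> j - k < l" using permutes_inv_less[OF \<sigma> j] ge by simp
    have \<theta>_eq: "\<theta> (\<lambda>i. (v(j := x)) (\<sigma> i)) = \<theta> (\<lambda>i. v (\<sigma> i))" for x
      by (rule multilinear_formD(1)[OF \<theta>]) (use ge permutes_inverses[OF \<sigma>] in auto)
    show ?thesis
      unfolding \<theta>_eq wedge_split_slot(3)[OF \<sigma> ge] multilinear_formD(2)[OF \<eta> less]
      by (simp only: ring_distribs)
  qed
  then show "wedge k l \<theta> \<eta> (v(j := a + b)) = wedge k l \<theta> \<eta> (v(j := a)) + wedge k l \<theta> \<eta> (v(j := b))"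
    unfolding wedge_def add_divide_distrib[symmetric] sum.distrib[symmetric]
    by (intro arg_cong2[of _ _ _ _ "(/)"] sum.cong refl) simp
next
  fix j v c a assume j: "j < k + l"
  have "of_int (sign \<sigma>) * \<theta> (\<lambda>i. (v(j := scl c a)) (\<sigma> i)) * \<eta> (\<lambda>i. (v(j := scl c a)) (\<sigma> (k + i)))
     = h c * (of_int (sign \<sigma>) * \<theta> (\<lambda>i. (v(j := a)) (\<sigma> i)) * \<eta> (\<lambda>i. (v(j := a)) (\<sigma> (k + i))))"
    if \<sigma>: "\<sigma> permutes {..<k + l}" for \<sigma>
  proof (cases "inv_into UNIV \<sigma> j < k")
    case True
    show ?thesis
      unfolding wedge_split_slot(1)[OF \<sigma>] wedge_split_slot(2)[OF \<sigma> True]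
        multilinear_formD(3)[OF \<theta> True] by (simp only: mult_ac)
  next
    case False
    then have ge: "k \<le> inv_into UNIV \<sigma> j" by simp
    have less: "inv_into UNIV \<sigma> j - k < l" using permutes_inv_less[OF \<sigma> j] ge by simp
    have \<theta>_eq: "\<theta> (\<lambda>i. (v(j := x)) (\<sigma> i)) = \<theta> (\<lambda>i. v (\<sigma> i))" for x
      by (rule multilinear_formD(1)[OF \<theta>]) (use ge permutes_inverses[OF \<sigma>] in auto)
    show ?thesis
      unfolding \<theta>_eq wedge_split_slot(3)[OF \<sigma> ge] multilinear_formD(3)[OF \<eta> less]
      by (simp only: mult_ac)
  qed
  then show "wedge k l \<theta> \<eta> (v(j := scl c a)) = h c * wedge k l \<theta> \<eta> (v(j := a))"
    unfolding wedge_def times_divide_eq_right sum_distrib_left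
    by (intro arg_cong2[of _ _ _ _ "(/)"] sum.cong refl) simp
qed

lemma alternating_form_wedge:
  fixes \<theta> \<eta> :: "(nat \<Rightarrow> 'v) \<Rightarrow> 'f::field_char_0"
  shows "alternating_form (k + l) (wedge k l \<theta> \<eta>)"
  unfolding alternating_form_def
proof (intro allI impI)
  fix v :: "nat \<Rightarrow> 'v" and \<tau> :: "nat \<Rightarrow> nat" assume \<tau>: "\<tau> permutes {..<k + l}"
  let ?t = "\<lambda>\<sigma>. of_int (sign \<sigma>) * \<theta> (\<lambda>i. v (\<sigma> i)) * \<eta> (\<lambda>i. v (\<sigma> (k + i)))"
  have sg: "sign (\<tau> \<circ> \<sigma>) = sign \<tau> * sign \<sigma>" if "\<sigma> permutes {..<k + l}" for \<sigma>
    using that \<tau> by (intro sign_compose permutation_permutes[THEN iffD2] exI[of _ "{..<k + l}"] conjI) auto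
  have sq: "of_int (sign \<tau>) * of_int (sign \<tau>) = (1::'f)" by (simp add: sign_def)
  have "(\<Sum>\<sigma> | \<sigma> permutes {..<k + l}. of_int (sign \<sigma>) * \<theta> (\<lambda>i. v (\<tau> (\<sigma> i))) * \<eta> (\<lambda>i. v (\<tau> (\<sigma> (k + i)))))
     = (\<Sum>\<sigma> | \<sigma> permutes {..<k + l}. of_int (sign \<tau>) * ?t (\<tau> \<circ> \<sigma>))"
    by (intro sum.cong refl) (auto simp: sg sq mult.assoc[symmetric])
  also have "\<dots> = of_int (sign \<tau>) * (\<Sum>\<sigma> | \<sigma> permutes {..<k + l}. ?t \<sigma>)"
    unfolding sum_distrib_left by (rule setum_permutations_compose_left[OF \<tau>, symmetric])
  finally show "wedge k l \<theta> \<eta> (\<lambda>i. v (\<tau> i)) = of_int (sign \<tau>) * wedge k l \<theta> \<eta> v"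
    unfolding wedge_def times_divide_eq_right by (rule arg_cong)
qed

lemma wedge_radical:
  assumes \<theta>: "\<And>v j. j < k \<Longrightarrow> v j = r \<Longrightarrow> \<theta> v = 0" and \<eta>: "\<And>v j. j < l \<Longrightarrow> v j = r \<Longrightarrow> \<eta> v = 0"
    and j: "j < k + l" "v j = r"
  shows "wedge k l \<theta> \<eta> v = 0"
proof -
  have "\<theta> (\<lambda>i. v (\<sigma> i)) * \<eta> (\<lambda>i. v (\<sigma> (k + i))) = 0" if \<sigma>: "\<sigma> permutes {..<k + l}" for \<sigma>
  proof (cases "inv_into UNIV \<sigma> j < k")
    case True
    then show ?thesis using \<theta>[of "inv_into UNIV \<sigma> j" "\<lambda>i. v (\<sigma> i)"] permutes_inverses[OF \<sigma>] j by simp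
  next
    case False
    moreover have "inv_into UNIV \<sigma> j - k < l" using permutes_inv_less[OF \<sigma> j(1)] False by simp
    ultimately show ?thesis
      using \<eta>[of "inv_into UNIV \<sigma> j - k" "\<lambda>i. v (\<sigma> (k + i))"] permutes_inverses[OF \<sigma>] j by simp
  qed
  then show ?thesis unfolding wedge_def by (auto simp: mult.assoc intro!: sum.neutral)
qed

definition bilinear_alternating ::
  "('k \<Rightarrow> 'v::ab_group_add \<Rightarrow> 'v) \<Rightarrow> ('k \<Rightarrow> 'f::field_char_0) \<Rightarrow> ('v \<Rightarrow> 'v \<Rightarrow> 'f) \<Rightarrow> bool"
  where "bilinear_alternating scl h \<omega> \<longleftrightarrow>
    (\<forall>a b c. \<omega> (a + b) c = \<omega> a c + \<omega> b c) \<and> (\<forall>a b c. \<omega> a (b + c) = \<omega> a b + \<omega> a c) \<and>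
    (\<forall>c a b. \<omega> (scl c a) b = h c * \<omega> a b) \<and> (\<forall>c a b. \<omega> a (scl c b) = h c * \<omega> a b) \<and>
    (\<forall>a. \<omega> a a = 0)"

lemma multilinear_two_form_power:
  assumes "bilinear_alternating scl h \<omega>"
  shows "multilinear_form scl h (2 * k) (two_form_power \<omega> k)"
proof (induction k)
  case 0
  show ?case by (simp add: multilinear_form_def)
next
  case (Suc k)
  have "multilinear_form scl h 2 (\<lambda>v. \<omega> (v 0) (v 1))"
    using assms unfolding multilinear_form_def bilinear_alternating_def
    by (auto simp: less_2_cases_iff)
  from multilinear_form_wedge[OF this Suc.IH] show ?case by simp
qed

lemma alternating_two_form_power: "alternating_form (2 * k) (two_form_power \<omega> k)"
proof (cases k)
  case 0
  have "\<sigma> = id" if "\<sigma> permutes {..<0::nat}" for \<sigma> using that by simp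
  then show ?thesis unfolding 0 alternating_form_def by auto
next
  case (Suc l)
  then show ?thesis using alternating_form_wedge[of 2 "2 * l"] by simp
qed

lemma two_form_power_radical:
  assumes "\<And>x. \<omega> r x = 0" "\<And>x. \<omega> x r = 0" "j < 2 * k" "v j = r"
  shows "two_form_power \<omega> k v = 0"
  using assms(3,4)
proof (induction k arbitrary: v j)
  case (Suc k)
  have "wedge 2 (2 * k) (\<lambda>v. \<omega> (v 0) (v 1)) (two_form_power \<omega> k) v = 0"
  proof (rule wedge_radical)
    show "\<omega> (v 0) (v 1) = 0" if "j < 2" "v j = r" for v and j :: nat
      using less_2_cases[OF that(1)] that(2) assms(1,2) by auto
    show "two_form_power \<omega> k v = 0" if "j < 2 * k" "v j = r" for v and j :: nat
      using that by (rule Suc.IH)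
    show "j < 2 + 2 * k" "v j = r" using Suc.prems by auto
  qed
  then show ?case by simp
qed simp

text \<open>
  A power of a 2-form at given vectors is a polynomial in the mutual values of the form. This is
  how forms on different spaces, or in coordinates, are compared.
\<close>

lemma two_form_power_gram:
  assumes "\<And>i j. i < 2 * k \<Longrightarrow> j < 2 * k \<Longrightarrow> \<omega> (v i) (v j) = \<omega>' (v' i) (v' j)"
  shows "two_form_power \<omega> k v = two_form_power \<omega>' k v'"
  using assms
proof (induction k arbitrary: v v')
  case (Suc k)
  have "wedge 2 (2 * k) (\<lambda>v. \<omega> (v 0) (v 1)) (two_form_power \<omega> k) v
    = wedge 2 (2 * k) (\<lambda>v. \<omega>' (v 0) (v 1)) (two_form_power \<omega>' k) v'"
    unfolding wedge_def
  proof (intro arg_cong2[of _ _ _ _ "(/)"] sum.cong refl)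
    fix \<sigma> assume "\<sigma> \<in> {\<sigma>. \<sigma> permutes {..<2 + 2 * k}}"
    then have \<sigma>: "\<sigma> permutes {..<2 + 2 * k}" by simp
    have lt: "i < 2 + 2 * k \<Longrightarrow> \<sigma> i < 2 * Suc k" for i using permutes_less[OF \<sigma>] by simp
    have "two_form_power \<omega> k (\<lambda>i. v (\<sigma> (2 + i))) = two_form_power \<omega>' k (\<lambda>i. v' (\<sigma> (2 + i)))"
      by (rule Suc.IH) (use Suc.prems lt in auto)
    moreover have "\<omega> (v (\<sigma> 0)) (v (\<sigma> 1)) = \<omega>' (v' (\<sigma> 0)) (v' (\<sigma> 1))"
      by (rule Suc.prems) (rule lt; simp)+
    ultimately show "of_int (sign \<sigma>) * \<omega> (v (\<sigma> 0)) (v (\<sigma> 1)) * two_form_power \<omega> k (\<lambda>i. v (\<sigma> (2 + i))) =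
      of_int (sign \<sigma>) * \<omega>' (v' (\<sigma> 0)) (v' (\<sigma> 1)) * two_form_power \<omega>' k (\<lambda>i. v' (\<sigma> (2 + i)))"
      by (simp only:)
  qed
  then show ?case by simp
qed simp

lemma two_form_power_scale:
  "two_form_power (\<lambda>a b. c * \<omega> a b) k v = c ^ k * two_form_power \<omega> k v"
proof (induction k arbitrary: v)
  case (Suc k)
  show ?case
    by (simp add: wedge_def Suc.IH sum_distrib_left mult_ac)
qed simp

text \<open>
  Along an affine pencil of 2-forms a power is a polynomial in the parameter, and the leading
  coefficient is the power of the direction.
\<close>

lemma two_form_power_pencil:
  fixes \<omega> \<omega>' :: "'v \<Rightarrow> 'v \<Rightarrow> 'f::field_char_0"
  shows "\<exists>P. degree P \<le> k \<and> coeff P k = two_form_power \<omega>' k v \<and>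
    (\<forall>z. poly P z = two_form_power (\<lambda>a b. \<omega> a b + z * \<omega>' a b) k v)"
proof (induction k arbitrary: v)
  case 0
  show ?case by (intro exI[of _ 1]) simp
next
  case (Suc k)
  then obtain Q where Q: "\<And>v. degree (Q v) \<le> k" "\<And>v. coeff (Q v) k = two_form_power \<omega>' k v"
    "\<And>v z. poly (Q v) z = two_form_power (\<lambda>a b. \<omega> a b + z * \<omega>' a b) k v" by metis
  define S where "S = {\<sigma>. \<sigma> permutes {..<2 + 2 * k}}"
  define F where "F = (fact 2 * fact (2 * k) :: 'f)"
  define R where "R = (\<lambda>\<sigma>. Polynomial.smult (of_int (sign \<sigma>) / F)
    ([:\<omega> (v (\<sigma> 0)) (v (\<sigma> 1)), \<omega>' (v (\<sigma> 0)) (v (\<sigma> 1)):] * Q (\<lambda>i. v (\<sigma> (2 + i)))))"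
  have "degree (R \<sigma>) \<le> Suc k" for \<sigma>
    unfolding R_def
    by (rule order_trans[OF degree_smult_le], rule order_trans[OF degree_mult_le])
      (use Q(1)[of "\<lambda>i. v (\<sigma> (2 + i))"] in simp)
  then have "degree (\<Sum>\<sigma>\<in>S. R \<sigma>) \<le> Suc k" by (intro degree_sum_le) (auto simp: S_def finite_permutations)
  moreover have "coeff (R \<sigma>) (Suc k) = of_int (sign \<sigma>) * \<omega>' (v (\<sigma> 0)) (v (\<sigma> 1)) *
      two_form_power \<omega>' k (\<lambda>i. v (\<sigma> (2 + i))) / F" for \<sigma>
  proof -
    have "coeff (Q w) (Suc k) = 0" for w using Q(1)[of w] by (intro coeff_eq_0) simp
    then show ?thesis by (simp add: R_def Q(2))
  qed
  then have "coeff (\<Sum>\<sigma>\<in>S. R \<sigma>) (Suc k) = two_form_power \<omega>' (Suc k) v"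
    by (simp add: coeff_sum wedge_def S_def F_def sum_divide_distrib)
  moreover have "poly (\<Sum>\<sigma>\<in>S. R \<sigma>) z = two_form_power (\<lambda>a b. \<omega> a b + z * \<omega>' a b) (Suc k) v" for z
  proof -
    have "poly (R \<sigma>) z = of_int (sign \<sigma>) * (\<omega> (v (\<sigma> 0)) (v (\<sigma> 1)) + z * \<omega>' (v (\<sigma> 0)) (v (\<sigma> 1))) *
        two_form_power (\<lambda>a b. \<omega> a b + z * \<omega>' a b) k (\<lambda>i. v (\<sigma> (2 + i))) / F" for \<sigma>
      by (simp add: R_def Q(3) ring_distribs mult.assoc add_divide_distrib)
    then show ?thesis by (simp add: poly_sum wedge_def S_def F_def sum_divide_distrib)
  qed
  ultimately show ?case by blast
qed

lemma continuous_on_two_form_power: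
  fixes \<omega> :: "'p::topological_space \<Rightarrow> 'v \<Rightarrow> 'v \<Rightarrow> complex"
  assumes "\<And>a b. continuous_on S (\<lambda>p. \<omega> p a b)"
  shows "continuous_on S (\<lambda>p. two_form_power (\<omega> p) k v)"
proof (induction k arbitrary: v)
  case (Suc k)
  show ?case unfolding two_form_power.simps wedge_def
    by (intro continuous_intros assms Suc.IH) auto
qed simp

text \<open>
  Putting the relation into slot \<open>j\<close> of the form leaves only the coefficient of \<open>v j\<close>: all other
  vectors would be repeated, and \<open>r\<close> contributes nothing. So vectors with a nonzero value of the form
  are independent modulo its radical.
\<close>

lemma independent_of_nonzero_value:
  assumes ml: "multilinear_form scl h k \<theta>" and alt: "alternating_form k \<theta>"
    and rel: "(\<Sum>i<k. scl (c i) (v i)) + r = 0"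
    and rad: "\<And>v j. j < k \<Longrightarrow> v j = - r \<Longrightarrow> \<theta> v = 0"
    and nz: "\<theta> v \<noteq> 0" and j: "j < k"
  shows "h (c j) = 0"
proof -
  have zero: "\<theta> (v(j := v i)) = 0" if "i < k" "i \<noteq> j" for i
    by (rule alternating_form_repeated[OF alt that(1) j that(2)]) (use that in simp)
  have "0 = \<theta> (v(j := \<Sum>i<k. scl (c i) (v i)))"
    by (rule sym, rule rad[OF j]) (use rel in \<open>simp add: eq_neg_iff_add_eq_0\<close>)
  also have "\<dots> = (\<Sum>i<k. h (c i) * \<theta> (v(j := v i)))"
    by (rule multilinear_form_sum[OF ml j]) simp
  also have "\<dots> = (\<Sum>i<k. if i = j then h (c j) * \<theta> v else 0)"
    by (intro sum.cong) (auto simp: zero)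
  also have "\<dots> = h (c j) * \<theta> v" using j by simp
  finally show ?thesis using nz by simp
qed

lemma multilinear_form_vanishes_on_span:
  assumes vs: "vector_space scl" and ml: "multilinear_form scl h k \<theta>"
    and G: "\<And>w. (\<And>i. i < k \<Longrightarrow> w i \<in> G) \<Longrightarrow> \<theta> w = 0"
    and w: "\<And>i. i < k \<Longrightarrow> w i \<in> module.span scl G"
  shows "\<theta> w = 0"
proof -
  interpret vector_space scl by fact
  have "\<theta> w = 0" if "n \<le> k" "\<And>i. i < k \<Longrightarrow> w i \<in> span G" "\<And>i. n \<le> i \<Longrightarrow> i < k \<Longrightarrow> w i \<in> G" for n w
    using that
  proof (induction n arbitrary: w)
    case 0
    then show ?case by (intro G) auto
  next
    case (Suc n)
    then have n: "n < k" by simp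
    have "\<theta> (w(n := x)) = 0" if "x \<in> span G" for x
      using that
    proof (induction rule: span_induct_alt)
      case base
      show ?case by (rule multilinear_form_zero[OF ml n])
    next
      case (step c x y)
      have "\<theta> (w(n := x)) = 0"
        by (rule Suc.IH) (use Suc.prems step span_base in auto)
      then show ?case
        using step
        by (simp add: multilinear_formD(2)[OF ml n] multilinear_formD(3)[OF ml n] del: fun_upd_apply)
    qed
    from this[of "w n"] show ?case using Suc.prems n by simp
  qed
  from this[of k w] w show ?thesis by simp
qed

section \<open>Top powers and one-dimensional kernels\<close>

text \<open>
  The symplectic form for which the basis vectors \<open>2 i\<close> and \<open>2 i + 1\<close> are paired.
\<close>

definition standard_form :: "nat \<Rightarrow> nat \<Rightarrow> 'f::field_char_0"
  where "standard_form i j =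
    (if even i \<and> j = Suc i then 1 else if odd i \<and> i = Suc j then - 1 else 0)"

lemma standard_form_shift: "standard_form (2 + i) (2 + j) = standard_form i j"
  by (auto simp: standard_form_def)

lemma standard_form_div:
  "standard_form i j = (if i div 2 = j div 2 \<and> i \<noteq> j then if even i then 1 else - 1 else 0)"
  unfolding standard_form_def
  by (cases "even i"; cases "even j"; auto elim!: evenE oddE; presburger)

lemma standard_form_alt: "standard_form i j = - standard_form j i"
  by (auto simp: standard_form_def)

lemma two_form_power_permute_tail:
  assumes "p permutes {2..<2 * k + 2}"
  shows "two_form_power \<omega> k (\<lambda>i. v (p (2 + i))) = of_int (sign p) * two_form_power \<omega> k (\<lambda>i. v (2 + i))"
  using assms finite_atLeastLessThan
proof (induction p arbitrary: v rule: permutes_induct)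
  case (swap a b p)
  let ?t = "Transposition.transpose a b" and ?t' = "Transposition.transpose (a - 2) (b - 2)"
  have t: "?t (2 + i) = 2 + ?t' i" for i
    using swap.hyps by (auto simp: Transposition.transpose_def)
  have "two_form_power \<omega> k (\<lambda>i. v ((?t \<circ> p) (2 + i)))
      = of_int (sign p) * two_form_power \<omega> k (\<lambda>i. v (?t (2 + i)))"
    using swap.IH[of "\<lambda>i. v (?t i)"] by simp
  also have "two_form_power \<omega> k (\<lambda>i. v (?t (2 + i))) = two_form_power \<omega> k (\<lambda>i. v (2 + ?t' i))"
    unfolding t ..
  also have "\<dots> = of_int (sign ?t') * two_form_power \<omega> k (\<lambda>i. v (2 + i))"
  proof -
    have "?t' permutes {..<2 * k}" using swap.hyps by (intro permutes_swap_id) auto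
    from alternating_two_form_power[of k \<omega>, unfolded alternating_form_def, rule_format,
        OF this, of "\<lambda>i. v (2 + i)"]
    show ?thesis .
  qed
  finally have "two_form_power \<omega> k (\<lambda>i. v ((?t \<circ> p) (2 + i)))
      = of_int (sign p) * (of_int (sign ?t') * two_form_power \<omega> k (\<lambda>i. v (2 + i)))" .
  moreover have "sign ?t' = sign ?t" using swap.hyps by (auto simp: sign_swap_id)
  moreover have "sign (?t \<circ> p) = sign ?t * sign p"
    using swap.hyps
    by (intro sign_compose) (auto simp: permutation_swap_id intro: permutes_imp_permutation[rotated])
  ultimately show ?case by (simp only: of_int_mult mult_ac)
qed auto

text \<open>
  In the defining sum of a power, the first pair \<open>(\<sigma> 0, \<sigma> 1)\<close> can be moved to the front: the
  permutation that does so is even, because it moves two neighbours together, and it preserves the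
  form on the remaining indices. So all nonzero terms of the sum are equal.
\<close>

lemma standard_form_power_term_even:
  fixes \<sigma> :: "nat \<Rightarrow> nat"
  assumes \<sigma>: "\<sigma> permutes {..<2 + 2 * k}" and ev: "even (\<sigma> 0)" "\<sigma> 1 = Suc (\<sigma> 0)"
  shows "of_int (sign \<sigma>) * standard_form (\<sigma> 0) (\<sigma> 1) * two_form_power standard_form k (\<lambda>i. \<sigma> (2 + i))
    = (two_form_power standard_form k (\<lambda>i. i) :: 'f::field_char_0)"
proof -
  define a where "a = \<sigma> 0"
  define \<tau> where "\<tau> = Transposition.transpose 0 a \<circ> Transposition.transpose 1 (Suc a)"
  have a: "even a" "\<sigma> 0 = a" "\<sigma> 1 = Suc a" using ev by (auto simp: a_def)
  have lt: "Suc a < 2 + 2 * k" using permutes_less[OF \<sigma>, of 1] a by simp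
  have t0: "\<tau> a = 0" "\<tau> (Suc a) = 1"
    using a(1) by (auto simp: \<tau>_def Transposition.transpose_def)
  have J: "standard_form (\<tau> i) (\<tau> j) = (standard_form i j :: 'f)" for i j
  proof -
    have "even (\<tau> i) = even i" for i
      using a(1) by (auto simp: \<tau>_def Transposition.transpose_def)
    moreover have "\<tau> i div 2 = Transposition.transpose 0 (a div 2) (i div 2)" for i
      using a(1) unfolding \<tau>_def Transposition.transpose_def comp_def by (simp, presburger)
    then have "(\<tau> i div 2 = \<tau> j div 2) = (i div 2 = j div 2)" for i j
      by (simp add: inj_eq)
    moreover have "inj \<tau>" unfolding \<tau>_def by (intro inj_compose) simp_all
    then have "(\<tau> i = \<tau> j) = (i = j)" for i j by (simp add: inj_eq)
    ultimately show ?thesis unfolding standard_form_div by simp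
  qed
  have \<tau>: "\<tau> permutes {..<2 + 2 * k}"
    unfolding \<tau>_def using lt by (intro permutes_compose permutes_swap_id) auto
  have sg\<tau>: "sign \<tau> = 1"
    unfolding \<tau>_def by (subst sign_compose) (auto simp: permutation_swap_id sign_swap_id)
  define p where "p = \<tau> \<circ> \<sigma>"
  have sgp: "sign p = sign \<sigma>"
    unfolding p_def using \<sigma> \<tau> sg\<tau>
    by (subst sign_compose) (auto intro: permutes_imp_permutation[rotated])
  have p: "p permutes {..<2 + 2 * k}" unfolding p_def using \<sigma> \<tau> by (rule permutes_compose)
  have p0: "p 0 = 0" "p 1 = 1" using a t0 by (auto simp: p_def)
  have "p permutes {2..<2 * k + 2}"
    using p
  proof (rule permutes_superset)
    fix x assume "x \<in> {..<2 + 2 * k} - {2..<2 * k + 2}"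
    then have "x = 0 \<or> x = 1" by auto
    then show "p x = x" using p0 by auto
  qed
  then have "two_form_power standard_form k (\<lambda>i. p (2 + i))
      = of_int (sign p) * (two_form_power standard_form k (\<lambda>i. 2 + i) :: 'f)"
    by (rule two_form_power_permute_tail[where v = "\<lambda>i. i"])
  also have "two_form_power standard_form k (\<lambda>i. 2 + i) = (two_form_power standard_form k (\<lambda>i. i) :: 'f)"
    by (rule two_form_power_gram) (rule standard_form_shift)
  finally have "two_form_power standard_form k (\<lambda>i. p (2 + i))
      = of_int (sign \<sigma>) * (two_form_power standard_form k (\<lambda>i. i) :: 'f)" using sgp by simp
  moreover have "two_form_power standard_form k (\<lambda>i. p (2 + i))
      = (two_form_power standard_form k (\<lambda>i. \<sigma> (2 + i)) :: 'f)"
    by (rule two_form_power_gram) (simp add: p_def J)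
  moreover have "standard_form (\<sigma> 0) (\<sigma> 1) = (1::'f)" using ev by (simp add: standard_form_def)
  moreover have "of_int (sign \<sigma>) * of_int (sign \<sigma>) = (1::'f)" by (simp add: sign_def)
  ultimately have "two_form_power standard_form k (\<lambda>i. \<sigma> (2 + i))
      = of_int (sign \<sigma>) * (two_form_power standard_form k (\<lambda>i. i) :: 'f)"
    and "standard_form (\<sigma> 0) (\<sigma> 1) = (1::'f)" and "of_int (sign \<sigma>) * of_int (sign \<sigma>) = (1::'f)"
    by (simp_all only:)
  then show ?thesis by (simp only: mult_1_right mult_1_left mult.assoc[symmetric])
qed

lemma standard_form_power_term:
  fixes \<sigma> :: "nat \<Rightarrow> nat"
  assumes \<sigma>: "\<sigma> permutes {..<2 + 2 * k}" and nz: "standard_form (\<sigma> 0) (\<sigma> 1) \<noteq> (0::'f::field_char_0)"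
  shows "of_int (sign \<sigma>) * standard_form (\<sigma> 0) (\<sigma> 1) * two_form_power standard_form k (\<lambda>i. \<sigma> (2 + i))
    = (two_form_power standard_form k (\<lambda>i. i) :: 'f)"
proof -
  show ?thesis
  proof (cases "even (\<sigma> 0) \<and> \<sigma> 1 = Suc (\<sigma> 0)")
    case True
    then show ?thesis using standard_form_power_term_even \<sigma> by blast
  next
    case False
    then have od: "odd (\<sigma> 0)" "\<sigma> 0 = Suc (\<sigma> 1)" using nz by (auto simp: standard_form_def split: if_splits)
    let ?t = "Transposition.transpose 0 (1::nat)"
    define \<sigma>' where "\<sigma>' = \<sigma> \<circ> ?t"
    have t: "?t permutes {..<2 + 2 * k}" by (intro permutes_swap_id) auto
    have \<sigma>': "\<sigma>' permutes {..<2 + 2 * k}" unfolding \<sigma>'_def using t \<sigma> by (rule permutes_compose)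
    have "sign \<sigma>' = - sign \<sigma>"
      unfolding \<sigma>'_def using \<sigma>
      by (subst sign_compose) (auto simp: permutation_swap_id sign_swap_id intro: permutes_imp_permutation[rotated])
    moreover have vals: "\<sigma>' 0 = \<sigma> 1" "\<sigma>' 1 = \<sigma> 0" "\<And>i. \<sigma>' (2 + i) = \<sigma> (2 + i)"
      by (auto simp: \<sigma>'_def Transposition.transpose_def)
    have alt: "standard_form (\<sigma> 1) (\<sigma> 0) = - (standard_form (\<sigma> 0) (\<sigma> 1) :: 'f)"
      by (rule standard_form_alt)
    have "of_int (sign \<sigma>') * standard_form (\<sigma>' 0) (\<sigma>' 1) * two_form_power standard_form k (\<lambda>i. \<sigma>' (2 + i))
      = (two_form_power standard_form k (\<lambda>i. i) :: 'f)"
      by (rule standard_form_power_term_even[OF \<sigma>']) (use vals od in auto)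
    ultimately show ?thesis unfolding vals alt by simp
  qed
qed

text \<open>
  All nonvanishing terms of the sum for exponent \<open>k + 1\<close> equal the value for exponent \<open>k\<close>, so there
  is no cancellation.
\<close>

lemma standard_form_power_nonzero:
  "two_form_power standard_form k (\<lambda>i. i) \<noteq> (0 :: 'f::field_char_0)"
proof (induction k)
  case (Suc k)
  define S where "S = {\<sigma>. \<sigma> permutes {..<2 + 2 * k}}"
  define S' where "S' = {\<sigma> \<in> S. standard_form (\<sigma> 0) (\<sigma> 1) \<noteq> (0::'f)}"
  have fin: "finite S" by (simp add: S_def finite_permutations)
  have "(\<Sum>\<sigma>\<in>S. of_int (sign \<sigma>) * standard_form (\<sigma> 0) (\<sigma> 1) * two_form_power standard_form k (\<lambda>i. \<sigma> (2 + i)))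
     = (\<Sum>\<sigma>\<in>S'. of_int (sign \<sigma>) * standard_form (\<sigma> 0) (\<sigma> 1) * (two_form_power standard_form k (\<lambda>i. \<sigma> (2 + i)) :: 'f))"
    by (rule sum.mono_neutral_right[OF fin]) (auto simp: S'_def)
  also have "\<dots> = (\<Sum>\<sigma>\<in>S'. two_form_power standard_form k (\<lambda>i. i))"
    by (intro sum.cong refl standard_form_power_term) (auto simp: S'_def S_def)
  also have "\<dots> = of_nat (card S') * two_form_power standard_form k (\<lambda>i. i)" by simp
  finally have eq: "two_form_power standard_form (Suc k) (\<lambda>i. i)
      = of_nat (card S') * (two_form_power standard_form k (\<lambda>i. i) :: 'f) / (fact 2 * fact (2 * k))"
    by (simp add: wedge_def S_def)
  have "id \<in> S'" by (auto simp: S'_def S_def standard_form_def permutes_id)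
  moreover have "finite S'" using fin by (simp add: S'_def)
  ultimately have "card S' \<noteq> 0" by auto
  then show ?case unfolding eq using Suc.IH by simp
qed simp

definition coordinate_form :: "nat \<Rightarrow> (nat \<Rightarrow> nat \<Rightarrow> 'f::field_char_0) \<Rightarrow> (nat \<Rightarrow> 'f) \<Rightarrow> (nat \<Rightarrow> 'f) \<Rightarrow> 'f"
  where "coordinate_form d W x y = (\<Sum>i<d. x i * (\<Sum>j<d. W i j * y j))"

definition coordinate_scale :: "'f::field_char_0 \<Rightarrow> (nat \<Rightarrow> 'f) \<Rightarrow> nat \<Rightarrow> 'f"
  where "coordinate_scale c x = (\<lambda>i. c * x i)"

definition unit_vector :: "nat \<Rightarrow> nat \<Rightarrow> 'f::field_char_0"
  where "unit_vector i = (\<lambda>j. if j = i then 1 else 0)"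

lemma vector_space_coordinate_scale: "vector_space coordinate_scale"
  by standard (auto simp: coordinate_scale_def fun_eq_iff plus_fun_def distrib_left distrib_right)

lemma coordinate_form_swap:
  assumes "skew_matrix d W"
  shows "coordinate_form d W x y = - coordinate_form d W y x"
proof -
  have "coordinate_form d W x y = (\<Sum>i<d. \<Sum>j<d. x i * W i j * y j)"
    by (simp add: coordinate_form_def sum_distrib_left mult.assoc)
  also have "\<dots> = (\<Sum>i<d. \<Sum>j<d. - (y j * (W j i * x i)))"
  proof (intro sum.cong refl)
    fix i j assume "i \<in> {..<d}" "j \<in> {..<d}"
    then have "W i j = - W j i" using skew_matrixD[OF assms] by blast
    then show "x i * W i j * y j = - (y j * (W j i * x i))"
      by (metis mult.commute mult.assoc mult_minus_left mult_minus_right)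
  qed
  also have "\<dots> = (\<Sum>j<d. \<Sum>i<d. - (y j * (W j i * x i)))" by (rule sum.swap)
  also have "\<dots> = - coordinate_form d W y x"
    by (simp add: coordinate_form_def sum_distrib_left sum_negf)
  finally show ?thesis .
qed

lemma bilinear_alternating_coordinate_form:
  assumes "skew_matrix d W"
  shows "bilinear_alternating coordinate_scale (\<lambda>c. c) (coordinate_form d W)"
  unfolding bilinear_alternating_def
proof (intro conjI allI)
  fix a b c :: "nat \<Rightarrow> 'a" and r :: 'a
  show "coordinate_form d W (a + b) c = coordinate_form d W a c + coordinate_form d W b c"
    by (simp add: coordinate_form_def plus_fun_def distrib_right sum.distrib)
  show "coordinate_form d W a (b + c) = coordinate_form d W a b + coordinate_form d W a c"
    by (simp add: coordinate_form_def plus_fun_def distrib_left sum.distrib)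
  show "coordinate_form d W (coordinate_scale r a) b = r * coordinate_form d W a b"
    by (simp add: coordinate_form_def coordinate_scale_def sum_distrib_left mult.assoc)
  show "coordinate_form d W a (coordinate_scale r b) = r * coordinate_form d W a b"
    by (simp add: coordinate_form_def coordinate_scale_def sum_distrib_left mult_ac)
  have "coordinate_form d W a a = - coordinate_form d W a a" by (rule coordinate_form_swap[OF assms])
  then have "coordinate_form d W a a + coordinate_form d W a a = 0" by (simp only: eq_neg_iff_add_eq_0)
  then show "coordinate_form d W a a = 0" by (simp only: mult_2[symmetric] mult_eq_0_iff) simp
qed

lemma coordinate_form_kernel:
  assumes "skew_matrix d W" "kernel_vec d W u"
  shows "coordinate_form d W x u = 0" "coordinate_form d W u x = 0"
proof -
  show *: "coordinate_form d W x u = 0"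
    unfolding coordinate_form_def
    by (rule sum.neutral) (use assms(2) in \<open>simp add: kernel_vec_def\<close>)
  show "coordinate_form d W u x = 0" using coordinate_form_swap[OF assms(1), of u x] * by simp
qed

lemma coordinate_form_unit:
  assumes "i < d" "j < d"
  shows "coordinate_form d W (unit_vector i) (unit_vector j) = W i j"
proof -
  have "(\<Sum>k<d. W l k * unit_vector j k) = W l j" for l
    using sum_delta_mult(2)[OF assms(2), of "W l"] by (simp add: unit_vector_def)
  then show ?thesis
    using sum_delta_mult(2)[OF assms(1), of "\<lambda>l. W l j"]
    by (simp add: coordinate_form_def unit_vector_def mult.commute)
qed

lemma coordinate_form_unit_left:
  assumes "i < d"
  shows "coordinate_form d W (unit_vector i) y = (\<Sum>j<d. W i j * y j)"
proof -
  have "coordinate_form d W (unit_vector i) y = (\<Sum>l<d. (if l = i then (\<Sum>j<d. W l j * y j) else 0))"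
    unfolding coordinate_form_def unit_vector_def by (intro sum.cong) auto
  then show ?thesis using assms by simp
qed

lemma coordinate_form_functional:
  "coordinate_form d W x y = (\<Sum>j<d. (\<Sum>i<d. x i * W i j) * y j)"
  unfolding coordinate_form_def sum_distrib_left sum_distrib_right mult.assoc by (rule sum.swap)

definition partner :: "nat \<Rightarrow> nat"
  where "partner i = (if even i then Suc i else i - 1)"

lemma standard_form_partner: "standard_form j i \<noteq> (0::'f::field_char_0) \<longleftrightarrow> i = partner j"
  by (auto simp: standard_form_def partner_def elim!: oddE)

lemma standard_form_square: "standard_form j (partner j) * standard_form j (partner j) = (1::'f::field_char_0)"
  by (auto simp: standard_form_def partner_def elim!: oddE)

lemma partner_less: "j < 2 * k \<Longrightarrow> partner j < 2 * k"
  by (auto simp: partner_def elim!: evenE)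

text \<open>
  If no pair could be added, the orthogonal complement of the family would be isotropic, and hence,
  being complementary to the span of the family, would lie in the radical. A dimension count
  shows that it is too large for that.
\<close>

lemma symplectic_family_extend:
  fixes W :: "nat \<Rightarrow> nat \<Rightarrow> 'f::field_char_0"
  assumes sk: "skew_matrix d W" and c: "kernel_line d W c" and d: "2 * k + 1 < d"
    and gram: "\<And>i j. i < 2 * k \<Longrightarrow> j < 2 * k \<Longrightarrow> coordinate_form d W (a i) (a j) = standard_form i j"
  shows "\<exists>a'. \<forall>i<2 * Suc k. \<forall>j<2 * Suc k. coordinate_form d W (a' i) (a' j) = standard_form i j"
proof -
  let ?w = "coordinate_form d W"
  note ba = bilinear_alternating_coordinate_form[OF sk, unfolded bilinear_alternating_def]
  have add: "?w (x + y) z = ?w x z + ?w y z" "?w z (x + y) = ?w z x + ?w z y"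
    "?w (coordinate_scale r x) z = r * ?w x z" "?w z (coordinate_scale r x) = r * ?w z x" "?w x x = 0"
    for x y z r using ba by blast+
  have zero: "?w 0 z = 0" "?w z 0 = 0" for z by (simp_all add: coordinate_form_def zero_fun_def)
  have neg: "?w x y = - ?w y x" for x y by (rule coordinate_form_swap[OF sk])
  have sum: "?w z (\<Sum>i\<in>I. coordinate_scale (r i) (x i)) = (\<Sum>i\<in>I. r i * ?w z (x i))"
    "?w (\<Sum>i\<in>I. coordinate_scale (r i) (x i)) z = (\<Sum>i\<in>I. r i * ?w (x i) z)" for z r x and I :: "nat set"
  proof -
    show "?w z (\<Sum>i\<in>I. coordinate_scale (r i) (x i)) = (\<Sum>i\<in>I. r i * ?w z (x i))"
      by (induction I rule: infinite_finite_induct) (simp_all only: sum.infinite sum.empty sum.insert zero add not_False_eq_True if_True)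
    show "?w (\<Sum>i\<in>I. coordinate_scale (r i) (x i)) z = (\<Sum>i\<in>I. r i * ?w (x i) z)"
      by (induction I rule: infinite_finite_induct) (simp_all only: sum.infinite sum.empty sum.insert zero add not_False_eq_True if_True)
  qed
  have "\<exists>x y. (\<forall>i<2 * k. ?w (a i) x = 0) \<and> (\<forall>i<2 * k. ?w (a i) y = 0) \<and> ?w x y \<noteq> 0"
  proof (rule ccontr)
    assume "\<not> ?thesis"
    then have iso: "?w x y = 0" if "\<And>i. i < 2 * k \<Longrightarrow> ?w (a i) x = 0" "\<And>i. i < 2 * k \<Longrightarrow> ?w (a i) y = 0" for x y
      using that by blast
    have rad: "?w z x = 0" if x: "\<And>i. i < 2 * k \<Longrightarrow> ?w (a i) x = 0" for x z
    proof -
      \<comment> \<open>projection of \<open>z\<close> to the orthogonal complement of the family\<close>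
      define r where "r i = - (standard_form (partner i) i * ?w (a (partner i)) z)" for i
      define z' where "z' = z + (\<Sum>i<2 * k. coordinate_scale (r i) (a i))"
      have zz: "?w (a j) z' = 0" if j: "j < 2 * k" for j
      proof -
        have pp: "partner (partner j) = j" by (auto simp: partner_def elim!: oddE)
        have "(\<Sum>i<2 * k. r i * ?w (a j) (a i)) = (\<Sum>i<2 * k. r i * standard_form j i)"
          using gram j by (intro sum.cong) auto
        also have "\<dots> = (\<Sum>i<2 * k. if i = partner j then r i * standard_form j i else 0)"
          by (intro sum.cong refl) (use standard_form_partner[of j, where 'f = 'f] in auto)
        also have "\<dots> = r (partner j) * standard_form j (partner j)" using partner_less[OF j] by simp
        also have "\<dots> = - ?w (a j) z * (standard_form j (partner j) * standard_form j (partner j))"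
          by (simp add: r_def pp)
        finally show ?thesis by (simp add: z'_def add sum standard_form_square)
      qed
      have "?w z' x = 0" by (rule iso[OF zz x])
      then show ?thesis using x by (simp add: z'_def add sum)
    qed
    obtain \<alpha> where \<alpha>: "(\<Sum>i<d. \<alpha> i * c i) = 1"
      using exists_dual_vector[of d c] c by (auto simp: kernel_line_def)
    \<comment> \<open>orthogonal to the family, and not a nonzero multiple of \<open>c\<close>\<close>
    define A where "A i j = (if i < 2 * k then (\<Sum>l<d. a i l * W l j) else \<alpha> j)" for i j
    obtain u where u: "\<exists>j<d. u j \<noteq> 0" "\<And>i. i < 2 * k + 1 \<Longrightarrow> (\<Sum>j<d. A i j * u j) = 0"
      using underdetermined_system[OF d, of A] by metis
    have "?w (a i) u = 0" if "i < 2 * k" for i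
      using u(2)[of i] that by (simp add: A_def coordinate_form_functional)
    then have "kernel_vec d W u"
      unfolding kernel_vec_def by (auto simp: coordinate_form_unit_left[symmetric] intro: rad)
    then obtain l where l: "\<And>j. j < d \<Longrightarrow> u j = l * c j" using c by (auto simp: kernel_line_def)
    have "0 = (\<Sum>j<d. \<alpha> j * u j)" using u(2)[of "2 * k"] by (simp add: A_def)
    also have "\<dots> = (\<Sum>j<d. l * (\<alpha> j * c j))" by (intro sum.cong refl) (simp add: l)
    also have "\<dots> = l * (\<Sum>j<d. \<alpha> j * c j)" by (simp only: sum_distrib_left)
    finally have "l = 0" using \<alpha> by simp
    then show False using u(1) l by auto
  qed
  then obtain x y where x: "\<And>i. i < 2 * k \<Longrightarrow> ?w (a i) x = 0" and y: "\<And>i. i < 2 * k \<Longrightarrow> ?w (a i) y = 0"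
    and xy: "?w x y \<noteq> 0" by blast
  define y' where "y' = coordinate_scale (1 / ?w x y) y"
  have xy': "?w x y' = 1" using xy by (simp add: y'_def add)
  have y': "?w (a i) y' = 0" if "i < 2 * k" for i using y[OF that] by (simp add: y'_def add)
  have x_: "?w x (a i) = 0" and y_: "?w y' (a i) = 0" if "i < 2 * k" for i
    using x[OF that] y'[OF that] neg[of x "a i"] neg[of y' "a i"] by simp_all
  have yx': "?w y' x = - 1" using neg[of y' x] xy' by simp
  define a' where "a' i = (if i < 2 * k then a i else if i = 2 * k then x else y')" for i
  have "?w (a' i) (a' j) = standard_form i j" if ij: "i < 2 * Suc k" "j < 2 * Suc k" for i j
  proof (cases "i < 2 * k")
    case True
    show ?thesis
    proof (cases "j < 2 * k")
      case True
      with \<open>i < 2 * k\<close> gram show ?thesis by (simp add: a'_def)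
    next
      case False
      have "standard_form i j = (0::'f)"
      proof -
        have "i div 2 < k" "k \<le> j div 2" using \<open>i < 2 * k\<close> False by linarith+
        then show ?thesis by (simp add: standard_form_div)
      qed
      then show ?thesis using True False x y' by (simp add: a'_def)
    qed
  next
    case i: False
    show ?thesis
    proof (cases "j < 2 * k")
      case True
      have "standard_form i j = (0::'f)"
      proof -
        have "j div 2 < k" "k \<le> i div 2" using i True by linarith+
        then show ?thesis by (simp add: standard_form_div)
      qed
      then show ?thesis using True i x_ y_ by (simp add: a'_def)
    next
      case False
      then have "i = 2 * k \<or> i = Suc (2 * k)" "j = 2 * k \<or> j = Suc (2 * k)" using i ij by auto
      then show ?thesis using add(5) xy' yx' by (auto simp: a'_def standard_form_def)
    qed
  qed
  then show ?thesis by blast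
qed

lemma symplectic_family:
  fixes W :: "nat \<Rightarrow> nat \<Rightarrow> 'f::field_char_0"
  assumes sk: "skew_matrix d W" and c: "kernel_line d W c" and k: "2 * k < d"
  shows "\<exists>a. \<forall>i<2 * k. \<forall>j<2 * k. coordinate_form d W (a i) (a j) = standard_form i j"
  using k
proof (induction k)
  case (Suc k)
  then obtain a where "\<forall>i<2 * k. \<forall>j<2 * k. coordinate_form d W (a i) (a j) = standard_form i j" by auto
  then show ?case by (intro symplectic_family_extend[OF sk c, of k a]) (use Suc.prems in auto)
qed simp

text \<open>
  On a maximal symplectic family the power does not vanish. By multilinearity it cannot vanish on
  all families of basis vectors either.
\<close>

lemma two_form_power_nonzero_of_kernel_line:
  fixes W :: "nat \<Rightarrow> nat \<Rightarrow> 'f::field_char_0"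
  assumes sk: "skew_matrix d W" and c: "kernel_line d W c" and k: "2 * k < d"
  shows "\<exists>\<phi>. (\<forall>i. \<phi> i < d) \<and> two_form_power W k \<phi> \<noteq> 0"
proof (rule ccontr)
  assume "\<not> ?thesis"
  then have van: "two_form_power W k \<phi> = 0" if "\<And>i. \<phi> i < d" for \<phi> using that by blast
  let ?w = "coordinate_form d W"
  interpret vector_space "coordinate_scale :: 'f \<Rightarrow> (nat \<Rightarrow> 'f) \<Rightarrow> nat \<Rightarrow> 'f"
    by (rule vector_space_coordinate_scale)
  obtain a where a: "\<And>i j. i < 2 * k \<Longrightarrow> j < 2 * k \<Longrightarrow> ?w (a i) (a j) = standard_form i j"
    using symplectic_family[OF sk c k] by blast
  define b where "b i = (\<Sum>l<d. coordinate_scale (a i l) (unit_vector l))" for i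
  have sum_app: "(\<Sum>l\<in>I. f l) j = (\<Sum>l\<in>I. f l j)" for f :: "nat \<Rightarrow> nat \<Rightarrow> 'f" and I j
    by (induction I rule: infinite_finite_induct) auto
  have b: "b i j = a i j" if "j < d" for i j
  proof -
    have "b i j = (\<Sum>l<d. a i l * (if j = l then 1 else 0))"
      by (simp add: b_def sum_app coordinate_scale_def unit_vector_def)
    then show ?thesis using sum_delta_mult(3)[OF that] by simp
  qed
  have "?w (b i) (b j) = ?w (a i) (a j)" for i j by (simp add: coordinate_form_def b)
  then have "two_form_power ?w k b = two_form_power standard_form k (\<lambda>i. i)"
    using a by (intro two_form_power_gram) simp
  moreover have "two_form_power ?w k b = 0"
  proof (rule multilinear_form_vanishes_on_span[OF vector_space_axioms
        multilinear_two_form_power[OF bilinear_alternating_coordinate_form[OF sk]]])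
    fix w :: "nat \<Rightarrow> nat \<Rightarrow> 'f" assume w: "\<And>i. i < 2 * k \<Longrightarrow> w i \<in> unit_vector ` {..<d}"
    define \<phi> where "\<phi> i = (if i < 2 * k then SOME l. l < d \<and> w i = unit_vector l else 0)" for i
    have \<phi>: "\<phi> i < d \<and> w i = unit_vector (\<phi> i)" if "i < 2 * k" for i
      unfolding \<phi>_def using that w[OF that] by (auto intro: someI2_ex)
    have "two_form_power ?w k w = two_form_power W k \<phi>"
      by (rule two_form_power_gram) (simp add: \<phi> coordinate_form_unit)
    also have "\<dots> = 0" using \<phi> k by (intro van) (auto simp: \<phi>_def)
    finally show "two_form_power ?w k w = 0" .
  next
    fix i show "b i \<in> span (unit_vector ` {..<d})"
      unfolding b_def by (intro span_sum span_scale span_base) auto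
  qed
  ultimately show False using standard_form_power_nonzero by metis
qed

definition dot :: "nat \<Rightarrow> (nat \<Rightarrow> 'f::field_char_0) \<Rightarrow> (nat \<Rightarrow> 'f) \<Rightarrow> 'f"
  where "dot d y w = (\<Sum>i<d. y i * w i)"

text \<open>
  The determinant of a skew matrix of odd size vanishes, so the kernel is not zero.
\<close>

lemma kernel_line_of_dependent:
  fixes W :: "nat \<Rightarrow> nat \<Rightarrow> 'f::field_char_0"
  assumes sk: "skew_matrix d W" and odd: "odd d"
    and dep: "\<And>u u'. kernel_vec d W u \<Longrightarrow> kernel_vec d W u' \<Longrightarrow>
      \<exists>p q. (p \<noteq> 0 \<or> q \<noteq> 0) \<and> (\<forall>j<d. p * u j + q * u' j = 0)"
  obtains c where "kernel_line d W c"
proof -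
  obtain c where c: "kernel_vec d W c" "\<exists>j<d. c j \<noteq> 0" using odd_skew_singular[OF sk odd] by blast
  have "\<exists>l. \<forall>j<d. u j = l * c j" if u: "kernel_vec d W u" for u
  proof -
    obtain p q where pq: "p \<noteq> 0 \<or> q \<noteq> 0" "\<And>j. j < d \<Longrightarrow> p * u j + q * c j = 0"
      using dep[OF u c(1)] by blast
    have "p \<noteq> 0"
    proof
      assume "p = 0"
      then have "q \<noteq> 0" "\<And>j. j < d \<Longrightarrow> q * c j = 0" using pq by auto
      with c(2) show False by auto
    qed
    have "u j = (- q / p) * c j" if "j < d" for j
    proof -
      have "p * u j = - (q * c j)" using pq(2)[OF that] by (simp add: eq_neg_iff_add_eq_0)
      then show ?thesis using \<open>p \<noteq> 0\<close> by (simp add: field_simps)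
    qed
    then show ?thesis by blast
  qed
  with c show thesis by (intro that[of c]) (auto simp: kernel_line_def)
qed

lemma coordinate_form_kernel_vec:
  "kernel_vec d W u \<longleftrightarrow> (\<forall>w. coordinate_form d W w u = 0)"
proof
  assume "kernel_vec d W u"
  then show "\<forall>w. coordinate_form d W w u = 0"
    by (auto simp: coordinate_form_def kernel_vec_def)
next
  assume "\<forall>w. coordinate_form d W w u = 0"
  then show "kernel_vec d W u"
    by (auto simp: kernel_vec_def coordinate_form_unit_left[symmetric])
qed

text \<open>
  The \<open>2 k\<close> vectors with a nonzero value are independent modulo the kernel. Since the dimension is
  \<open>2 k + 1\<close>, any two kernel vectors are proportional.
\<close>

lemma kernel_line_of_two_form_power:
  fixes W :: "nat \<Rightarrow> nat \<Rightarrow> 'f::field_char_0"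
  assumes sk: "skew_matrix (2 * k + 1) W"
    and nz: "two_form_power (coordinate_form (2 * k + 1) W) k v \<noteq> 0"
  obtains c where "kernel_line (2 * k + 1) W c"
proof (rule kernel_line_of_dependent[OF sk])
  let ?d = "2 * k + 1" and ?w = "coordinate_form (2 * k + 1) W"
  fix u u' assume u: "kernel_vec ?d W u" "kernel_vec ?d W u'"
  obtain l where l: "\<exists>i<?d + 1. l i \<noteq> 0"
    and eq: "\<And>j. j < ?d \<Longrightarrow> (\<Sum>i<?d + 1. (if i < 2 * k then v i j else if i = 2 * k then u j else u' j) * l i) = 0"
    using underdetermined_system[of ?d "?d + 1" "\<lambda>j i. if i < 2 * k then v i j else if i = 2 * k then u j else u' j"]
    by auto
  define r where "r = (\<lambda>j. l (2 * k) * u j + l (Suc (2 * k)) * u' j)"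
  have eq': "(\<Sum>i<2 * k. l i * v i j) + r j = 0" if "j < ?d" for j
    using eq[OF that] by (simp add: r_def mult.commute add.assoc)
  define v' where "v' i = (\<lambda>j. if j < ?d then v i j else 0)" for i
  define r' where "r' = (\<lambda>j. if j < ?d then r j else 0)"
  have cong: "?w (\<lambda>j. if j < ?d then x j else 0) (\<lambda>j. if j < ?d then y j else 0) = ?w x y" for x y
    by (simp add: coordinate_form_def)
  have nz': "two_form_power ?w k v' \<noteq> 0"
  proof -
    have "two_form_power ?w k v' = two_form_power ?w k v"
      by (rule two_form_power_gram) (simp only: v'_def cong)
    with nz show ?thesis by simp
  qed
  have sum_app: "(\<Sum>l\<in>I. f l) j = (\<Sum>l\<in>I. f l j)" for f :: "nat \<Rightarrow> nat \<Rightarrow> 'f" and I j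
    by (induction I rule: infinite_finite_induct) auto
  have rel: "(\<Sum>i<2 * k. coordinate_scale (l i) (v' i)) + r' = 0"
  proof
    fix j show "((\<Sum>i<2 * k. coordinate_scale (l i) (v' i)) + r') j = 0 j"
      using eq'[of j] by (cases "j < ?d") (auto simp: sum_app coordinate_scale_def v'_def r'_def)
  qed
  have "kernel_vec ?d W (- r')"
    unfolding kernel_vec_def
  proof (intro allI impI)
    fix i assume i: "i < ?d"
    have "(\<Sum>j<?d. W i j * (- r') j) = - (l (2 * k) * (\<Sum>j<?d. W i j * u j) + l (Suc (2 * k)) * (\<Sum>j<?d. W i j * u' j))"
      unfolding sum_distrib_left sum.distrib[symmetric] sum_negf[symmetric]
      by (intro sum.cong) (auto simp: r'_def r_def algebra_simps)
    then show "(\<Sum>j<?d. W i j * (- r') j) = 0" using u i by (simp add: kernel_vec_def)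
  qed
  note rad = coordinate_form_kernel[OF sk this]
  have li: "l i = 0" if "i < 2 * k" for i
  proof (rule independent_of_nonzero_value[where h = "\<lambda>c. c" and scl = coordinate_scale and v = v' and r = r'
        and c = l and j = i and k = "2 * k" and \<theta> = "two_form_power ?w k"])
    show "multilinear_form coordinate_scale (\<lambda>c. c) (2 * k) (two_form_power ?w k)"
      by (rule multilinear_two_form_power[OF bilinear_alternating_coordinate_form[OF sk]])
    show "two_form_power ?w k v = 0" if "j < 2 * k" "v j = - r'" for v j
      by (rule two_form_power_radical[where r = "- r'"]) (use that rad in auto)
  qed (use alternating_two_form_power rel nz' that in auto)
  show "\<exists>p q. (p \<noteq> 0 \<or> q \<noteq> 0) \<and> (\<forall>j<?d. p * u j + q * u' j = 0)"
  proof (intro exI conjI allI impI)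
    obtain i where "i < ?d + 1" "l i \<noteq> 0" using l by blast
    moreover from this li have "i = 2 * k \<or> i = Suc (2 * k)" by (metis Suc_eq_plus1 add_2_eq_Suc' less_SucE)
    ultimately show "l (2 * k) \<noteq> 0 \<or> l (Suc (2 * k)) \<noteq> 0" by auto
    fix j assume "j < ?d"
    from eq'[OF this] li show "l (2 * k) * u j + l (Suc (2 * k)) * u' j = 0" by (simp add: r_def)
  qed
qed (use that in auto)

section \<open>Kernels of Lie--Poisson forms on the secondary algebra\<close>

text \<open>
  Complex structure constants of a unimodular Lie algebra with a fixed basis. The ground field may
  be real, but genericity concerns complex combinations, for which this serves as the
  complexification.
\<close>

locale structure_constants =
  fixes m :: nat and \<gamma> :: "nat \<Rightarrow> nat \<Rightarrow> nat \<Rightarrow> 'f::field_char_0"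
  assumes skew_constants: "\<And>i j k. i < m \<Longrightarrow> j < m \<Longrightarrow> \<gamma> i j k = - \<gamma> j i k"
    and jacobi_constants: "\<And>i j k n. i < m \<Longrightarrow> j < m \<Longrightarrow> k < m \<Longrightarrow> n < m \<Longrightarrow>
      (\<Sum>l<m. \<gamma> j k l * \<gamma> i l n + \<gamma> k i l * \<gamma> j l n + \<gamma> i j l * \<gamma> k l n) = 0"
    and unimodular_constants: "\<And>i. i < m \<Longrightarrow> (\<Sum>j<m. \<gamma> i j j) = 0"
begin

definition lie_form :: "(nat \<Rightarrow> 'f) \<Rightarrow> nat \<Rightarrow> nat \<Rightarrow> 'f"
  where "lie_form y i j = (\<Sum>k<m. y k * \<gamma> i j k)"

lemma skew_lie_form: "skew_matrix m (lie_form y)"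
  unfolding skew_matrix_def
proof (intro allI impI)
  fix i j assume ij: "i < m" "j < m"
  show "lie_form y i j = - lie_form y j i"
    unfolding lie_form_def sum_negf[symmetric]
    by (intro sum.cong refl) (subst skew_constants[OF ij], simp)
qed

lemma jacobi_lie_form:
  assumes "i < m" "j < m" "l < m"
  shows "(\<Sum>k<m. \<gamma> l i k * lie_form y k j + lie_form y i k * \<gamma> l j k) = (\<Sum>k<m. lie_form y l k * \<gamma> i j k)"
proof -
  have "(\<Sum>k<m. \<gamma> j l k * lie_form y i k + \<gamma> l i k * lie_form y j k + \<gamma> i j k * lie_form y l k)
     = (\<Sum>k<m. \<Sum>n<m. y n * (\<gamma> j l k * \<gamma> i k n + \<gamma> l i k * \<gamma> j k n + \<gamma> i j k * \<gamma> l k n))"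
    unfolding lie_form_def sum_distrib_left sum.distrib[symmetric]
    by (intro sum.cong refl) (simp add: algebra_simps)
  also have "\<dots> = (\<Sum>n<m. y n * (\<Sum>k<m. \<gamma> j l k * \<gamma> i k n + \<gamma> l i k * \<gamma> j k n + \<gamma> i j k * \<gamma> l k n))"
    unfolding sum_distrib_left by (rule sum.swap)
  also have "\<dots> = 0" using jacobi_constants assms by (intro sum.neutral) auto
  finally have "(\<Sum>k<m. \<gamma> j l k * lie_form y i k + \<gamma> l i k * lie_form y j k + \<gamma> i j k * lie_form y l k) = 0" .
  moreover have "\<gamma> j l k * lie_form y i k + \<gamma> l i k * lie_form y j k + \<gamma> i j k * lie_form y l k
      = lie_form y l k * \<gamma> i j k - (\<gamma> l i k * lie_form y k j + lie_form y i k * \<gamma> l j k)" if "k < m" for k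
    unfolding skew_constants[OF assms(2,3), of k] skew_matrixD[OF skew_lie_form assms(2) that, of y]
    by (simp add: algebra_simps)
  ultimately have "(\<Sum>k<m. lie_form y l k * \<gamma> i j k - (\<gamma> l i k * lie_form y k j + lie_form y i k * \<gamma> l j k)) = 0"
    by simp
  then show ?thesis by (simp only: sum_subtractf right_minus_eq)
qed

definition adjoint_matrix :: "(nat \<Rightarrow> 'f) \<Rightarrow> nat \<Rightarrow> nat \<Rightarrow> 'f"
  where "adjoint_matrix v k i = (\<Sum>l<m. v l * \<gamma> l i k)"

text \<open>
  By the Jacobi identity the derivation \<open>ad v\<close> scales the form of \<open>y\<close> by 1. It is traceless by
  unimodularity, so the trace identity gives \<open>2 e = - (m - 1)\<close>.
\<close>

lemma conformal_eigenvalue: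
  assumes c: "kernel_line m (lie_form y) c" and m: "m \<ge> 2"
    and v: "\<And>j. j < m \<Longrightarrow> (\<Sum>i<m. v i * lie_form y i j) = y j"
  obtains e where "e \<noteq> 0" "\<And>k. k < m \<Longrightarrow> (\<Sum>i<m. adjoint_matrix v k i * c i) = e * c k"
proof -
  let ?P = "adjoint_matrix v" and ?W = "lie_form y"
  have conf: "(\<Sum>k<m. ?P k i * ?W k j + ?W i k * ?P k j) = 1 * ?W i j" if ij: "i < m" "j < m" for i j
  proof -
    have "(\<Sum>k<m. ?P k i * ?W k j + ?W i k * ?P k j)
        = (\<Sum>k<m. \<Sum>l<m. v l * (\<gamma> l i k * ?W k j + ?W i k * \<gamma> l j k))"
      unfolding adjoint_matrix_def sum_distrib_left sum_distrib_right sum.distrib[symmetric]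
      by (intro sum.cong refl) (simp add: algebra_simps)
    also have "\<dots> = (\<Sum>l<m. v l * (\<Sum>k<m. \<gamma> l i k * ?W k j + ?W i k * \<gamma> l j k))"
      unfolding sum_distrib_left by (rule sum.swap)
    also have "\<dots> = (\<Sum>l<m. v l * (\<Sum>k<m. ?W l k * \<gamma> i j k))"
      using jacobi_lie_form ij by (intro sum.cong refl) auto
    also have "\<dots> = (\<Sum>k<m. (\<Sum>l<m. v l * ?W l k) * \<gamma> i j k)"
      unfolding sum_distrib_left sum_distrib_right mult.assoc by (rule sum.swap)
    also have "\<dots> = (\<Sum>k<m. y k * \<gamma> i j k)" using v by (intro sum.cong refl) auto
    finally show ?thesis by (simp add: lie_form_def)
  qed
  obtain e where e: "\<And>i. i < m \<Longrightarrow> (\<Sum>j<m. ?P i j * c j) = e * c i"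
    and tr: "2 * ((\<Sum>i<m. ?P i i) - e) = 1 * (of_nat m - 1)"
    by (rule conformal_trace[OF skew_lie_form c conf]) (assumption | rule that)+
  have "(\<Sum>i<m. ?P i i) = (\<Sum>l<m. v l * (\<Sum>i<m. \<gamma> l i i))"
    unfolding adjoint_matrix_def sum_distrib_left by (rule sum.swap)
  also have "\<dots> = 0" using unimodular_constants by (intro sum.neutral) auto
  finally have "- 2 * e = of_nat (m - 1)" using tr m by (simp add: of_nat_diff)
  then have "e \<noteq> 0" using m by auto
  with e show thesis by (rule that[rotated])
qed

end

lemma sum_lessThan_add: "(\<Sum>j<m + n. g j) = (\<Sum>j<m. g j) + (\<Sum>j<n. g (m + j :: nat))"
  for g :: "nat \<Rightarrow> 'f::comm_monoid_add"
  by (induction n) (simp_all add: add.assoc)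

lemma sum_secondary_split:
  "(\<Sum>j<2 * m + 1. g j) = (\<Sum>j<m. g j) + (\<Sum>j<m. g (m + j)) + g (2 * m)"
  for g :: "nat \<Rightarrow> 'f::comm_monoid_add"
  using sum_lessThan_add[of g m m] by (simp add: mult_2)

lemma coordinate_form_combination:
  "coordinate_form d W w (\<lambda>j. p * x j + q * y j) = p * coordinate_form d W w x + q * coordinate_form d W w y"
  by (simp add: coordinate_form_def sum_distrib_left sum.distrib algebra_simps)

lemma dot_combination: "dot d w (\<lambda>j. p * x j + q * y j) = p * dot d w x + q * dot d w y"
  by (simp add: dot_def sum_distrib_left sum.distrib algebra_simps)

lemma coordinate_form_cong_right:
  assumes "\<And>j. j < d \<Longrightarrow> x j = y j"
  shows "coordinate_form d W w x = coordinate_form d W w y" "dot d w x = dot d w y"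
  using assms by (simp_all add: coordinate_form_def dot_def)

lemma coordinate_form_multiple:
  assumes "\<And>j. j < d \<Longrightarrow> x j = p * y j"
  shows "coordinate_form d W w x = p * coordinate_form d W w y" "dot d w x = p * dot d w y"
  using assms by (simp_all add: coordinate_form_def dot_def sum_distrib_left algebra_simps)

context structure_constants
begin

text \<open>
  Membership of \<open>(v, v', s)\<close> in the kernel of the Lie--Poisson form at \<open>(x, y, 0)\<close>, tested separately
  on the three factors of the secondary algebra.
\<close>

definition secondary_solution ::
  "(nat \<Rightarrow> 'f) \<Rightarrow> (nat \<Rightarrow> 'f) \<Rightarrow> (nat \<Rightarrow> 'f) \<Rightarrow> (nat \<Rightarrow> 'f) \<Rightarrow> 'f \<Rightarrow> bool"
  where "secondary_solution x y v v' s \<longleftrightarrow>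
    (\<forall>w. coordinate_form m (lie_form x) w v + coordinate_form m (lie_form y) w v' = 0) \<and>
    (\<forall>w. coordinate_form m (lie_form y) w v + s * dot m y w = 0) \<and> dot m y v' = 0"

lemma secondary_solution_combination:
  assumes "secondary_solution x y v v' s" "secondary_solution x y u u' r"
  shows "secondary_solution x y (\<lambda>j. p * v j + q * u j) (\<lambda>j. p * v' j + q * u' j) (p * s + q * r)"
  unfolding secondary_solution_def
proof (intro conjI allI)
  fix w
  let ?X = "coordinate_form m (lie_form x) w" and ?W = "coordinate_form m (lie_form y) w"
  have a: "?X v + ?W v' = 0" "?X u + ?W u' = 0" "?W v + s * dot m y w = 0" "?W u + r * dot m y w = 0"
    using assms by (auto simp: secondary_solution_def)
  have "p * (?X v + ?W v') + q * (?X u + ?W u') = 0" "p * (?W v + s * dot m y w) + q * (?W u + r * dot m y w) = 0"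
    unfolding a by simp_all
  then show "?X (\<lambda>j. p * v j + q * u j) + ?W (\<lambda>j. p * v' j + q * u' j) = 0"
    "?W (\<lambda>j. p * v j + q * u j) + (p * s + q * r) * dot m y w = 0"
    by (simp_all add: coordinate_form_combination algebra_simps)
  show "dot m y (\<lambda>j. p * v' j + q * u' j) = 0"
    using assms by (simp add: dot_combination secondary_solution_def)
qed

lemma lie_form_adjoint:
  "coordinate_form m (lie_form x) v c = dot m x (\<lambda>k. \<Sum>i<m. adjoint_matrix v k i * c i)"
proof -
  have "coordinate_form m (lie_form x) v c = (\<Sum>l<m. \<Sum>i<m. \<Sum>k<m. x k * (v l * \<gamma> l i k * c i))"
    unfolding coordinate_form_def lie_form_def sum_distrib_left sum_distrib_right
    by (intro sum.cong refl) (simp add: algebra_simps)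
  also have "\<dots> = (\<Sum>l<m. \<Sum>k<m. \<Sum>i<m. x k * (v l * \<gamma> l i k * c i))"
    by (intro sum.cong refl sum.swap)
  also have "\<dots> = (\<Sum>k<m. \<Sum>l<m. \<Sum>i<m. x k * (v l * \<gamma> l i k * c i))" by (rule sum.swap)
  also have "\<dots> = (\<Sum>k<m. \<Sum>i<m. \<Sum>l<m. x k * (v l * \<gamma> l i k * c i))"
    by (intro sum.cong refl sum.swap)
  also have "\<dots> = dot m x (\<lambda>k. \<Sum>i<m. adjoint_matrix v k i * c i)"
    unfolding dot_def adjoint_matrix_def sum_distrib_left sum_distrib_right by (simp add: mult.assoc)
  finally show ?thesis .
qed

text \<open>
  Kernel vectors with \<open>v = 0\<close>. They exist only if \<open>y\<close> vanishes on the kernel line of its own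
  differential.
\<close>

lemma secondary_solution_central:
  assumes c: "kernel_line m (lie_form y) c" and sol: "secondary_solution x y v v' s"
    and v: "\<And>j. j < m \<Longrightarrow> v j = 0"
  obtains l where "\<And>j. j < m \<Longrightarrow> v' j = l * c j" "l * dot m y c = 0"
proof -
  have "coordinate_form m (lie_form x) w v = 0" for w
    using coordinate_form_multiple(1)[of m v 0 v] v by simp
  then have "kernel_vec m (lie_form y) v'"
    using sol by (simp add: coordinate_form_kernel_vec secondary_solution_def)
  then obtain l where l: "\<And>j. j < m \<Longrightarrow> v' j = l * c j" using c by (auto simp: kernel_line_def)
  have "l * dot m y c = 0"
    using sol coordinate_form_multiple(2)[of m v' l c y] l by (simp add: secondary_solution_def)
  with l show thesis by (rule that)
qed

text \<open>
  Test the second equation on \<open>c\<close>.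
\<close>

lemma secondary_solution_contact:
  assumes c: "kernel_line m (lie_form y) c" and yc: "dot m y c \<noteq> 0"
    and sol: "secondary_solution x y v v' s"
  shows "s = 0" "\<exists>l. \<forall>j<m. v j = l * c j"
proof -
  have kc: "kernel_vec m (lie_form y) c" using c by (simp add: kernel_line_def)
  have "coordinate_form m (lie_form y) c v + s * dot m y c = 0"
    using sol by (simp add: secondary_solution_def)
  then show s: "s = 0"
    using coordinate_form_kernel(2)[OF skew_lie_form kc] yc by simp
  then have "kernel_vec m (lie_form y) v"
    using sol by (simp add: coordinate_form_kernel_vec secondary_solution_def)
  then show "\<exists>l. \<forall>j<m. v j = l * c j" using c by (auto simp: kernel_line_def)
qed

text \<open>
  Here \<open>y = y \<circ> ad v\<^sub>0\<close>, so the second equation gives \<open>v = s v\<^sub>0 + l c\<close>. Testing the first one on \<open>c\<close> and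
  on \<open>v\<^sub>0\<close>, where \<open>x([v\<^sub>0, c]) = e x(c)\<close> is nonzero, gives \<open>s = 0\<close> and \<open>l = 0\<close>.
\<close>

lemma secondary_solution_noncontact:
  assumes m: "m \<ge> 2" and c: "kernel_line m (lie_form y) c" and yc: "dot m y c = 0"
    and xc: "dot m x c \<noteq> 0" and sol: "secondary_solution x y v v' s"
  shows "s = 0" "\<And>j. j < m \<Longrightarrow> v j = 0"
proof -
  let ?X = "coordinate_form m (lie_form x)" and ?W = "coordinate_form m (lie_form y)"
  have kc: "kernel_vec m (lie_form y) c" using c by (simp add: kernel_line_def)
  have swap: "?X a b = - ?X b a" "?W a b = - ?W b a" for a b
    by (rule coordinate_form_swap[OF skew_lie_form])+
  obtain v\<^sub>0 where v0: "\<And>i. i < m \<Longrightarrow> (\<Sum>j<m. lie_form y i j * v\<^sub>0 j) = - y i"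
  proof (rule skew_image_eq_annihilator[OF skew_lie_form c])
    show "(\<Sum>i<m. - y i * c i) = 0" using yc by (simp add: dot_def sum_negf)
  qed auto
  have Wv0: "?W w v\<^sub>0 = - dot m y w" for w
  proof -
    have "?W w v\<^sub>0 = (\<Sum>i<m. w i * - y i)"
      unfolding coordinate_form_def using v0 by (intro sum.cong refl) auto
    then show ?thesis by (simp add: dot_def sum_negf mult.commute)
  qed
  have v0': "(\<Sum>i<m. v\<^sub>0 i * lie_form y i j) = y j" if "j < m" for j
  proof -
    have "(\<Sum>i<m. v\<^sub>0 i * lie_form y i j) = (\<Sum>i<m. - (lie_form y j i * v\<^sub>0 i))"
      by (intro sum.cong refl) (subst skew_matrixD[OF skew_lie_form _ that], auto)
    then show ?thesis using v0[OF that] by (simp add: sum_negf)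
  qed
  obtain e where e: "e \<noteq> 0" "\<And>k. k < m \<Longrightarrow> (\<Sum>i<m. adjoint_matrix v\<^sub>0 k i * c i) = e * c k"
    using conformal_eigenvalue[OF c m v0'] by blast
  have Xv0c: "?X v\<^sub>0 c = e * dot m x c"
    unfolding lie_form_adjoint using e(2) by (rule coordinate_form_multiple(2))
  have "?W w (\<lambda>j. 1 * v j + (- s) * v\<^sub>0 j) = 0" for w
    unfolding coordinate_form_combination Wv0 using sol by (simp add: secondary_solution_def)
  then have "kernel_vec m (lie_form y) (\<lambda>j. 1 * v j + (- s) * v\<^sub>0 j)"
    unfolding coordinate_form_kernel_vec by blast
  with c[unfolded kernel_line_def] have "\<exists>l. \<forall>j<m. 1 * v j + (- s) * v\<^sub>0 j = l * c j"
    by blast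
  then obtain l where "\<And>j. j < m \<Longrightarrow> 1 * v j + (- s) * v\<^sub>0 j = l * c j" by blast
  then have l: "v j = s * v\<^sub>0 j + l * c j" if "j < m" for j using that by (simp add: diff_eq_eq add.commute)
  have Xv: "?X w v = s * ?X w v\<^sub>0 + l * ?X w c" for w
    using coordinate_form_cong_right(1)[of m v "\<lambda>j. s * v\<^sub>0 j + l * c j"] l
    by (simp add: coordinate_form_combination)
  have Xcc: "?X c c = 0"
    using bilinear_alternating_coordinate_form[OF skew_lie_form, of x] by (simp add: bilinear_alternating_def)
  have eq: "?X w v + ?W w v' = 0" for w using sol by (simp add: secondary_solution_def)
  have "s * (e * dot m x c) = 0"
    using eq[of c] coordinate_form_kernel(2)[OF skew_lie_form kc, of v'] swap(1)[of c v\<^sub>0]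
    by (simp add: Xv Xcc Xv0c)
  then show s: "s = 0" using e(1) xc by simp
  have "?W v\<^sub>0 v' = 0"
    using swap(2)[of v\<^sub>0 v'] Wv0[of v'] sol by (simp add: secondary_solution_def)
  then have "l * (e * dot m x c) = 0" using eq[of v\<^sub>0] by (simp add: Xv s Xv0c)
  then have "l = 0" using e(1) xc by simp
  with s l show "\<And>j. j < m \<Longrightarrow> v j = 0" by simp
qed

lemma secondary_solutions_dependent:
  assumes m: "m \<ge> 2" and c: "kernel_line m (lie_form y) c" and xyc: "dot m y c \<noteq> 0 \<or> dot m x c \<noteq> 0"
    and sol: "secondary_solution x y v v' s" "secondary_solution x y u u' r"
  shows "\<exists>p q. (p \<noteq> 0 \<or> q \<noteq> 0) \<and> (\<forall>j<m. p * v j + q * u j = 0) \<and>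
    (\<forall>j<m. p * v' j + q * u' j = 0) \<and> p * s + q * r = 0"
proof (cases "dot m y c = 0")
  case False
  obtain a b where a: "\<And>j. j < m \<Longrightarrow> v j = a * c j" and b: "\<And>j. j < m \<Longrightarrow> u j = b * c j"
    using secondary_solution_contact(2)[OF c False] sol by meson
  define p q where "p = (if a = 0 \<and> b = 0 then 1 else b)" and "q = (if a = 0 \<and> b = 0 then 0 else - a)"
  have pq: "p \<noteq> 0 \<or> q \<noteq> 0" by (simp add: p_def q_def)
  have v: "p * v j + q * u j = 0" if "j < m" for j using that by (simp add: a b p_def q_def)
  obtain l where "\<And>j. j < m \<Longrightarrow> p * v' j + q * u' j = l * c j" "l * dot m y c = 0"
    using secondary_solution_central[OF c secondary_solution_combination[OF sol, of p q] v] by blast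
  then have "\<And>j. j < m \<Longrightarrow> p * v' j + q * u' j = 0" using False by simp
  moreover have "s = 0" "r = 0" using secondary_solution_contact(1)[OF c False] sol by blast+
  ultimately show ?thesis using v pq by (intro exI[of _ p] exI[of _ q]) simp
next
  case True
  with xyc have xc: "dot m x c \<noteq> 0" by simp
  note z = secondary_solution_noncontact[OF m c True xc]
  obtain a where a: "\<And>j. j < m \<Longrightarrow> v' j = a * c j"
    using secondary_solution_central[OF c sol(1) z(2)[OF sol(1)]] by blast
  obtain b where b: "\<And>j. j < m \<Longrightarrow> u' j = b * c j"
    using secondary_solution_central[OF c sol(2) z(2)[OF sol(2)]] by blast
  define p q where "p = (if a = 0 \<and> b = 0 then 1 else b)" and "q = (if a = 0 \<and> b = 0 then 0 else - a)"
  have pq: "p \<noteq> 0 \<or> q \<noteq> 0" by (simp add: p_def q_def)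
  have "p * v' j + q * u' j = 0" if "j < m" for j using that by (simp add: a b p_def q_def)
  then show ?thesis
    using pq z(1)[OF sol(1)] z(1)[OF sol(2)] z(2)[OF sol(1)] z(2)[OF sol(2)]
    by (intro exI[of _ p] exI[of _ q]) simp
qed

definition secondary_matrix :: "(nat \<Rightarrow> 'f) \<Rightarrow> (nat \<Rightarrow> 'f) \<Rightarrow> nat \<Rightarrow> nat \<Rightarrow> 'f"
  where "secondary_matrix x y i j =
    (if i < m then if j < m then lie_form x i j else if j < 2 * m then lie_form y i (j - m) else 0
     else if i < 2 * m then if j < m then lie_form y (i - m) j else if j < 2 * m then 0 else y (i - m)
     else if j < m then 0 else if j < 2 * m then - y (j - m) else 0)"

lemma skew_secondary_matrix: "skew_matrix (2 * m + 1) (secondary_matrix x y)"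
  unfolding skew_matrix_def
proof (intro allI impI)
  fix i j assume ij: "i < 2 * m + 1" "j < 2 * m + 1"
  have sk: "lie_form z i j = - lie_form z j i" if "i < m" "j < m" for z i j
    using skew_matrixD[OF skew_lie_form] that by blast
  consider "i < m" "j < m" | "i < m" "m \<le> j" "j < 2 * m" | "m \<le> i" "i < 2 * m" "j < m"
    | "\<not> (i < m \<and> j < m)" "\<not> (i < m \<and> m \<le> j \<and> j < 2 * m)" "\<not> (m \<le> i \<and> i < 2 * m \<and> j < m)"
    by linarith
  then show "secondary_matrix x y i j = - secondary_matrix x y j i"
  proof cases
    case 1 then show ?thesis using sk[of i j x] by (simp add: secondary_matrix_def)
  next
    case 2 then show ?thesis using sk[of i "j - m" y] by (simp add: secondary_matrix_def)
  next
    case 3 then show ?thesis using sk[of "i - m" j y] by (simp add: secondary_matrix_def)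
  next
    case 4 then show ?thesis using ij by (auto simp: secondary_matrix_def)
  qed
qed

lemma secondary_solution_of_kernel:
  assumes k: "kernel_vec (2 * m + 1) (secondary_matrix x y) k"
  shows "secondary_solution x y k (\<lambda>j. k (m + j)) (k (2 * m))"
proof -
  have row: "(\<Sum>j<m. secondary_matrix x y i j * k j) + (\<Sum>j<m. secondary_matrix x y i (m + j) * k (m + j))
     + secondary_matrix x y i (2 * m) * k (2 * m) = 0" if "i < 2 * m + 1" for i
    using k that unfolding kernel_vec_def sum_secondary_split by blast
  have 1: "(\<Sum>j<m. lie_form x i j * k j) + (\<Sum>j<m. lie_form y i j * k (m + j)) = 0" if "i < m" for i
    using row[of i] that by (simp add: secondary_matrix_def)
  have 2: "(\<Sum>j<m. lie_form y i j * k j) + y i * k (2 * m) = 0" if "i < m" for i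
    using row[of "m + i"] that by (simp add: secondary_matrix_def)
  have 3: "(\<Sum>j<m. y j * k (m + j)) = 0"
    using row[of "2 * m"] by (simp add: secondary_matrix_def sum_negf)
  show ?thesis
    unfolding secondary_solution_def
  proof (intro conjI allI)
    fix w
    have "coordinate_form m (lie_form x) w k + coordinate_form m (lie_form y) w (\<lambda>j. k (m + j))
      = (\<Sum>i<m. w i * ((\<Sum>j<m. lie_form x i j * k j) + (\<Sum>j<m. lie_form y i j * k (m + j))))"
      unfolding coordinate_form_def distrib_left sum.distrib ..
    then show "coordinate_form m (lie_form x) w k + coordinate_form m (lie_form y) w (\<lambda>j. k (m + j)) = 0"
      using 1 by simp
    have "coordinate_form m (lie_form y) w k + k (2 * m) * dot m y w
      = (\<Sum>i<m. w i * ((\<Sum>j<m. lie_form y i j * k j) + y i * k (2 * m)))"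
      unfolding coordinate_form_def distrib_left sum.distrib dot_def sum_distrib_left
      by (simp add: mult_ac)
    then show "coordinate_form m (lie_form y) w k + k (2 * m) * dot m y w = 0" using 2 by simp
    show "dot m y (\<lambda>j. k (m + j)) = 0" using 3 by (simp add: dot_def)
  qed
qed

text \<open>
  The heart of genericity: for a contact \<open>y\<close> the kernel projects injectively to the line of \<open>c\<close> in the
  first factor, otherwise it is the line of \<open>c\<close> in the second factor. Two kernel vectors are
  therefore dependent, and the dimension is odd.
\<close>

lemma secondary_kernel_line:
  assumes m: "m \<ge> 2" and c: "kernel_line m (lie_form y) c" and xyc: "dot m y c \<noteq> 0 \<or> dot m x c \<noteq> 0"
  obtains k where "kernel_line (2 * m + 1) (secondary_matrix x y) k"
proof (rule kernel_line_of_dependent[OF skew_secondary_matrix])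
  fix u u' assume u: "kernel_vec (2 * m + 1) (secondary_matrix x y) u"
    "kernel_vec (2 * m + 1) (secondary_matrix x y) u'"
  obtain p q where pq: "p \<noteq> 0 \<or> q \<noteq> 0" "\<forall>j<m. p * u j + q * u' j = 0"
    "\<forall>j<m. p * u (m + j) + q * u' (m + j) = 0" "p * u (2 * m) + q * u' (2 * m) = 0"
    using secondary_solutions_dependent[OF m c xyc u[THEN secondary_solution_of_kernel]] by blast
  have "p * u j + q * u' j = 0" if j: "j < 2 * m + 1" for j
  proof -
    consider "j < m" | "m \<le> j" "j < 2 * m" | "j = 2 * m"
      using j by (metis Suc_eq_plus1 less_Suc_eq not_less)
    then show ?thesis
    proof cases
      case 2
      then have "j - m < m" by linarith
      with pq(3) have "p * u (m + (j - m)) + q * u' (m + (j - m)) = 0" by blast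
      with 2 show ?thesis by simp
    qed (use pq in auto)
  qed
  with pq(1) show "\<exists>p q. (p \<noteq> 0 \<or> q \<noteq> 0) \<and> (\<forall>j<2 * m + 1. p * u j + q * u' j = 0)" by blast
qed (use that in auto)

end

section \<open>Calculus with directional derivatives\<close>

text \<open>
  Two-parameter families \<open>q + a w + b w'\<close> are iterated moves.
\<close>

definition move :: "('i \<Rightarrow> 'k::real_normed_field) \<Rightarrow> 'k \<Rightarrow> ('i \<Rightarrow> 'k) \<Rightarrow> 'i \<Rightarrow> 'k"
  where "move q h w = (\<lambda>i. q i + h * w i)"

lemma move_move: "move (move q a w) b w = move q (a + b) w"
  by (simp add: move_def fun_eq_iff algebra_simps)

lemma move_commute: "move (move q a w) b w' = move (move q b w') a w"
  by (simp add: move_def fun_eq_iff algebra_simps)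

lemma move_zero: "move q 0 w = q"
  by (simp add: move_def)

lemma move_neighbourhood:
  assumes U: "openin (top_of_set W) U" "q \<in> U" and W: "\<And>a b. move (move q a w) b w' \<in> W"
  obtains \<delta> where "\<delta> > 0" "\<And>a b. norm a < \<delta> \<Longrightarrow> norm b < \<delta> \<Longrightarrow> move (move q a w) b w' \<in> U"
proof -
  let ?\<phi> = "\<lambda>(a, b). move (move q a w) b w'"
  obtain O' where O': "open O'" "U = W \<inter> O'" using U(1) by (auto simp: openin_open)
  have "continuous_on UNIV ?\<phi>"
    unfolding move_def case_prod_unfold by (intro continuous_intros)
  then have "open (?\<phi> -` O')" using O'(1) by (simp add: open_vimage)
  moreover have "(0, 0) \<in> ?\<phi> -` O'" using U(2) O'(2) by (simp add: move_zero)
  ultimately obtain e where e: "e > 0" "ball (0, 0) e \<subseteq> ?\<phi> -` O'" by (meson open_contains_ball)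
  show thesis
  proof (rule that[of "e / 2"])
    fix a b :: 'b assume ab: "norm a < e / 2" "norm b < e / 2"
    have "norm (a, b) \<le> norm a + norm b" by (rule norm_Pair_le)
    then have "(a, b) \<in> ball (0, 0) e" using ab by (simp add: zero_prod_def[symmetric])
    then show "move (move q a w) b w' \<in> U" using e(2) O'(2) W by auto
  qed (use e in simp)
qed

lemma move_continuous:
  fixes g :: "('i \<Rightarrow> 'k::real_normed_field) \<Rightarrow> 'k"
  assumes U: "openin (top_of_set W) U" "q \<in> U" and W: "\<And>a b. move (move q a w) b w' \<in> W"
    and g: "continuous_on U g" and e: "e > 0"
  obtains \<delta> where "\<delta> > 0" "\<And>a b. norm a < \<delta> \<Longrightarrow> norm b < \<delta> \<Longrightarrow>
    move (move q a w) b w' \<in> U \<and> norm (g (move (move q a w) b w') - g q) < e"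
proof -
  let ?U = "U \<inter> g -` ball (g q) e"
  have "openin (top_of_set U) ?U" using g by (rule continuous_openin_preimage_gen) simp
  then have "openin (top_of_set W) ?U" using U(1) by (rule openin_trans)
  moreover have "q \<in> ?U" using U(2) e by simp
  ultimately obtain \<delta> where "\<delta> > 0" "\<And>a b. norm a < \<delta> \<Longrightarrow> norm b < \<delta> \<Longrightarrow> move (move q a w) b w' \<in> ?U"
    using move_neighbourhood[OF _ _ W] by metis
  then show thesis by (intro that[of \<delta>]) (auto simp: dist_norm norm_minus_commute)
qed

lemma has_directional_derivative_move:
  "has_directional_derivative f q w D \<longleftrightarrow> ((\<lambda>h. f (move q h w)) has_field_derivative D) (at 0)"
  by (simp add: has_directional_derivative_def move_def)

lemma derivative_along_line:
  assumes "has_directional_derivative f (move q a w) w D"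
  shows "((\<lambda>h. f (move q h w)) has_field_derivative D) (at a)"
  using assms DERIV_shift[of "\<lambda>h. f (move q h w)" D 0 a]
  by (simp add: has_directional_derivative_move move_move add.commute)

lemma real_derivative_along_line:
  fixes f :: "('i \<Rightarrow> 'k::real_normed_field) \<Rightarrow> 'k"
  assumes "has_directional_derivative f (move q (of_real a) w) w D" and L: "bounded_linear L"
  shows "((\<lambda>t. L (f (move q (of_real t) w))) has_real_derivative L D) (at a)"
proof -
  have "(of_real has_vector_derivative (1::'k)) (at a)"
    using has_vector_derivative_of_real[OF DERIV_ident] by simp
  from field_vector_diff_chain_at[OF this derivative_along_line[OF assms(1)]]
  have "((\<lambda>t. f (move q (of_real t) w)) has_vector_derivative D) (at a)" by (simp add: comp_def)
  from bounded_linear.has_vector_derivative[OF L this] show ?thesis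
    by (simp add: has_real_derivative_iff_has_vector_derivative)
qed

text \<open>
  The mean value theorem, applied in each of the two directions. It needs real values, hence the
  functional \<open>L\<close>.
\<close>

lemma mixed_difference:
  fixes f :: "('i \<Rightarrow> 'k::real_normed_field) \<Rightarrow> 'k" and L :: "'k \<Rightarrow> real"
  assumes h: "0 < h" and L: "bounded_linear L"
    and U: "\<And>a b. 0 \<le> a \<Longrightarrow> a \<le> h \<Longrightarrow> 0 \<le> b \<Longrightarrow> b \<le> h \<Longrightarrow> move (move q (of_real a) w) (of_real b) w' \<in> U"
    and f: "\<And>q. q \<in> U \<Longrightarrow> has_directional_derivative f q w (g q)"
    and g: "\<And>q. q \<in> U \<Longrightarrow> has_directional_derivative g q w' (k q)"
  shows "\<exists>a b. 0 < a \<and> a < h \<and> 0 < b \<and> b < h \<and>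
    L (f (move (move q (of_real h) w) (of_real h) w')) - L (f (move q (of_real h) w))
      - L (f (move q (of_real h) w')) + L (f q)
     = h * h * L (k (move (move q (of_real a) w) (of_real b) w'))"
proof -
  let ?P = "\<lambda>a b. move (move q (of_real a) w) (of_real b) w'"
  define \<phi> where "\<phi> a = L (f (?P a h)) - L (f (?P a 0))" for a
  have d1: "((\<lambda>a. L (f (?P a b))) has_real_derivative L (g (?P a b))) (at a)"
    if "0 \<le> a" "a \<le> h" "0 \<le> b" "b \<le> h" for a b
    using real_derivative_along_line[of f "move q (of_real b) w'" a w "g (?P a b)", OF _ L] f[OF U[OF that]]
    unfolding move_commute[of q _ w _ w'] by simp
  have "\<exists>a>0. a < h \<and> \<phi> h - \<phi> 0 = (h - 0) * (L (g (?P a h)) - L (g (?P a 0)))"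
  proof (rule MVT2[OF h])
    fix x assume "0 \<le> x" "x \<le> h"
    then show "(\<phi> has_real_derivative L (g (?P x h)) - L (g (?P x 0))) (at x)"
      unfolding \<phi>_def using h by (intro DERIV_diff d1) auto
  qed
  then obtain a where a: "0 < a" "a < h" "\<phi> h - \<phi> 0 = h * (L (g (?P a h)) - L (g (?P a 0)))" by auto
  have d2: "((\<lambda>b. L (g (?P a b))) has_real_derivative L (k (?P a b))) (at b)" if "0 \<le> b" "b \<le> h" for b
    using real_derivative_along_line[of g "move q (of_real a) w" b w' "k (?P a b)", OF _ L] g U that a by simp
  have "\<exists>b>0. b < h \<and> L (g (?P a h)) - L (g (?P a 0)) = (h - 0) * L (k (?P a b))"
    by (rule MVT2[OF h]) (rule d2)
  then obtain b where b: "0 < b" "b < h" "L (g (?P a h)) - L (g (?P a 0)) = h * L (k (?P a b))" by auto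
  have "\<phi> h - \<phi> 0 = h * h * L (k (?P a b))" unfolding a(3) b(3) by simp
  then have "L (f (?P h h)) - L (f (move q (of_real h) w)) - L (f (move q (of_real h) w')) + L (f q)
      = h * h * L (k (?P a b))"
    by (simp add: \<phi>_def move_zero)
  with a b show ?thesis by blast
qed

lemma bounded_linear_to_complex: "bounded_linear (to_complex :: 'k::real_or_complex \<Rightarrow> complex)"
  by (rule bounded_linear_intro[where K = 1]) (auto simp: to_complex_add to_complex_scaleR norm_to_complex)

lemma to_complex_zero: "to_complex 0 = 0"
  using norm_to_complex[of 0] by simp

lemma to_complex_diff: "to_complex (x - y) = to_complex x - to_complex y"
  using to_complex_add[of "x - y" y] by simp

lemma to_complex_inject: "to_complex x = to_complex y \<longleftrightarrow> x = y"
  using norm_to_complex[of "x - y"] by (auto simp: to_complex_diff)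

lemma equal_by_real_functionals:
  fixes x y :: "'k::real_or_complex"
  assumes "\<And>L :: 'k \<Rightarrow> real. bounded_linear L \<Longrightarrow> L x = L y"
  shows "x = y"
proof -
  have "Re (to_complex x) = Re (to_complex y)"
    by (rule assms[OF bounded_linear_compose[OF bounded_linear_Re bounded_linear_to_complex]])
  moreover have "Im (to_complex x) = Im (to_complex y)"
    by (rule assms[OF bounded_linear_compose[OF bounded_linear_Im bounded_linear_to_complex]])
  ultimately have "to_complex x = to_complex y" by (rule complex_eqI)
  then show ?thesis by (simp only: to_complex_inject)
qed

lemma functional_continuous:
  fixes L :: "'k::real_normed_field \<Rightarrow> real"
  assumes L: "bounded_linear L" and e: "e > 0"
  obtains \<delta> where "\<delta> > 0" "\<And>x y. norm (x - y) < \<delta> \<Longrightarrow> \<bar>L x - L y\<bar> < e"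
proof -
  obtain K where K: "K > 0" "\<And>x. norm (L x) \<le> norm x * K" using bounded_linear.pos_bounded[OF L] by blast
  show thesis
  proof (rule that[of "e / K"])
    fix x y :: 'k assume "norm (x - y) < e / K"
    then have "norm (x - y) * K < e" using K(1) by (simp add: field_simps)
    then show "\<bar>L x - L y\<bar> < e"
      using K(2)[of "x - y"] by (simp add: linear_diff[OF bounded_linear.linear[OF L]])
  qed (use e K in simp)
qed

text \<open>
  Schwarz's theorem. Both mixed derivatives are limits of the same second difference; over the
  complex numbers this is checked on real functionals and real increments.
\<close>

lemma symmetric_second_derivative:
  fixes f :: "('i \<Rightarrow> 'k::real_or_complex) \<Rightarrow> 'k"
  assumes U: "openin (top_of_set W) U" "q \<in> U" and W: "\<And>a b. move (move q a w) b w' \<in> W"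
    and f1: "\<And>q. q \<in> U \<Longrightarrow> has_directional_derivative f q w (g1 q)"
    and f2: "\<And>q. q \<in> U \<Longrightarrow> has_directional_derivative f q w' (g2 q)"
    and g1: "\<And>q. q \<in> U \<Longrightarrow> has_directional_derivative g1 q w' (g12 q)"
    and g2: "\<And>q. q \<in> U \<Longrightarrow> has_directional_derivative g2 q w (g21 q)"
    and cont: "continuous_on U g12" "continuous_on U g21"
  shows "g12 q = g21 q"
proof (rule equal_by_real_functionals)
  fix L :: "'k \<Rightarrow> real" assume L: "bounded_linear L"
  have W': "\<And>a b. move (move q a w') b w \<in> W" using W by (simp add: move_commute[of q _ w'])
  have "\<bar>L (g12 q) - L (g21 q)\<bar> \<le> 0 + e" if e: "e > 0" for e
  proof -
    obtain d where d: "d > 0" "\<And>x y. norm (x - y) < d \<Longrightarrow> \<bar>L x - L y\<bar> < e / 2"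
      by (rule functional_continuous[OF L half_gt_zero[OF e]]) (rule that)
    obtain d1 where d1: "d1 > 0" "\<And>a b. norm a < d1 \<Longrightarrow> norm b < d1 \<Longrightarrow>
        move (move q a w) b w' \<in> U \<and> norm (g12 (move (move q a w) b w') - g12 q) < d"
      by (rule move_continuous[OF U W cont(1) d(1)]) (rule that)
    obtain d2 where d2: "d2 > 0" "\<And>a b. norm a < d2 \<Longrightarrow> norm b < d2 \<Longrightarrow>
        move (move q a w') b w \<in> U \<and> norm (g21 (move (move q a w') b w) - g21 q) < d"
      by (rule move_continuous[OF U W' cont(2) d(1)]) (rule that)
    define h where "h = min d1 d2 / 2"
    have h: "0 < h" "h < d1" "h < d2" using d1(1) d2(1) by (auto simp: h_def)
    have "\<exists>a b. 0 < a \<and> a < h \<and> 0 < b \<and> b < h \<and>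
      L (f (move (move q (of_real h) w) (of_real h) w')) - L (f (move q (of_real h) w))
        - L (f (move q (of_real h) w')) + L (f q) = h * h * L (g12 (move (move q (of_real a) w) (of_real b) w'))"
      by (rule mixed_difference[OF h(1) L, of q w w' U f g1 g12])
        (use d1 h f1 g1 in \<open>auto simp: norm_of_real\<close>)
    then obtain a b where ab: "0 < a" "a < h" "0 < b" "b < h"
      "L (f (move (move q (of_real h) w) (of_real h) w')) - L (f (move q (of_real h) w))
        - L (f (move q (of_real h) w')) + L (f q) = h * h * L (g12 (move (move q (of_real a) w) (of_real b) w'))"
      by blast
    have "\<exists>a b. 0 < a \<and> a < h \<and> 0 < b \<and> b < h \<and>
      L (f (move (move q (of_real h) w') (of_real h) w)) - L (f (move q (of_real h) w'))
        - L (f (move q (of_real h) w)) + L (f q) = h * h * L (g21 (move (move q (of_real a) w') (of_real b) w))"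
      by (rule mixed_difference[OF h(1) L, of q w' w U f g2 g21])
        (use d2 h f2 g2 in \<open>auto simp: norm_of_real\<close>)
    then obtain a' b' where ab': "0 < a'" "a' < h" "0 < b'" "b' < h"
      "L (f (move (move q (of_real h) w') (of_real h) w)) - L (f (move q (of_real h) w'))
        - L (f (move q (of_real h) w)) + L (f q) = h * h * L (g21 (move (move q (of_real a') w') (of_real b') w))"
      by blast
    have "h * h * L (g12 (move (move q (of_real a) w) (of_real b) w'))
        = h * h * L (g21 (move (move q (of_real a') w') (of_real b') w))"
      using ab(5) ab'(5)[unfolded move_commute[of q "of_real h" w' "of_real h" w]] by linarith
    then have "L (g12 (move (move q (of_real a) w) (of_real b) w')) = L (g21 (move (move q (of_real a') w') (of_real b') w))"
      using h(1) by simp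
    moreover have "\<bar>L (g12 (move (move q (of_real a) w) (of_real b) w')) - L (g12 q)\<bar> < e / 2"
      using d1(2)[of "of_real a" "of_real b"] ab h by (intro d(2)) auto
    moreover have "\<bar>L (g21 (move (move q (of_real a') w') (of_real b') w)) - L (g21 q)\<bar> < e / 2"
      using d2(2)[of "of_real a'" "of_real b'"] ab' h by (intro d(2)) auto
    ultimately show ?thesis by linarith
  qed
  then have "\<bar>L (g12 q) - L (g21 q)\<bar> \<le> 0" by (rule field_le_epsilon)
  then show "L (g12 q) = L (g21 q)" by simp
qed

definition closed_under_moves :: "('i \<Rightarrow> 'k::real_normed_field) set \<Rightarrow> bool"
  where "closed_under_moves W \<longleftrightarrow> (\<lambda>i. 0) \<in> W \<and> (\<forall>q\<in>W. \<forall>w\<in>W. \<forall>a. move q a w \<in> W)"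

lemma directional_derivative_scale:
  assumes "has_directional_derivative f q w D"
  shows "has_directional_derivative f q (\<lambda>i. c * w i) (c * D)"
proof -
  have "((\<lambda>h. h * c) has_field_derivative c) (at 0)" by (auto intro!: derivative_eq_intros)
  moreover have "((\<lambda>h. f (move q h w)) has_field_derivative D) (at (0 * c))"
    using assms by (simp add: has_directional_derivative_move)
  ultimately have "((\<lambda>h. f (move q (h * c) w)) has_field_derivative D * c) (at 0)"
    by (rule DERIV_chain2[rotated])
  moreover have "move q (h * c) w = move q h (\<lambda>i. c * w i)" for h
    by (simp add: move_def mult.assoc)
  ultimately show ?thesis
    by (simp add: has_directional_derivative_move mult.commute)
qed

lemma directional_derivative_zero: "has_directional_derivative f q (\<lambda>i. 0) 0"
  by (simp add: has_directional_derivative_def)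

lemma directional_derivative_unique:
  assumes "has_directional_derivative f q w D" "has_directional_derivative f q w D'"
  shows "D = D'"
  using assms unfolding has_directional_derivative_def by (rule DERIV_unique)

text \<open>
  A function of class \<open>C\<^sup>1\<close> in the sense of directional derivatives has derivatives that are additive
  in the direction: split the increment into two moves.
\<close>

lemma directional_derivative_add:
  fixes f :: "('i \<Rightarrow> 'k::real_or_complex) \<Rightarrow> 'k"
  assumes U: "openin (top_of_set W) U" "q \<in> U" and W: "\<And>a b. move (move q a w) b w' \<in> W"
    and f1: "\<And>q. q \<in> U \<Longrightarrow> has_directional_derivative f q w (g1 q)"
    and f2: "\<And>q. q \<in> U \<Longrightarrow> has_directional_derivative f q w' (g2 q)"
    and cont: "continuous_on U g1" "continuous_on U g2"
    and D: "has_directional_derivative f q (\<lambda>i. w i + w' i) D"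
  shows "D = g1 q + g2 q"
proof (rule equal_by_real_functionals)
  fix L :: "'k \<Rightarrow> real" assume L: "bounded_linear L"
  let ?P = "\<lambda>a b. move (move q (of_real a) w) (of_real b) w'"
  have "\<bar>L D - (L (g1 q) + L (g2 q))\<bar> \<le> 0 + e" if e: "e > 0" for e
  proof -
    have e3: "e / 3 > 0" using e by simp
    obtain d where d: "d > 0" "\<And>x y. norm (x - y) < d \<Longrightarrow> \<bar>L x - L y\<bar> < e / 3"
      by (rule functional_continuous[OF L e3]) (rule that)
    obtain d1 where d1: "d1 > 0" "\<And>a b. norm a < d1 \<Longrightarrow> norm b < d1 \<Longrightarrow>
        move (move q a w) b w' \<in> U \<and> norm (g1 (move (move q a w) b w') - g1 q) < d"
      by (rule move_continuous[OF U W cont(1) d(1)]) (rule that)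
    obtain d2 where d2: "d2 > 0" "\<And>a b. norm a < d2 \<Longrightarrow> norm b < d2 \<Longrightarrow>
        move (move q a w) b w' \<in> U \<and> norm (g2 (move (move q a w) b w') - g2 q) < d"
      by (rule move_continuous[OF U W cont(2) d(1)]) (rule that)
    have "((\<lambda>t. L (f (move q (of_real t) (\<lambda>i. w i + w' i)))) has_real_derivative L D) (at 0)"
      by (rule real_derivative_along_line[OF _ L]) (simp add: move_zero D)
    from DERIV_D[OF this]
    have "(\<lambda>h. (L (f (?P h h)) - L (f q)) / h) \<midarrow>0\<rightarrow> L D"
      by (simp add: move_zero) (simp add: move_def algebra_simps)
    from LIM_D[OF this e3] obtain d3 where d3: "d3 > 0"
      "\<And>h. h \<noteq> 0 \<Longrightarrow> \<bar>h\<bar> < d3 \<Longrightarrow> \<bar>(L (f (?P h h)) - L (f q)) / h - L D\<bar> < e / 3"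
      by auto
    define h where "h = min d1 (min d2 d3) / 2"
    have h: "0 < h" "h < d1" "h < d2" "h < d3" using d1(1) d2(1) d3(1) by (auto simp: h_def)
    have "\<exists>b>0. b < h \<and> L (f (?P h h)) - L (f (?P h 0)) = (h - 0) * L (g2 (?P h b))"
    proof (rule MVT2[OF h(1)])
      fix b assume "0 \<le> b" "b \<le> h"
      then show "((\<lambda>b. L (f (?P h b))) has_real_derivative L (g2 (?P h b))) (at b)"
        using h d2(2)[of "of_real h" "of_real b"] by (intro real_derivative_along_line[OF f2 L]) auto
    qed
    then obtain b where b: "0 < b" "b < h" "L (f (?P h h)) - L (f (?P h 0)) = h * L (g2 (?P h b))" by auto
    have "\<exists>a>0. a < h \<and> L (f (move q (of_real h) w)) - L (f (move q (of_real 0) w)) = (h - 0) * L (g1 (move q (of_real a) w))"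
    proof (rule MVT2[OF h(1)])
      fix a assume "0 \<le> a" "a \<le> h"
      then show "((\<lambda>b. L (f (move q (of_real b) w))) has_real_derivative L (g1 (move q (of_real a) w))) (at a)"
        using h d1(2)[of "of_real a" 0] by (intro real_derivative_along_line[OF f1 L]) (auto simp: move_zero)
    qed
    then obtain a where a: "0 < a" "a < h"
      "L (f (move q (of_real h) w)) - L (f q) = h * L (g1 (move q (of_real a) w))" by (auto simp: move_zero)
    have "L (f (?P h h)) - L (f q) = h * (L (g2 (?P h b)) + L (g1 (move q (of_real a) w)))"
      using a(3) b(3) by (simp add: move_zero algebra_simps)
    then have "(L (f (?P h h)) - L (f q)) / h = L (g2 (?P h b)) + L (g1 (move q (of_real a) w))"
      using h(1) by simp
    moreover have "\<bar>(L (f (?P h h)) - L (f q)) / h - L D\<bar> < e / 3" using d3(2)[of h] h by simp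
    moreover have "\<bar>L (g2 (?P h b)) - L (g2 q)\<bar> < e / 3"
      using d2(2)[of "of_real h" "of_real b"] b h by (intro d(2)) auto
    moreover have "\<bar>L (g1 (move q (of_real a) w)) - L (g1 q)\<bar> < e / 3"
      using d1(2)[of "of_real a" 0] a h d1(1) by (intro d(2)) (auto simp: move_zero)
    ultimately show ?thesis by linarith
  qed
  then have "\<bar>L D - (L (g1 q) + L (g2 q))\<bar> \<le> 0" by (rule field_le_epsilon)
  then show "L D = L (g1 q + g2 q)" by (simp add: linear_add[OF bounded_linear.linear[OF L]])
qed

lemma directional_derivative_combination:
  fixes f :: "('i \<Rightarrow> 'k::real_or_complex) \<Rightarrow> 'k" and N :: nat
  assumes W: "closed_under_moves W" and U: "openin (top_of_set W) U" "q \<in> U"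
    and f: "Ck_on (Suc 0) W U f" and e: "\<And>i. i < N \<Longrightarrow> e i \<in> W"
    and G: "\<And>i q. i < N \<Longrightarrow> q \<in> U \<Longrightarrow> has_directional_derivative f q (e i) (G i q)"
    and cont: "\<And>i. i < N \<Longrightarrow> continuous_on U (G i)"
  shows "has_directional_derivative f q (\<lambda>j. \<Sum>i<N. c i * e i j) (\<Sum>i<N. c i * G i q)"
proof -
  have sub: "U \<subseteq> W" using U(1) by (rule openin_imp_subset)
  have "n \<le> N \<Longrightarrow> (\<lambda>j. \<Sum>i<n. c i * e i j) \<in> W \<and>
      (\<forall>q\<in>U. has_directional_derivative f q (\<lambda>j. \<Sum>i<n. c i * e i j) (\<Sum>i<n. c i * G i q))" for n
  proof (induction n)
    case 0
    show ?case using W by (simp add: closed_under_moves_def directional_derivative_zero)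
  next
    case (Suc n)
    let ?w = "\<lambda>j. \<Sum>i<n. c i * e i j" and ?w' = "\<lambda>j. c n * e n j"
    have n: "n < N" and wW: "?w \<in> W"
      and wd: "\<And>q. q \<in> U \<Longrightarrow> has_directional_derivative f q ?w (\<Sum>i<n. c i * G i q)"
      using Suc by auto
    have sum: "(\<lambda>j. \<Sum>i<Suc n. c i * e i j) = (\<lambda>j. ?w j + ?w' j)" by simp
    have eW: "move q a (e n) \<in> W" if "q \<in> W" for q a
      using W e[OF n] that by (simp add: closed_under_moves_def)
    have mv: "move q a ?w \<in> W" if "q \<in> W" for q a
      using W wW that by (simp add: closed_under_moves_def)
    have "move ?w (c n) (e n) \<in> W" by (rule eW[OF wW])
    then have sW: "(\<lambda>j. ?w j + ?w' j) \<in> W" by (simp add: move_def)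
    have w'd: "has_directional_derivative f q ?w' (c n * G n q)" if "q \<in> U" for q
      using directional_derivative_scale[OF G[OF n that]] .
    have "has_directional_derivative f q (\<lambda>j. ?w j + ?w' j) (\<Sum>i<Suc n. c i * G i q)" if q: "q \<in> U" for q
    proof -
      obtain D where D: "has_directional_derivative f q (\<lambda>j. ?w j + ?w' j) D"
        using f sW q by auto
      have "move (move q a ?w) b ?w' = move (move q a ?w) (b * c n) (e n)" for a b
        by (simp add: move_def mult.assoc)
      then have "move (move q a ?w) b ?w' \<in> W" for a b using eW mv q sub by auto
      then have "D = (\<Sum>i<n. c i * G i q) + c n * G n q"
        by (rule directional_derivative_add[OF U(1) q _ wd w'd _ _ D])
          (auto intro!: continuous_intros cont simp: n less_trans[OF _ n])
      with D show ?thesis by simp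
    qed
    then show ?case unfolding sum using sW by blast
  qed
  from this[of N] U(2) show ?thesis by simp
qed

lemma tuple_space_neighbourhood:
  fixes V :: "(nat \<Rightarrow> 'k::real_normed_field) set"
  assumes "openin (top_of_set (tuple_space N)) V" "y \<in> V"
  shows "\<exists>\<delta>>0. \<forall>v\<in>tuple_space N. (\<forall>i<N. norm (v i) < \<delta>) \<longrightarrow> (\<lambda>i. y i + v i) \<in> V"
proof -
  obtain O' where O': "open O'" "V = tuple_space N \<inter> O'" using assms(1) by (auto simp: openin_open)
  have "openin (product_topology (\<lambda>_. euclidean) UNIV) O'" using O'(1) by (simp add: open_fun_def)
  then obtain X where X: "y \<in> Pi\<^sub>E UNIV X" "\<And>i. open (X i)" "Pi\<^sub>E UNIV X \<subseteq> O'"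
    using product_topology_open_contains_basis[of "\<lambda>_. euclidean" UNIV O' y] assms(2) O'(2) by auto
  have "\<exists>d>0. ball (y i) d \<subseteq> X i" for i
  proof -
    have "y i \<in> X i" using X(1) by (auto simp: PiE_def)
    with X(2)[of i] show ?thesis by (auto simp: open_contains_ball)
  qed
  then obtain d where d: "\<And>i. d i > 0" "\<And>i. ball (y i) (d i) \<subseteq> X i" by metis
  define \<delta> where "\<delta> = Min (insert 1 (d ` {..<N}))"
  show ?thesis
  proof (intro exI[of _ \<delta>] conjI ballI impI)
    show "\<delta> > 0" using d(1) by (simp add: \<delta>_def)
    fix v :: "nat \<Rightarrow> 'k"
    assume v: "v \<in> tuple_space N" and "\<forall>i<N. norm (v i) < \<delta>"
    then have v_less: "norm (v i) < \<delta>" if "i < N" for i using that by blast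
    have "y i + v i \<in> X i" for i
    proof (cases "i < N")
      case True
      then have "\<delta> \<le> d i" unfolding \<delta>_def by (intro Min_le) auto
      then have "y i + v i \<in> ball (y i) (d i)" using v_less[OF True] by (simp add: dist_norm)
      then show ?thesis using d(2) by blast
    next
      case False
      then have "v i = 0" using v by (simp add: tuple_space_def)
      then show ?thesis using X(1) by (auto simp: PiE_def)
    qed
    then have "(\<lambda>i. y i + v i) \<in> O'" using X(3) by (auto simp: PiE_def)
    moreover have "(\<lambda>i. y i + v i) \<in> tuple_space N"
      using v assms(2) O'(2) by (auto simp: tuple_space_def)
    ultimately show "(\<lambda>i. y i + v i) \<in> V" using O'(2) by simp
  qed
qed

text \<open>
  Move one coordinate at a time and bound each partial derivative near the point.
\<close>

lemma C1_locally_lipschitz: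
  fixes f :: "(nat \<Rightarrow> 'k::real_or_complex) \<Rightarrow> 'k"
  assumes V: "openin (top_of_set (tuple_space N)) V" "y \<in> V"
    and f: "Ck_on (Suc 0) (tuple_space N) V f" and L: "bounded_linear L"
  shows "\<exists>\<delta>>0. \<exists>C>0. \<forall>v\<in>tuple_space N. (\<forall>i<N. norm (v i) < \<delta>) \<longrightarrow>
    \<bar>L (f (\<lambda>i. y i + v i)) - L (f y)\<bar> \<le> C * (\<Sum>i<N. norm (v i))"
proof -
  have W: "closed_under_moves (tuple_space N :: (nat \<Rightarrow> 'k) set)"
    by (auto simp: closed_under_moves_def tuple_space_def move_def)
  have e: "(\<lambda>j. if j = i then 1 else 0) \<in> (tuple_space N :: (nat \<Rightarrow> 'k) set)" if "i < N" for i
    using that by (auto simp: tuple_space_def)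
  have "\<exists>g. i < N \<longrightarrow> (\<forall>q\<in>V. has_directional_derivative f q (\<lambda>j. if j = i then 1 else 0) (g q)) \<and> continuous_on V g" for i
    using f e[of i] by auto
  then obtain G where G: "\<And>i q. i < N \<Longrightarrow> q \<in> V \<Longrightarrow> has_directional_derivative f q (\<lambda>j. if j = i then 1 else 0) (G i q)"
    "\<And>i. i < N \<Longrightarrow> continuous_on V (G i)" by metis
  define V' where "V' = (\<Inter>i\<in>{..<N}. V \<inter> G i -` ball (G i y) 1) \<inter> topspace (top_of_set V)"
  have "openin (top_of_set V) (V \<inter> G i -` ball (G i y) 1)" if "i < N" for i
    using G(2)[OF that] by (rule continuous_openin_preimage_gen) simp
  then have "openin (top_of_set V) V'"
    unfolding V'_def by (intro openin_INT) auto
  then have V': "openin (top_of_set (tuple_space N)) V'" using V(1) by (rule openin_trans)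
  have yV': "y \<in> V'" using V(2) by (auto simp: V'_def)
  obtain K where K: "K > 0" "\<And>x. norm (L x) \<le> norm x * K" using bounded_linear.pos_bounded[OF L] by blast
  define M where "M = 1 + (\<Sum>i<N. norm (G i y))"
  have M: "M > 0" unfolding M_def by (intro add_pos_nonneg sum_nonneg) auto
  have bound: "norm (G i q) \<le> M" if "i < N" "q \<in> V'" for i q
  proof -
    have "G i q \<in> ball (G i y) 1" using that unfolding V'_def by blast
    then have "norm (G i q - G i y) < 1" by (simp add: dist_norm norm_minus_commute)
    moreover have "norm (G i y) \<le> (\<Sum>i<N. norm (G i y))" using that(1) by (intro member_le_sum) auto
    ultimately show ?thesis using norm_triangle_sub[of "G i q" "G i y"] by (simp add: M_def)
  qed
  obtain \<delta> where \<delta>: "\<delta> > 0"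
    "\<And>v. v \<in> tuple_space N \<Longrightarrow> (\<forall>i<N. norm (v i) < \<delta>) \<Longrightarrow> (\<lambda>i. y i + v i) \<in> V'"
    using tuple_space_neighbourhood[OF V' yV'] by blast
  have "\<forall>v\<in>tuple_space N. (\<forall>i<N. norm (v i) < \<delta>) \<longrightarrow>
    \<bar>L (f (\<lambda>i. y i + v i)) - L (f y)\<bar> \<le> K * M * (\<Sum>i<N. norm (v i))"
  proof (intro ballI impI)
    fix v :: "nat \<Rightarrow> 'k" assume v: "v \<in> tuple_space N" "\<forall>i<N. norm (v i) < \<delta>"
    have inV: "move y (of_real t) v \<in> V'" if "0 \<le> t" "t \<le> 1" for t
    proof -
      have "norm (of_real t * v i) < \<delta>" if "i < N" for i
        using v(2)[rule_format, OF that] \<open>0 \<le> t\<close> \<open>t \<le> 1\<close> mult_left_le_one_le[of "norm (v i)" t]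
        by (simp add: norm_mult)
      then show ?thesis
        unfolding move_def using v(1) by (intro \<delta>(2)) (auto simp: tuple_space_def)
    qed
    have v_eq: "(\<lambda>j. \<Sum>i<N. v i * (if j = i then 1 else 0)) = v"
    proof
      fix j show "(\<Sum>i<N. v i * (if j = i then 1 else 0)) = v j"
        using sum_delta_mult(3)[of j N v] v(1) by (cases "j < N") (auto simp: tuple_space_def)
    qed
    have der: "has_directional_derivative f q v (\<Sum>i<N. v i * G i q)" if "q \<in> V" for q
    proof -
      have "has_directional_derivative f q (\<lambda>j. \<Sum>i<N. v i * (if j = i then 1 else 0)) (\<Sum>i<N. v i * G i q)"
        by (rule directional_derivative_combination[OF W V(1) that f e G])
      then show ?thesis unfolding v_eq .
    qed
    have "\<exists>t>0. t < 1 \<and> L (f (move y (of_real 1) v)) - L (f (move y (of_real 0) v))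
        = (1 - 0) * L (\<Sum>i<N. v i * G i (move y (of_real t) v))"
    proof (rule MVT2)
      fix t :: real assume "0 \<le> t" "t \<le> 1"
      then have "move y (of_real t) v \<in> V" using inV by (auto simp: V'_def)
      then show "((\<lambda>t. L (f (move y (of_real t) v))) has_real_derivative
          L (\<Sum>i<N. v i * G i (move y (of_real t) v))) (at t)"
        by (rule real_derivative_along_line[OF der L])
    qed simp
    then obtain t where t: "0 < t" "t < 1"
      "L (f (move y (of_real 1) v)) - L (f (move y (of_real 0) v)) = L (\<Sum>i<N. v i * G i (move y (of_real t) v))"
      by auto
    have "norm (\<Sum>i<N. v i * G i (move y (of_real t) v)) \<le> (\<Sum>i<N. norm (v i) * M)"
      using bound inV t by (intro sum_norm_le) (auto simp: norm_mult intro!: mult_left_mono)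
    then have "norm (\<Sum>i<N. v i * G i (move y (of_real t) v)) * K \<le> (\<Sum>i<N. norm (v i) * M) * K"
      using K(1) by (intro mult_right_mono) auto
    also have "\<dots> = (K * M) * (\<Sum>i<N. norm (v i))"
      by (simp add: sum_distrib_left sum_distrib_right mult_ac)
    finally have "norm (\<Sum>i<N. v i * G i (move y (of_real t) v)) * K \<le> (K * M) * (\<Sum>i<N. norm (v i))" .
    then have "\<bar>L (\<Sum>i<N. v i * G i (move y (of_real t) v))\<bar> \<le> (K * M) * (\<Sum>i<N. norm (v i))"
      using K(2)[of "\<Sum>i<N. v i * G i (move y (of_real t) v)"] by simp
    then show "\<bar>L (f (\<lambda>i. y i + v i)) - L (f y)\<bar> \<le> K * M * (\<Sum>i<N. norm (v i))"
      using t(3) by (simp add: move_def)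
  qed
  moreover have "K * M > 0" using K(1) M by simp
  ultimately show ?thesis using \<delta>(1) by blast
qed

section \<open>Flat coordinates as a symmetric connection\<close>

text \<open>
  A basis with its dual basis.
\<close>

definition frame ::
  "('k::field \<Rightarrow> 'v::ab_group_add \<Rightarrow> 'v) \<Rightarrow> nat \<Rightarrow> (nat \<Rightarrow> 'v) \<Rightarrow> (nat \<Rightarrow> 'v \<Rightarrow> 'k) \<Rightarrow> bool"
  where "frame scl d f \<phi> \<longleftrightarrow> vector_space scl \<and> (\<forall>i<d. \<phi> i \<in> dual_space scl) \<and>
    (\<forall>i<d. \<forall>j<d. \<phi> i (f j) = (if i = j then 1 else 0)) \<and> (\<forall>x. x = (\<Sum>i<d. scl (\<phi> i x) (f i)))"

lemma dual_spaceD: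
  assumes "w \<in> dual_space scl"
  shows "w (x + y) = w x + w y" "w (scl c x) = c * w x" "w 0 = 0" "w (- x) = - w x" "w (x - y) = w x - w y"
    "w (\<Sum>i\<in>I. g i) = (\<Sum>i\<in>I. w (g i))"
proof -
  interpret Vector_Spaces.linear scl "(*)" w using assms by (simp add: dual_space_def)
  show "w (x + y) = w x + w y" "w (scl c x) = c * w x" "w 0 = 0" "w (- x) = - w x" "w (x - y) = w x - w y"
    "w (\<Sum>i\<in>I. g i) = (\<Sum>i\<in>I. w (g i))"
    by (rule add scale zero neg diff sum)+
qed

lemma dual_space_iff:
  assumes "vector_space scl"
  shows "w \<in> dual_space scl \<longleftrightarrow> (\<forall>x y. w (x + y) = w x + w y) \<and> (\<forall>c x. w (scl c x) = c * w x)"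
  using assms by (auto simp: dual_space_def Vector_Spaces.linear_iff vector_space_def algebra_simps)

lemma closed_under_moves_dual_space:
  assumes "vector_space scl"
  shows "closed_under_moves (dual_space scl)"
  unfolding closed_under_moves_def
  by (auto simp: dual_space_iff[OF assms] move_def dual_spaceD algebra_simps)

lemma frame_functional:
  assumes "frame scl d f \<phi>" "w \<in> dual_space scl"
  shows "w x = (\<Sum>i<d. \<phi> i x * w (f i))"
proof -
  have "w x = w (\<Sum>i<d. scl (\<phi> i x) (f i))" using assms(1) unfolding frame_def by metis
  then show ?thesis by (simp add: dual_spaceD[OF assms(2)])
qed

lemma frame_functional_expansion:
  assumes "frame scl d f \<phi>" "w \<in> dual_space scl"
  shows "w = (\<lambda>x. \<Sum>i<d. w (f i) * \<phi> i x)"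
  by (rule ext, subst frame_functional[OF assms]) (simp add: mult.commute)

lemma frame_vector_eqI:
  assumes "frame scl d f \<phi>" "\<And>i. i < d \<Longrightarrow> \<phi> i x = \<phi> i y"
  shows "x = y"
proof -
  have "x = (\<Sum>i<d. scl (\<phi> i x) (f i))" "y = (\<Sum>i<d. scl (\<phi> i y) (f i))"
    using assms(1) unfolding frame_def by blast+
  moreover have "(\<Sum>i<d. scl (\<phi> i x) (f i)) = (\<Sum>i<d. scl (\<phi> i y) (f i))"
    using assms(2) by (intro sum.cong) auto
  ultimately show ?thesis by metis
qed

lemma frame_coordinates_of_combination:
  assumes "frame scl d f \<phi>" "i < d"
  shows "\<phi> i (\<Sum>j<d. scl (c j) (f j)) = c i"
proof -
  have d: "\<phi> i \<in> dual_space scl" using assms by (simp add: frame_def)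
  have "\<phi> i (\<Sum>j<d. scl (c j) (f j)) = (\<Sum>j<d. c j * (if i = j then 1 else 0))"
    using assms by (auto simp: dual_spaceD[OF d] frame_def intro!: sum.cong)
  then show ?thesis using sum_delta_mult(3)[OF assms(2)] by simp
qed

lemma frame_two_form:
  assumes fr: "frame scl d f \<phi>" and B: "two_form scl B"
  shows "B (\<Sum>k<d. scl (a k) (f k)) (\<Sum>l<d. scl (b l) (f l)) = (\<Sum>k<d. \<Sum>l<d. a k * b l * B (f k) (f l))"
proof -
  have l: "(\<lambda>x. B x y) \<in> dual_space scl" and r: "B x \<in> dual_space scl" for x y
    using B by (auto simp: two_form_def dual_space_def)
  have left: "B (\<Sum>k<d. scl (a k) (f k)) y = (\<Sum>k<d. a k * B (f k) y)" for y
    by (simp add: dual_spaceD(2,6)[OF l])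
  have right: "B x (\<Sum>l<d. scl (b l) (f l)) = (\<Sum>l<d. b l * B x (f l))" for x
    by (simp add: dual_spaceD(2,6)[OF r])
  show ?thesis unfolding left unfolding right sum_distrib_left by (simp only: mult.assoc)
qed

text \<open>
  The differential is only defined by a universal property, so its existence has to be derived from
  the linearity of directional derivatives in the direction.
\<close>

lemma differential_frame:
  fixes scl :: "'k::real_or_complex \<Rightarrow> 'b::ab_group_add \<Rightarrow> 'b"
  assumes fr: "frame scl d f \<phi>" and U: "openin (top_of_set (dual_space scl)) U" "q \<in> U"
    and C: "Ck_on (Suc 0) (dual_space scl) U X"
    and G: "\<And>k q. k < d \<Longrightarrow> q \<in> U \<Longrightarrow> has_directional_derivative X q (\<phi> k) (G k q)"
    and cont: "\<And>k. k < d \<Longrightarrow> continuous_on U (G k)"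
  shows "differential scl X q = (\<Sum>k<d. scl (G k q) (f k))"
    and "w \<in> dual_space scl \<Longrightarrow> has_directional_derivative X q w (\<Sum>k<d. w (f k) * G k q)"
proof -
  have vs: "vector_space scl" and \<phi>: "\<And>k. k < d \<Longrightarrow> \<phi> k \<in> dual_space scl" using fr by (auto simp: frame_def)
  have der: "has_directional_derivative X q w (\<Sum>k<d. w (f k) * G k q)" if w: "w \<in> dual_space scl" for w
  proof -
    have "has_directional_derivative X q (\<lambda>j. \<Sum>i<d. w (f i) * \<phi> i j) (\<Sum>i<d. w (f i) * G i q)"
      by (rule directional_derivative_combination[OF closed_under_moves_dual_space[OF vs] U C \<phi> G cont])
    then show ?thesis unfolding frame_functional_expansion[OF fr w, symmetric] .
  qed
  show "w \<in> dual_space scl \<Longrightarrow> has_directional_derivative X q w (\<Sum>k<d. w (f k) * G k q)" by (rule der)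
  show "differential scl X q = (\<Sum>k<d. scl (G k q) (f k))"
    unfolding differential_def
  proof (rule the_equality)
    show "\<forall>w\<in>dual_space scl. has_directional_derivative X q w (w (\<Sum>k<d. scl (G k q) (f k)))"
      using der by (auto simp: dual_spaceD mult.commute)
    fix a assume a: "\<forall>w\<in>dual_space scl. has_directional_derivative X q w (w a)"
    show "a = (\<Sum>k<d. scl (G k q) (f k))"
    proof (rule frame_vector_eqI[OF fr])
      fix i assume i: "i < d"
      show "\<phi> i a = \<phi> i (\<Sum>k<d. scl (G k q) (f k))"
        using a \<phi>[OF i] G[OF i U(2)] directional_derivative_unique
        unfolding frame_coordinates_of_combination[OF fr i] by blast
    qed
  qed
qed

text \<open>
  The inverse chart is locally Lipschitz. If all coordinates are stationary in the direction \<open>w\<close>,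
  moving by \<open>h w\<close> changes them by \<open>o(h)\<close>, and hence changes the point by \<open>o(h)\<close>.
\<close>

lemma coordinate_differentials_separate:
  fixes scl :: "'k::real_or_complex \<Rightarrow> 'b::ab_group_add \<Rightarrow> 'b" and x :: "('b \<Rightarrow> 'k) \<Rightarrow> nat \<Rightarrow> 'k"
  assumes vs: "vector_space scl" and U: "openin (top_of_set (dual_space scl)) U" "p \<in> U"
    and V: "openin (top_of_set (tuple_space d)) V"
    and hom: "homeomorphism U V x \<psi>"
    and \<psi>: "\<And>b. Ck_on (Suc 0) (tuple_space d) V (\<lambda>y. \<psi> y b)"
    and w: "w \<in> dual_space scl" and zero: "\<And>i. i < d \<Longrightarrow> has_directional_derivative (\<lambda>q. x q i) p w 0"
  shows "w b = 0"
proof (rule equal_by_real_functionals)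
  fix L :: "'k \<Rightarrow> real" assume L: "bounded_linear L"
  have xV: "x q \<in> V" if "q \<in> U" for q using hom that by (auto simp: homeomorphism_def)
  have inv: "\<psi> (x q) = q" if "q \<in> U" for q using hom that by (simp add: homeomorphism_def)
  have VW: "V \<subseteq> tuple_space d" using V by (rule openin_imp_subset)
  have UW: "U \<subseteq> dual_space scl" using U(1) by (rule openin_imp_subset)
  obtain \<delta> C where \<delta>: "\<delta> > 0" and C: "C > 0"
    and lip: "\<And>v. v \<in> tuple_space d \<Longrightarrow> (\<forall>i<d. norm (v i) < \<delta>) \<Longrightarrow>
      \<bar>L (\<psi> (\<lambda>i. x p i + v i) b) - L (\<psi> (x p) b)\<bar> \<le> C * (\<Sum>i<d. norm (v i))"
    using C1_locally_lipschitz[OF V xV[OF U(2)] \<psi>[of b] L] by blast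
  have mv: "move (move p a w) c w \<in> dual_space scl" for a c
    using closed_under_moves_dual_space[OF vs] w U(2) UW unfolding closed_under_moves_def by blast
  obtain \<eta> where \<eta>: "\<eta> > 0" "\<And>a c. norm a < \<eta> \<Longrightarrow> norm c < \<eta> \<Longrightarrow> move (move p a w) c w \<in> U"
    by (rule move_neighbourhood[OF U mv]) (rule that)
  have "\<bar>L (w b)\<bar> \<le> 0 + e" if e: "e > 0" for e
  proof -
    define e' where "e' = min (e / (C * (real d + 1))) \<delta>"
    have Cd: "C * (real d + 1) > 0" using C by simp
    have e': "e' > 0" using e Cd \<delta> by (simp add: e'_def)
    have "\<exists>s>0. \<forall>h. h \<noteq> 0 \<and> norm h < s \<longrightarrow> norm ((x (move p h w) i - x p i) / h) < e'" if i: "i < d" for i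
    proof -
      have "((\<lambda>h. x (move p h w) i) has_field_derivative 0) (at 0)"
        using zero[OF i] by (simp add: has_directional_derivative_move)
      from LIM_D[OF DERIV_D[OF this] e'] show ?thesis by (simp add: move_zero)
    qed
    then obtain s where s: "\<And>i. i < d \<Longrightarrow> s i > 0"
      "\<And>i h. i < d \<Longrightarrow> h \<noteq> 0 \<Longrightarrow> norm h < s i \<Longrightarrow> norm ((x (move p h w) i - x p i) / h) < e'" by metis
    define \<mu> where "\<mu> = Min (insert 1 (insert \<eta> (s ` {..<d})))"
    define t where "t = \<mu> / 2"
    have \<mu>: "\<mu> > 0" using \<eta>(1) s(1) by (auto simp: \<mu>_def)
    have "\<mu> \<le> 1" "\<mu> \<le> \<eta>" unfolding \<mu>_def by (intro Min_le; simp)+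
    then have t: "t > 0" "t < 1" "t < \<eta>" using \<mu> by (auto simp: t_def)
    have ts: "t < s i" if "i < d" for i
    proof -
      have "\<mu> \<le> s i" unfolding \<mu>_def using that by (intro Min_le) auto
      then show ?thesis using \<mu> by (simp add: t_def)
    qed
    let ?h = "of_real t :: 'k"
    define v where "v i = x (move p ?h w) i - x p i" for i
    have hU: "move p ?h w \<in> U" using \<eta>(2)[of ?h 0] t \<eta>(1) by (simp add: move_zero)
    have vW: "v \<in> tuple_space d"
      using subsetD[OF VW xV[OF hU]] subsetD[OF VW xV[OF U(2)]] by (simp add: v_def tuple_space_def)
    have vi: "norm (v i) \<le> e' * t" if "i < d" for i
      using s(2)[OF that, of ?h] ts[OF that] t by (simp add: v_def norm_divide field_simps)
    have vd: "norm (v i) < \<delta>" if "i < d" for i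
    proof -
      have "e' * t < e' * 1" using e' t by (intro mult_strict_left_mono) auto
      then show ?thesis using vi[OF that] by (simp add: e'_def)
    qed
    have "\<psi> (\<lambda>i. x p i + v i) b = p b + ?h * w b"
      using inv[OF hU] by (simp add: v_def move_def)
    then have "L (\<psi> (\<lambda>i. x p i + v i) b) - L (\<psi> (x p) b) = t * L (w b)"
      using inv[OF U(2)] linear_add[OF bounded_linear.linear[OF L]]
        linear_scale[OF bounded_linear.linear[OF L], of t "w b"] by (simp add: scaleR_conv_of_real)
    then have "t * \<bar>L (w b)\<bar> \<le> C * (\<Sum>i<d. norm (v i))"
      using lip[OF vW] vd t by (simp add: abs_mult)
    also have "\<dots> \<le> C * (\<Sum>i<d. e' * t)" using C vi by (intro mult_left_mono sum_mono) auto
    also have "\<dots> = t * (C * real d * e')" by simp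
    finally have "\<bar>L (w b)\<bar> \<le> C * real d * e'" using t by simp
    also have "\<dots> \<le> C * (real d + 1) * e'" using C e' by (intro mult_right_mono mult_left_mono) auto
    also have "\<dots> \<le> C * (real d + 1) * (e / (C * (real d + 1)))"
      using Cd by (intro mult_left_mono) (auto simp: e'_def)
    also have "\<dots> = e" using Cd C by simp
    finally show ?thesis by simp
  qed
  then have "\<bar>L (w b)\<bar> \<le> 0" by (rule field_le_epsilon)
  then show "L (w b) = L 0" using linear_0[OF bounded_linear.linear[OF L]] by simp
qed

lemma sum_bilinear_change:
  fixes t s :: "nat \<Rightarrow> 'f::field"
  shows "(\<Sum>i<d. \<Sum>j<d. t i * s j * (\<Sum>k<d. \<Sum>l<d. A i k * B j l * Q k l))
    = (\<Sum>k<d. \<Sum>l<d. (\<Sum>i<d. t i * A i k) * (\<Sum>j<d. s j * B j l) * Q k l)"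
proof -
  have "(\<Sum>i<d. \<Sum>j<d. t i * s j * (\<Sum>k<d. \<Sum>l<d. A i k * B j l * Q k l))
    = (\<Sum>i<d. \<Sum>j<d. \<Sum>k<d. \<Sum>l<d. t i * A i k * (s j * B j l) * Q k l)"
    unfolding sum_distrib_left by (intro sum.cong refl) (simp add: mult_ac)
  also have "\<dots> = (\<Sum>i<d. \<Sum>k<d. \<Sum>j<d. \<Sum>l<d. t i * A i k * (s j * B j l) * Q k l)"
    by (intro sum.cong refl sum.swap)
  also have "\<dots> = (\<Sum>i<d. \<Sum>k<d. \<Sum>l<d. \<Sum>j<d. t i * A i k * (s j * B j l) * Q k l)"
    by (intro sum.cong refl sum.swap)
  also have "\<dots> = (\<Sum>k<d. \<Sum>i<d. \<Sum>l<d. \<Sum>j<d. t i * A i k * (s j * B j l) * Q k l)"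
    by (rule sum.swap)
  also have "\<dots> = (\<Sum>k<d. \<Sum>l<d. \<Sum>i<d. \<Sum>j<d. t i * A i k * (s j * B j l) * Q k l)"
    by (intro sum.cong refl sum.swap)
  also have "\<dots> = (\<Sum>k<d. \<Sum>l<d. (\<Sum>i<d. t i * A i k) * (\<Sum>j<d. s j * B j l) * Q k l)"
    unfolding sum_product unfolding sum_distrib_right ..
  finally show ?thesis .
qed

text \<open>
  The Christoffel symbols \<open>K\<close> of the connection for which the coordinate differentials are parallel:
  second derivatives of the coordinates, contracted with the inverse Jacobian. They are symmetric
  by Schwarz's theorem. A bivector field with constant coefficients in these coordinates is
  parallel. The same \<open>K\<close> serves all such fields, which is what flatness of a pair means.
\<close>

lemma flat_connection:
  fixes scl :: "'k::real_or_complex \<Rightarrow> 'b::ab_group_add \<Rightarrow> 'b"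
  assumes fr: "frame scl d f \<phi>" and d: "vector_space.dim scl UNIV = d"
    and loc: "local_coordinates scl p U x"
  shows "\<exists>K. (\<forall>k<d. \<forall>r<d. \<forall>u<d. K k r u = K r k u) \<and>
    (\<forall>Q Q'. constant_coefficients scl Q U x \<longrightarrow> (\<forall>q\<in>dual_space scl. two_form scl (Q q)) \<longrightarrow>
      (\<forall>r<d. \<forall>k<d. \<forall>l<d. has_directional_derivative (\<lambda>q. Q q (f k) (f l)) p (\<phi> r) (Q' r k l)) \<longrightarrow>
      (\<forall>r<d. \<forall>u<d. \<forall>w<d. (\<Sum>k<d. K k r u * Q p (f k) (f w)) + (\<Sum>k<d. K k r w * Q p (f u) (f k)) + Q' r u w = 0))"
proof -
  have vs: "vector_space scl" and \<phi>: "\<And>k. k < d \<Longrightarrow> \<phi> k \<in> dual_space scl" using fr by (auto simp: frame_def)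
  obtain V \<psi> where pU: "p \<in> U" and hom: "homeomorphism U V x \<psi>"
    and sx: "\<And>i. smooth_on_open (dual_space scl) U (\<lambda>q. x q i)"
    and s\<psi>: "\<And>b. smooth_on_open (tuple_space d) V (\<lambda>y. \<psi> y b)"
    using loc unfolding local_coordinates_def d by blast
  have U: "openin (top_of_set (dual_space scl)) U" and C2: "\<And>i. Ck_on (Suc (Suc 0)) (dual_space scl) U (\<lambda>q. x q i)"
    and C1: "\<And>i. Ck_on (Suc 0) (dual_space scl) U (\<lambda>q. x q i)"
    using sx unfolding smooth_on_open_def by blast+
  have V: "openin (top_of_set (tuple_space d)) V" and \<psi>1: "\<And>b. Ck_on (Suc 0) (tuple_space d) V (\<lambda>y. \<psi> y b)"
    using s\<psi> unfolding smooth_on_open_def by blast+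
  define P where "P i k g \<longleftrightarrow> k < d \<longrightarrow>
      (\<forall>q\<in>U. has_directional_derivative (\<lambda>q. x q i) q (\<phi> k) (g q)) \<and> Ck_on (Suc 0) (dual_space scl) U g" for i k g
  have "\<exists>g. P i k g" for i k
    using C2[of i] \<phi>[of k] unfolding P_def by (subst (asm) Ck_on.simps(2)) blast
  then obtain G where "\<And>i k. P i k (G i k)" by metis
  then have G: "\<And>i k q. k < d \<Longrightarrow> q \<in> U \<Longrightarrow> has_directional_derivative (\<lambda>q. x q i) q (\<phi> k) (G i k q)"
    "\<And>i k. k < d \<Longrightarrow> Ck_on (Suc 0) (dual_space scl) U (G i k)" unfolding P_def by blast+
  have Gc: "continuous_on U (G i k)" if "k < d" for i k using G(2)[OF that] by simp
  define R where "R i k l g \<longleftrightarrow> k < d \<longrightarrow> l < d \<longrightarrow>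
      (\<forall>q\<in>U. has_directional_derivative (G i k) q (\<phi> l) (g q)) \<and> continuous_on U g" for i k l g
  have "\<exists>g. R i k l g" for i k l
    using G(2)[of k i] \<phi>[of l] unfolding R_def by (cases "k < d"; cases "l < d") auto
  then obtain H where "\<And>i k l. R i k l (H i k l)" by metis
  then have H: "\<And>i k l q. k < d \<Longrightarrow> l < d \<Longrightarrow> q \<in> U \<Longrightarrow> has_directional_derivative (G i k) q (\<phi> l) (H i k l q)"
    "\<And>i k l. k < d \<Longrightarrow> l < d \<Longrightarrow> continuous_on U (H i k l)" unfolding R_def by blast+
  have mv: "move (move p a (\<phi> k)) b (\<phi> l) \<in> dual_space scl" if "k < d" "l < d" for a b k l
    using closed_under_moves_dual_space[OF vs] \<phi>[OF that(1)] \<phi>[OF that(2)] pU openin_imp_subset[OF U]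
    unfolding closed_under_moves_def by blast
  have sym: "H i k l p = H i l k p" if "k < d" "l < d" for i k l
    by (rule symmetric_second_derivative[OF U pU mv[OF that], of "\<lambda>q. x q i" "G i k" "G i l"])
      (use G(1) H that in auto)
  have diff: "differential scl (\<lambda>q. x q i) q = (\<Sum>k<d. scl (G i k q) (f k))" if "q \<in> U" for i q
    by (rule differential_frame(1)[OF fr U that C1 G(1) Gc])
  define J where "J i k = G i k p" for i k
  \<comment> \<open>the Jacobian is invertible because a direction killed by all coordinates is zero\<close>
  have "nonsingular d J"
    unfolding nonsingular_def
  proof (intro allI impI)
    fix u j assume u: "kernel_vec d J u" and j: "j < d"
    define w where "w = (\<lambda>b. \<Sum>k<d. u k * \<phi> k b)"
    have w: "w \<in> dual_space scl"
      unfolding dual_space_iff[OF vs] w_def using dual_spaceD(1,2)[OF \<phi>]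
      by (auto simp: sum_distrib_left sum.distrib algebra_simps intro!: sum.cong)
    have wf: "w (f k) = u k" if k: "k < d" for k
    proof -
      have "w (f k) = (\<Sum>i<d. u i * (if i = k then 1 else 0))"
        unfolding w_def using fr k by (auto simp: frame_def intro!: sum.cong)
      then show ?thesis using sum_delta_mult(2)[OF k] by simp
    qed
    have "has_directional_derivative (\<lambda>q. x q i) p w 0" if "i < d" for i
    proof -
      have "(\<Sum>k<d. w (f k) * G i k p) = (\<Sum>k<d. J i k * u k)"
        by (intro sum.cong refl) (simp add: wf J_def)
      also have "\<dots> = 0" using u that by (simp add: kernel_vec_def)
      finally show ?thesis using differential_frame(2)[OF fr U pU C1 G(1) Gc w, of i] by simp
    qed
    then have "w (f j) = 0"
      by (rule coordinate_differentials_separate[OF vs U pU V hom \<psi>1 w])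
    then show "u j = 0" using wf[OF j] by simp
  qed
  then obtain T where T: "\<And>i k. i < d \<Longrightarrow> k < d \<Longrightarrow> (\<Sum>j<d. J i j * T j k) = (if i = k then 1 else 0)"
    and T': "\<And>i k. i < d \<Longrightarrow> k < d \<Longrightarrow> (\<Sum>j<d. T i j * J j k) = (if i = k then 1 else 0)"
    by (rule nonsingular_inverse) (rule that)
  define K where "K k r u = (\<Sum>i<d. T u i * H i k r p)" for k r u
  have Ksym: "K k r u = K r k u" if "k < d" "r < d" for k r u
    unfolding K_def using sym[OF that] by simp
  have main: "(\<Sum>k<d. K k r u * Q p (f k) (f w)) + (\<Sum>k<d. K k r w * Q p (f u) (f k)) + Q' r u w = 0"
    if cc: "constant_coefficients scl Q U x" and tf: "\<And>q. q \<in> dual_space scl \<Longrightarrow> two_form scl (Q q)"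
    and der: "\<And>r k l. r < d \<Longrightarrow> k < d \<Longrightarrow> l < d \<Longrightarrow> has_directional_derivative (\<lambda>q. Q q (f k) (f l)) p (\<phi> r) (Q' r k l)"
    and r: "r < d" and u: "u < d" and w: "w < d" for Q Q' r u w
  proof -
    let ?E = "\<lambda>i j q. \<Sum>k<d. \<Sum>l<d. G i k q * G j l q * Q q (f k) (f l)"
    let ?D = "\<lambda>i j. \<Sum>k<d. \<Sum>l<d. (H i k r p * J j l * Q p (f k) (f l) + J i k * H j l r p * Q p (f k) (f l)
        + J i k * J j l * Q' r k l)"
    have D0: "?D i j = 0" if ij: "i < d" "j < d" for i j
    proof -
      have Eq: "Q q (differential scl (\<lambda>r. x r i) q) (differential scl (\<lambda>r. x r j) q) = ?E i j q" if "q \<in> U" for q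
        unfolding diff[OF that] by (rule frame_two_form[OF fr tf]) (use that openin_imp_subset[OF U] in auto)
      have "(\<lambda>q. Q q (differential scl (\<lambda>r. x r i) q) (differential scl (\<lambda>r. x r j) q)) constant_on U"
        using cc ij unfolding constant_coefficients_def d by blast
      then obtain c where "\<forall>q\<in>U. Q q (differential scl (\<lambda>r. x r i) q) (differential scl (\<lambda>r. x r j) q) = c"
        unfolding constant_on_def by blast
      then have c: "?E i j q = c" if "q \<in> U" for q using Eq[OF that] that by simp
      have 1: "((\<lambda>h. ?E i j (move p h (\<phi> r))) has_field_derivative ?D i j) (at 0)"
      proof (intro DERIV_sum)
        fix k l assume "k \<in> {..<d}" "l \<in> {..<d}"
        then have kl: "k < d" "l < d" by auto
        have a: "((\<lambda>h. G i k (move p h (\<phi> r))) has_field_derivative H i k r p) (at 0)"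
          "((\<lambda>h. G j l (move p h (\<phi> r))) has_field_derivative H j l r p) (at 0)"
          "((\<lambda>h. Q (move p h (\<phi> r)) (f k) (f l)) has_field_derivative Q' r k l) (at 0)"
          using H(1)[OF kl(1) r pU, of i] H(1)[OF kl(2) r pU, of j] der[OF r kl]
          by (simp_all add: has_directional_derivative_move)
        from DERIV_mult[OF DERIV_mult[OF a(1,2)] a(3)]
        show "((\<lambda>h. G i k (move p h (\<phi> r)) * G j l (move p h (\<phi> r)) * Q (move p h (\<phi> r)) (f k) (f l))
            has_field_derivative H i k r p * J j l * Q p (f k) (f l) + J i k * H j l r p * Q p (f k) (f l)
            + J i k * J j l * Q' r k l) (at 0)"
          by (simp add: J_def move_zero algebra_simps)
      qed
      obtain \<delta> where \<delta>: "\<delta> > 0" "\<And>a b. norm a < \<delta> \<Longrightarrow> norm b < \<delta> \<Longrightarrow> move (move p a (\<phi> r)) b (\<phi> r) \<in> U"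
        by (rule move_neighbourhood[OF U pU mv[OF r r]]) (rule that)
      have "((\<lambda>h. ?E i j (move p h (\<phi> r))) has_field_derivative 0) (at 0)"
      proof (rule has_field_derivative_transform_within[OF DERIV_const \<delta>(1)])
        fix h :: 'k assume "dist h 0 < \<delta>"
        then have "move p h (\<phi> r) \<in> U" using \<delta>(2)[of h 0] \<delta>(1) by (simp add: move_zero)
        then show "c = ?E i j (move p h (\<phi> r))" using c by simp
      qed simp
      with 1 show ?thesis by (rule DERIV_unique)
    qed
    have TJ: "(\<Sum>i<d. T a i * J i k) = (if a = k then 1 else 0)" if "a < d" "k < d" for a k
      using T'[OF that] .
    let ?q = "\<lambda>k l. Q p (f k) (f l)"
    \<comment> \<open>express the derivatives of the constant coefficients in the frame\<close>
    have "0 = (\<Sum>i<d. \<Sum>j<d. T u i * T w j * ?D i j)" using D0 by simp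
    also have "\<dots> = (\<Sum>i<d. \<Sum>j<d. T u i * T w j * (\<Sum>k<d. \<Sum>l<d. H i k r p * J j l * ?q k l))
      + (\<Sum>i<d. \<Sum>j<d. T u i * T w j * (\<Sum>k<d. \<Sum>l<d. J i k * H j l r p * ?q k l))
      + (\<Sum>i<d. \<Sum>j<d. T u i * T w j * (\<Sum>k<d. \<Sum>l<d. J i k * J j l * Q' r k l))"
      unfolding sum.distrib distrib_left ..
    also have "\<dots> = (\<Sum>k<d. \<Sum>l<d. K k r u * (\<Sum>j<d. T w j * J j l) * ?q k l)
      + (\<Sum>k<d. \<Sum>l<d. (\<Sum>i<d. T u i * J i k) * K l r w * ?q k l)
      + (\<Sum>k<d. \<Sum>l<d. (\<Sum>i<d. T u i * J i k) * (\<Sum>j<d. T w j * J j l) * Q' r k l)"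
      unfolding sum_bilinear_change K_def ..
    also have "(\<Sum>k<d. \<Sum>l<d. K k r u * (\<Sum>j<d. T w j * J j l) * ?q k l) = (\<Sum>k<d. K k r u * ?q k w)"
    proof (intro sum.cong refl)
      fix k
      have "(\<Sum>l<d. K k r u * (\<Sum>j<d. T w j * J j l) * ?q k l) = (\<Sum>l<d. (if w = l then 1 else 0) * (K k r u * ?q k l))"
        using TJ[OF w] by (intro sum.cong) auto
      then show "(\<Sum>l<d. K k r u * (\<Sum>j<d. T w j * J j l) * ?q k l) = K k r u * ?q k w"
        using sum_delta_mult(1)[OF w] by simp
    qed
    also have "(\<Sum>k<d. \<Sum>l<d. (\<Sum>i<d. T u i * J i k) * K l r w * ?q k l) = (\<Sum>l<d. K l r w * ?q u l)"
    proof -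
      have "(\<Sum>k<d. \<Sum>l<d. (\<Sum>i<d. T u i * J i k) * K l r w * ?q k l)
          = (\<Sum>k<d. (if u = k then 1 else 0) * (\<Sum>l<d. K l r w * ?q k l))"
        using TJ[OF u] by (intro sum.cong) auto
      then show ?thesis using sum_delta_mult(1)[OF u] by simp
    qed
    also have "(\<Sum>k<d. \<Sum>l<d. (\<Sum>i<d. T u i * J i k) * (\<Sum>j<d. T w j * J j l) * Q' r k l) = Q' r u w"
    proof -
      have "(\<Sum>k<d. \<Sum>l<d. (\<Sum>i<d. T u i * J i k) * (\<Sum>j<d. T w j * J j l) * Q' r k l)
          = (\<Sum>k<d. (if u = k then 1 else 0) * (\<Sum>l<d. (if w = l then 1 else 0) * Q' r k l))"
        using TJ[OF u] TJ[OF w] by (intro sum.cong) auto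
      then show ?thesis by (simp only: sum_delta_mult(1)[OF u] sum_delta_mult(1)[OF w])
    qed
    finally show ?thesis by simp
  qed
  show ?thesis
    using Ksym main by (intro exI[of _ K]) blast
qed

section \<open>The trace of a flat connection\<close>

context lie_algebra
begin

lemma bracket_add: "bracket (x + y) z = bracket x z + bracket y z" "bracket z (x + y) = bracket z x + bracket z y"
  and bracket_scale: "bracket (scl c x) z = scl c (bracket x z)" "bracket z (scl c x) = scl c (bracket z x)"
  using linear_bracket_left[of z] linear_bracket_right[of z] by (simp_all add: Vector_Spaces.linear_iff)

lemma bracket_sum: "bracket (\<Sum>i\<in>I. g i) z = (\<Sum>i\<in>I. bracket (g i) z)" "bracket z (\<Sum>i\<in>I. g i) = (\<Sum>i\<in>I. bracket z (g i))"
proof -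
  interpret l: Vector_Spaces.linear scl scl "\<lambda>a. bracket a z" by (rule linear_bracket_left)
  interpret r: Vector_Spaces.linear scl scl "bracket z" by (rule linear_bracket_right)
  show "bracket (\<Sum>i\<in>I. g i) z = (\<Sum>i\<in>I. bracket (g i) z)" "bracket z (\<Sum>i\<in>I. g i) = (\<Sum>i\<in>I. bracket z (g i))"
    by (rule l.sum r.sum)+
qed

lemma bracket_swap: "bracket x y = - bracket y x"
  using bracket_same[of "x + y", unfolded bracket_add]
  by (simp add: bracket_same eq_neg_iff_add_eq_0 add.commute)

lemma bracket_minus: "bracket (- x) y = - bracket x y" "bracket y (- x) = - bracket y x"
  using bracket_scale(1)[of "- 1" x y] bracket_scale(2)[of y "- 1" x] by simp_all

lemma bracket_derivation: "bracket u (bracket v w) = bracket (bracket u v) w + bracket v (bracket u w)"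
  using jacobi[of u v w] bracket_swap[of w "bracket u v"] bracket_swap[of w u]
  by (simp add: bracket_minus algebra_simps)

lemma functional_bracket_dual:
  assumes "x \<in> dual_space scl"
  shows "(\<lambda>w. x (bracket u w)) \<in> dual_space scl" "(\<lambda>w. x (bracket w u)) \<in> dual_space scl"
  by (simp_all add: dual_space_iff[OF vector_space_axioms] bracket_add bracket_scale dual_spaceD[OF assms])

text \<open>
  Rewrites a statement about the radical of a Lie--Poisson form as one about its matrix.
\<close>

lemma bracket_kernel_line:
  fixes f :: "nat \<Rightarrow> 'a" and \<phi> :: "nat \<Rightarrow> 'a \<Rightarrow> 'k"
  assumes fr: "frame scl d f \<phi>" and x: "x \<in> dual_space scl"
    and c: "\<And>w. x (bracket c w) = 0" "c \<noteq> 0"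
    and line: "\<forall>u. (\<forall>w. x (bracket u w) = 0) \<longrightarrow> (\<exists>l. u = scl l c)"
  shows "skew_matrix d (\<lambda>i j. x (bracket (f i) (f j)))"
    and "kernel_line d (\<lambda>i j. x (bracket (f i) (f j))) (\<lambda>i. \<phi> i c)"
proof -
  define W where "W i j = x (bracket (f i) (f j))" for i j
  define C where "C i = \<phi> i c" for i
  have \<phi>: "\<phi> i \<in> dual_space scl" if "i < d" for i using fr that by (simp add: frame_def)
  have expand: "(\<Sum>i<d. \<phi> i v * w (f i)) = w v" if "w \<in> dual_space scl" for w v
    using frame_functional[OF fr that, of v] by simp
  have sk: "skew_matrix d W"
    unfolding skew_matrix_def W_def using bracket_swap dual_spaceD(4)[OF x] by metis
  have rowsum: "(\<Sum>j<d. W i j * a j) = x (bracket (f i) (\<Sum>j<d. scl (a j) (f j)))" for i a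
    by (simp add: W_def bracket_sum bracket_scale dual_spaceD(2,6)[OF x] mult.commute)
  have kernel: "kernel_vec d W a \<longleftrightarrow> (\<forall>w. x (bracket (\<Sum>j<d. scl (a j) (f j)) w) = 0)" for a
  proof
    let ?v = "\<Sum>j<d. scl (a j) (f j)"
    assume k: "kernel_vec d W a"
    show "\<forall>w. x (bracket ?v w) = 0"
    proof
      fix w
      have "x (bracket ?v (f i)) = 0" if "i < d" for i
        using k that bracket_swap[of ?v "f i"] by (simp add: kernel_vec_def rowsum dual_spaceD(4)[OF x])
      then show "x (bracket ?v w) = 0"
        using expand[OF functional_bracket_dual(1)[OF x, of ?v], of w] by simp
    qed
  next
    assume "\<forall>w. x (bracket (\<Sum>j<d. scl (a j) (f j)) w) = 0"
    then show "kernel_vec d W a"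
      unfolding kernel_vec_def rowsum using bracket_swap dual_spaceD(3,4)[OF x] by metis
  qed
  have c_sum: "(\<Sum>j<d. scl (C j) (f j)) = c"
    using fr unfolding frame_def C_def by metis
  have cline: "kernel_line d W C"
    unfolding kernel_line_def
  proof (intro conjI allI impI)
    show "kernel_vec d W C" unfolding kernel c_sum using c(1) by simp
    show "\<exists>j<d. C j \<noteq> 0"
    proof (rule ccontr)
      assume "\<not> ?thesis"
      then have "c = 0" unfolding c_sum[symmetric] by (intro sum.neutral) auto
      then show False using c(2) by simp
    qed
    fix a assume "kernel_vec d W a"
    then obtain l where l: "(\<Sum>j<d. scl (a j) (f j)) = scl l c" using line unfolding kernel by blast
    have "a j = l * C j" if "j < d" for j
      using arg_cong[OF l, of "\<phi> j"] frame_coordinates_of_combination[OF fr that, of a] dual_spaceD(2)[OF \<phi>[OF that]]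
      by (simp add: C_def)
    then show "\<exists>l. \<forall>j<d. a j = l * C j" by blast
  qed
  show "skew_matrix d (\<lambda>i j. x (bracket (f i) (f j)))"
    and "kernel_line d (\<lambda>i j. x (bracket (f i) (f j))) (\<lambda>i. \<phi> i c)"
    using sk cline unfolding W_def C_def by this
qed

text \<open>
  A skew form identifies the quotient by its kernel with the annihilator of the kernel.
\<close>

lemma coadjoint_image:
  fixes f :: "nat \<Rightarrow> 'a" and \<phi> :: "nat \<Rightarrow> 'a \<Rightarrow> 'k"
  assumes fr: "frame scl d f \<phi>" and x: "x \<in> dual_space scl"
    and c: "\<And>w. x (bracket c w) = 0" "c \<noteq> 0"
    and line: "\<forall>u. (\<forall>w. x (bracket u w) = 0) \<longrightarrow> (\<exists>l. u = scl l c)"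
    and z: "z \<in> dual_space scl" "z c = 0"
  obtains u where "\<And>w. x (bracket u w) = z w"
proof -
  note kl = bracket_kernel_line[OF fr x c line]
  have "(\<Sum>i<d. - z (f i) * \<phi> i c) = 0"
    using frame_functional[OF fr z(1), of c] z(2) by (simp add: sum_negf mult.commute)
  then obtain a where a: "\<And>i. i < d \<Longrightarrow> (\<Sum>j<d. x (bracket (f i) (f j)) * a j) = - z (f i)"
    by (rule skew_image_eq_annihilator[OF kl]) (rule that)
  let ?u = "\<Sum>j<d. scl (a j) (f j)"
  have "x (bracket ?u (f i)) = z (f i)" if "i < d" for i
  proof -
    have "x (bracket (f i) ?u) = - z (f i)"
      using a[OF that] by (simp add: bracket_sum bracket_scale dual_spaceD(2,6)[OF x] mult.commute)
    then show ?thesis using bracket_swap[of ?u "f i"] by (simp add: dual_spaceD(4)[OF x])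
  qed
  then have "x (bracket ?u w) = z w" for w
    using frame_functional[OF fr functional_bracket_dual(1)[OF x, of ?u], of w] frame_functional[OF fr z(1), of w] by simp
  then show thesis by (rule that)
qed

text \<open>
  Let \<open>N\<^sub>z\<close> be the matrix of the connection in the direction \<open>z\<close>, and let \<open>b = x \<circ> ad u\<close>. Both \<open>- N\<^sub>b\<close> and \<open>ad u\<close>
  transform the form at \<open>x\<close> into the form at \<open>b\<close>, so \<open>N\<^sub>b + ad u\<close> preserves the former and, by the trace
  identity, its trace is its eigenvalue \<open>e\<close> on \<open>c\<close>. The eigenvalue vanishes: \<open>x(N\<^sub>b c) = b(N\<^sub>x c)\<close> by the
  symmetry of \<open>K\<close>, and \<open>N\<^sub>x\<close> preserves the line of \<open>c\<close>, on which \<open>b\<close> is zero.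
\<close>

lemma flat_connection_trace:
  fixes f :: "nat \<Rightarrow> 'a" and \<phi> :: "nat \<Rightarrow> 'a \<Rightarrow> 'k" and K :: "nat \<Rightarrow> nat \<Rightarrow> nat \<Rightarrow> 'k"
  assumes fr: "frame scl d f \<phi>" and x: "x \<in> dual_space scl"
    and sym: "\<And>k r u. k < d \<Longrightarrow> r < d \<Longrightarrow> u < d \<Longrightarrow> K k r u = K r k u"
    and flat: "\<And>r u w. r < d \<Longrightarrow> u < d \<Longrightarrow> w < d \<Longrightarrow>
      (\<Sum>k<d. K k r u * x (bracket (f k) (f w))) + (\<Sum>k<d. K k r w * x (bracket (f u) (f k))) + \<phi> r (bracket (f u) (f w)) = 0"
    and c: "\<And>w. x (bracket c w) = 0" "x c \<noteq> 0"
    and line: "\<forall>u. (\<forall>w. x (bracket u w) = 0) \<longrightarrow> (\<exists>l. u = scl l c)"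
    and char: "(2::'k) \<noteq> 0"
  shows "(\<Sum>r<d. x (bracket u (f r)) * (\<Sum>i<d. K i r i)) = - (\<Sum>i<d. \<phi> i (bracket u (f i)))"
proof -
  define W where "W i j = x (bracket (f i) (f j))" for i j
  define C where "C i = \<phi> i c" for i
  have \<phi>: "\<phi> i \<in> dual_space scl" if "i < d" for i using fr that by (simp add: frame_def)
  have expand: "(\<Sum>i<d. \<phi> i v * w (f i)) = w v" if "w \<in> dual_space scl" for w v
    using frame_functional[OF fr that, of v] by simp
  have "c \<noteq> 0" using c(2) dual_spaceD(3)[OF x] by auto
  note kl = bracket_kernel_line[OF fr x c(1) this line]
  have sk: "skew_matrix d W" and cline: "kernel_line d W C"
    using kl unfolding W_def C_def by this
  let ?b = "\<lambda>v. x (bracket u v)"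
  have b: "?b \<in> dual_space scl" by (rule functional_bracket_dual(1)[OF x])
  define N where "N z k i = (\<Sum>r<d. z (f r) * K k r i)" for z :: "'a \<Rightarrow> 'k" and k i
  have N_conf: "(\<Sum>k<d. N z k i * W k j) + (\<Sum>k<d. W i k * N z k j) = - z (bracket (f i) (f j))"
    if z: "z \<in> dual_space scl" and ij: "i < d" "j < d" for z i j
  proof -
    have "(\<Sum>k<d. N z k i * W k j) = (\<Sum>r<d. z (f r) * (\<Sum>k<d. K k r i * W k j))"
      unfolding N_def sum_distrib_left sum_distrib_right mult.assoc by (rule sum.swap)
    moreover have "(\<Sum>k<d. W i k * N z k j) = (\<Sum>r<d. z (f r) * (\<Sum>k<d. K k r j * W i k))"
      unfolding N_def sum_distrib_left
      by (subst sum.swap) (simp add: mult_ac)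
    ultimately have "(\<Sum>k<d. N z k i * W k j) + (\<Sum>k<d. W i k * N z k j)
       = (\<Sum>r<d. z (f r) * ((\<Sum>k<d. K k r i * W k j) + (\<Sum>k<d. K k r j * W i k)))"
      by (simp only: distrib_left sum.distrib)
    also have "\<dots> = (\<Sum>r<d. - (\<phi> r (bracket (f i) (f j)) * z (f r)))"
    proof (intro sum.cong refl)
      fix r assume "r \<in> {..<d}"
      then have "(\<Sum>k<d. K k r i * W k j) + (\<Sum>k<d. K k r j * W i k) = - \<phi> r (bracket (f i) (f j))"
        using flat[of r i j] ij by (simp add: W_def eq_neg_iff_add_eq_0)
      then show "z (f r) * ((\<Sum>k<d. K k r i * W k j) + (\<Sum>k<d. K k r j * W i k)) = - (\<phi> r (bracket (f i) (f j)) * z (f r))"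
        by simp
    qed
    also have "\<dots> = - z (bracket (f i) (f j))" by (simp only: sum_negf expand[OF z])
    finally show ?thesis .
  qed
  define A where "A k i = \<phi> k (bracket u (f i))" for k i
  have A_conf: "(\<Sum>k<d. A k i * W k j) + (\<Sum>k<d. W i k * A k j) = ?b (bracket (f i) (f j))" for i j
  proof -
    have "(\<Sum>k<d. A k i * W k j) = x (bracket (bracket u (f i)) (f j))"
      unfolding A_def W_def by (rule expand[OF functional_bracket_dual(2)[OF x]])
    moreover have "(\<Sum>k<d. W i k * A k j) = x (bracket (f i) (bracket u (f j)))"
      unfolding A_def W_def using expand[OF functional_bracket_dual(1)[OF x, of "f i"], of "bracket u (f j)"]
      by (simp add: mult.commute)
    ultimately show ?thesis
      by (simp add: bracket_derivation[of u] dual_spaceD(1)[OF x])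
  qed
  have conf: "(\<Sum>k<d. (N ?b k i + A k i) * W k j + W i k * (N ?b k j + A k j)) = 0 * W i j" if "i < d" "j < d" for i j
  proof -
    have "(\<Sum>k<d. (N ?b k i + A k i) * W k j + W i k * (N ?b k j + A k j))
      = ((\<Sum>k<d. N ?b k i * W k j) + (\<Sum>k<d. W i k * N ?b k j)) + ((\<Sum>k<d. A k i * W k j) + (\<Sum>k<d. W i k * A k j))"
      unfolding distrib_left distrib_right sum.distrib by simp
    then show ?thesis unfolding N_conf[OF b that] A_conf by simp
  qed
  obtain e where e: "\<And>i. i < d \<Longrightarrow> (\<Sum>j<d. (N ?b i j + A i j) * C j) = e * C i"
    and tr: "2 * ((\<Sum>i<d. N ?b i i + A i i) - e) = 0 * (of_nat d - 1)"
    by (rule conformal_trace[OF sk cline conf]) (assumption | rule that)+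
  \<comment> \<open>the direction \<open>x\<close> itself scales the form, so it preserves the kernel line\<close>
  have confx: "(\<Sum>k<d. N x k i * W k j + W i k * N x k j) = (- 1) * W i j" if "i < d" "j < d" for i j
    using N_conf[OF x that] unfolding sum.distrib by (simp add: W_def)
  obtain e' where e': "\<And>i. i < d \<Longrightarrow> (\<Sum>j<d. N x i j * C j) = e' * C i"
    and "2 * ((\<Sum>i<d. N x i i) - e') = (- 1) * (of_nat d - 1)"
    by (rule conformal_trace[OF sk cline confx]) (assumption | rule that)+
  have xc: "(\<Sum>k<d. x (f k) * C k) = x c" and bc: "(\<Sum>k<d. ?b (f k) * C k) = 0"
    using expand[OF x, of c] expand[OF b, of c] c(1)[of u] bracket_swap[of u c]
    by (simp_all add: C_def mult.commute dual_spaceD(4)[OF x])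
  have "(\<Sum>k<d. x (f k) * (\<Sum>j<d. N ?b k j * C j)) = (\<Sum>k<d. \<Sum>j<d. \<Sum>r<d. x (f k) * (?b (f r) * (K k r j * C j)))"
    unfolding N_def sum_distrib_left sum_distrib_right by (simp add: mult.assoc)
  also have "\<dots> = (\<Sum>k<d. \<Sum>r<d. \<Sum>j<d. x (f k) * (?b (f r) * (K k r j * C j)))"
    by (intro sum.cong refl sum.swap)
  also have "\<dots> = (\<Sum>r<d. \<Sum>k<d. \<Sum>j<d. x (f k) * (?b (f r) * (K k r j * C j)))" by (rule sum.swap)
  also have "\<dots> = (\<Sum>r<d. \<Sum>j<d. \<Sum>k<d. x (f k) * (?b (f r) * (K k r j * C j)))"
    by (intro sum.cong refl sum.swap)
  also have "\<dots> = (\<Sum>r<d. ?b (f r) * (\<Sum>j<d. N x r j * C j))"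
    unfolding N_def sum_distrib_left sum_distrib_right
    by (intro sum.cong refl) (simp add: sym mult_ac)
  also have "\<dots> = (\<Sum>r<d. e' * (?b (f r) * C r))" by (intro sum.cong refl) (simp add: e')
  also have "\<dots> = 0" using bc by (simp only: sum_distrib_left[symmetric]) simp
  finally have N0: "(\<Sum>k<d. x (f k) * (\<Sum>j<d. N ?b k j * C j)) = 0" .
  have A0: "(\<Sum>k<d. x (f k) * (\<Sum>j<d. A k j * C j)) = 0"
  proof -
    have "(\<Sum>j<d. A k j * C j) = \<phi> k (bracket u c)" if "k < d" for k
      using expand[OF functional_bracket_dual(1)[OF \<phi>[OF that], of u], of c] by (simp add: A_def C_def mult.commute)
    then have "(\<Sum>k<d. x (f k) * (\<Sum>j<d. A k j * C j)) = (\<Sum>k<d. \<phi> k (bracket u c) * x (f k))"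
      by (intro sum.cong refl) simp
    also have "\<dots> = x (bracket u c)" by (rule expand[OF x])
    finally show ?thesis using c(1)[of u] bracket_swap[of u c] by (simp add: dual_spaceD(4)[OF x])
  qed
  have "e * x c = (\<Sum>k<d. x (f k) * (e * C k))" unfolding xc[symmetric] by (simp add: sum_distrib_left mult_ac)
  also have "\<dots> = (\<Sum>k<d. x (f k) * (\<Sum>j<d. (N ?b k j + A k j) * C j))"
    using e by (intro sum.cong refl) simp
  also have "\<dots> = (\<Sum>k<d. x (f k) * (\<Sum>j<d. N ?b k j * C j)) + (\<Sum>k<d. x (f k) * (\<Sum>j<d. A k j * C j))"
    unfolding distrib_right sum.distrib distrib_left ..
  finally have "e = 0" using N0 A0 c(2) by simp
  then have "2 * ((\<Sum>i<d. N ?b i i) + (\<Sum>i<d. A i i)) = 0" using tr by (simp only: sum.distrib) simp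
  then have "(\<Sum>i<d. N ?b i i) + (\<Sum>i<d. A i i) = 0" using char by (simp only: mult_eq_0_iff) simp
  moreover have "(\<Sum>i<d. N ?b i i) = (\<Sum>r<d. ?b (f r) * (\<Sum>i<d. K i r i))"
    unfolding N_def sum_distrib_left by (rule sum.swap)
  ultimately show ?thesis by (simp add: A_def eq_neg_iff_add_eq_0)
qed

end

section \<open>Flatness on the dual of the secondary algebra\<close>

lemma secondary_frame:
  fixes scl :: "'k::field \<Rightarrow> 'a::ab_group_add \<Rightarrow> 'a"
  assumes L: "lie_algebra scl bas bracket" and fr: "frame scl m e \<epsilon>"
  defines "F \<equiv> \<lambda>j. if j < m then (e j, 0, 0) else if j < 2 * m then (0, e (j - m), 0) else (0, 0, 1)"
    and "\<Phi> \<equiv> \<lambda>j (v, v', s). if j < m then \<epsilon> j v else if j < 2 * m then \<epsilon> (j - m) v' else s"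
  shows "frame (secondary_scale scl) (2 * m + 1) F \<Phi>"
proof -
  obtain B where "lie_algebra (secondary_scale scl) B (secondary_bracket scl bracket)"
    using lie_algebra_secondary(1)[OF L] by blast
  then interpret B: lie_algebra "secondary_scale scl" B "secondary_bracket scl bracket" .
  interpret lie_algebra scl bas bracket by (rule L)
  have \<epsilon>: "\<epsilon> i \<in> dual_space scl" if "i < m" for i using fr that by (simp add: frame_def)
  have delta: "\<epsilon> i (e j) = (if i = j then 1 else 0)" if "i < m" "j < m" for i j
    using fr that by (simp add: frame_def)
  have x: "x = (\<Sum>i<m. scl (\<epsilon> i x) (e i))" for x using fr unfolding frame_def by blast
  have sumP: "(\<Sum>i\<in>I. (g i, g' i, g'' i)) = (\<Sum>i\<in>I. g i, \<Sum>i\<in>I. g' i, \<Sum>i\<in>I. g'' i)"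
    for I :: "nat set" and g g' :: "nat \<Rightarrow> 'a" and g'' :: "nat \<Rightarrow> 'k"
    by (induction I rule: infinite_finite_induct) (auto simp: zero_prod_def)
  show ?thesis
    unfolding frame_def
  proof (intro conjI allI impI)
    show "vector_space (secondary_scale scl)" by (rule B.vector_space_axioms)
    fix i assume i: "i < 2 * m + 1"
    have "i < 2 * m \<Longrightarrow> \<not> i < m \<Longrightarrow> \<epsilon> (i - m) \<in> dual_space scl" by (rule \<epsilon>) linarith
    then show "\<Phi> i \<in> dual_space (secondary_scale scl)"
      unfolding dual_space_iff[OF B.vector_space_axioms] \<Phi>_def secondary_scale_def
      using \<epsilon>[of i] by (auto simp: dual_spaceD split: prod.splits)
    fix j assume j: "j < 2 * m + 1"
    have z: "\<epsilon> k 0 = 0" if "k < m" for k by (rule dual_spaceD(3)[OF \<epsilon>[OF that]])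
    show "\<Phi> i (F j) = (if i = j then 1 else 0)"
      using i j delta[of i j] delta[of "i - m" "j - m"] z[of i] z[of "i - m"]
      by (auto simp: \<Phi>_def F_def)
  next
    fix u :: "'a \<times> 'a \<times> 'k"
    obtain v v' s where u: "u = (v, v', s)" by (cases u)
    have 1: "(\<Sum>j<m. secondary_scale scl (\<Phi> j u) (F j)) = (v, 0, 0)"
    proof -
      have "(\<Sum>j<m. secondary_scale scl (\<Phi> j u) (F j)) = (\<Sum>j<m. (scl (\<epsilon> j v) (e j), 0, 0))"
        by (intro sum.cong) (auto simp: \<Phi>_def F_def u secondary_scale_def)
      then show ?thesis using x[of v] by (simp add: sumP)
    qed
    have 2: "(\<Sum>j<m. secondary_scale scl (\<Phi> (m + j) u) (F (m + j))) = (0, v', 0)"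
    proof -
      have "(\<Sum>j<m. secondary_scale scl (\<Phi> (m + j) u) (F (m + j))) = (\<Sum>j<m. (0, scl (\<epsilon> j v') (e j), 0))"
        by (intro sum.cong) (auto simp: \<Phi>_def F_def u secondary_scale_def)
      then show ?thesis using x[of v'] by (simp add: sumP)
    qed
    show "u = (\<Sum>j<2 * m + 1. secondary_scale scl (\<Phi> j u) (F j))"
      unfolding sum_secondary_split 1 2 by (simp add: \<Phi>_def F_def u secondary_scale_def)
  qed
qed

lemma secondary_functional_dual:
  fixes scl :: "'k::field \<Rightarrow> 'a::ab_group_add \<Rightarrow> 'a"
  assumes "lie_algebra scl bas bracket" and x: "x \<in> dual_space scl" and y: "y \<in> dual_space scl"
  shows "(\<lambda>(v, v', s). x v + y v') \<in> dual_space (secondary_scale scl)"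
proof -
  obtain B where "lie_algebra (secondary_scale scl) B (secondary_bracket scl bracket)"
    using lie_algebra_secondary(1)[OF assms(1)] by blast
  then interpret B: lie_algebra "secondary_scale scl" B "secondary_bracket scl bracket" .
  show ?thesis
    unfolding dual_space_iff[OF B.vector_space_axioms] secondary_scale_def
    by (auto simp: dual_spaceD[OF x] dual_spaceD[OF y] algebra_simps split: prod.splits)
qed

text \<open>
  The kernel at \<open>(x, y, 0)\<close> for a contact \<open>y\<close> with Reeb vector \<open>R\<close>. The second component solves
  \<open>y([v', w]) = - x([R, w])\<close>; adding a multiple of \<open>R\<close> makes \<open>y(v') = 0\<close>.
\<close>

lemma secondary_kernel:
  fixes scl :: "'k::field \<Rightarrow> 'a::ab_group_add \<Rightarrow> 'a"
  assumes L: "lie_algebra scl bas bracket" and fr: "frame scl m e \<epsilon>"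
    and x: "x \<in> dual_space scl" and y: "y \<in> dual_space scl"
    and R: "\<And>w. y (bracket R w) = 0" "y R = 1"
    and contact: "\<forall>u. (\<forall>w. y (bracket u w) = 0) \<longrightarrow> y u = 0 \<longrightarrow> u = 0"
  shows "\<exists>v'. (\<forall>w. (\<lambda>(v, v', s). x v + y v') (secondary_bracket scl bracket (R, v', 0) w) = 0) \<and>
    (\<lambda>(v, v', s). x v + y v') (R, v', 0) = x R \<and>
    (\<forall>u. (\<forall>w. (\<lambda>(v, v', s). x v + y v') (secondary_bracket scl bracket u w) = 0) \<longrightarrow>
      (\<exists>l. u = secondary_scale scl l (R, v', 0)))"
proof -
  interpret lie_algebra scl bas bracket by (rule L)
  note xD = dual_spaceD[OF x] and yD = dual_spaceD[OF y]
  have b0: "bracket 0 w = 0" "bracket w 0 = 0" for w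
    using bracket_scale(1)[of 0 0 w] bracket_scale(2)[of w 0 0] by simp_all
  have line: "\<exists>l. u = scl l R" if "\<And>w. y (bracket u w) = 0" for u
  proof -
    have "y (bracket (u + scl (- y u) R) w) = 0" for w
      using that R(1) by (simp only: bracket_add bracket_scale yD) simp
    moreover have "y (u + scl (- y u) R) = 0" using R(2) by (simp only: yD) simp
    ultimately have "u + scl (- y u) R = 0" using contact by blast
    then have "u = scl (y u) R" by simp
    then show ?thesis by blast
  qed
  have R0: "R \<noteq> 0" using R(2) yD(3) by auto
  have z: "(\<lambda>w. - x (bracket R w)) \<in> dual_space scl"
    by (simp add: dual_space_iff[OF vector_space_axioms] bracket_add bracket_scale xD)
  obtain u\<^sub>0 where u0: "\<And>w. y (bracket u\<^sub>0 w) = - x (bracket R w)"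
  proof (rule coadjoint_image[OF fr y R(1) R0 _ z])
    show "\<forall>u. (\<forall>w. y (bracket u w) = 0) \<longrightarrow> (\<exists>l. u = scl l R)" using line by blast
    show "- x (bracket R R) = 0" by (simp add: bracket_same xD)
  qed (rule that)
  define v' where "v' = u\<^sub>0 + scl (- y u\<^sub>0) R"
  have v': "y (bracket v' w) = - x (bracket R w)" for w
    using u0[of w] R(1)[of w] by (simp only: v'_def bracket_add bracket_scale yD) simp
  have yv': "y v' = 0" using R(2) by (simp only: v'_def yD) simp
  show ?thesis
  proof (intro exI[of _ v'] conjI allI impI)
    fix w show "(\<lambda>(v, v', s). x v + y v') (secondary_bracket scl bracket (R, v', 0) w) = 0"
      using v' yv' R(1) bracket_swap[of _ v']
      by (cases w) (simp add: secondary_bracket_def yD b0)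
    show "(\<lambda>(v, v', s). x v + y v') (R, v', 0) = x R" using yv' by simp
  next
    fix u assume "\<forall>w. (\<lambda>(v, v', s). x v + y v') (secondary_bracket scl bracket u w) = 0"
    then have u: "(\<lambda>(v, v', s). x v + y v') (secondary_bracket scl bracket u w) = 0" for w by blast
    obtain a a' s where ua: "u = (a, a', s)" by (cases u)
    have e1: "x (bracket a w) + y (bracket a' w) = 0" for w
      using u[of "(w, 0, 0)"] bracket_swap[of w a'] by (simp add: ua secondary_bracket_def yD b0)
    have e2: "y (bracket a w) - s * y w = 0" for w
      using u[of "(0, w, 0)"] by (simp add: ua secondary_bracket_def yD xD b0)
    have e3: "y a' = 0"
      using u[of "(0, 0, 1)"] by (simp add: ua secondary_bracket_def yD xD b0)
    have "y (bracket a R) = 0" using R(1)[of a] bracket_swap[of a R] by (simp add: yD)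
    then have s: "s = 0" using e2[of R] R(2) by simp
    then obtain l where l: "a = scl l R" using line[of a] e2 by auto
    have "y (bracket (a' + scl (- l) v') w) = 0" for w
    proof -
      have "y (bracket (a' + scl (- l) v') w) = y (bracket a' w) + l * x (bracket R w)"
        by (simp only: bracket_add bracket_scale yD v') simp
      then show ?thesis using e1[of w] by (simp add: l bracket_scale xD add.commute)
    qed
    moreover have "y (a' + scl (- l) v') = 0" using e3 yv' by (simp only: yD) simp
    ultimately have "a' + scl (- l) v' = 0" using contact by blast
    then have "a' = scl l v'" by simp
    with s l show "\<exists>l. u = secondary_scale scl l (R, v', 0)" by (auto simp: ua secondary_scale_def)
  qed
qed

text \<open>
  Elements of \<open>A\<close> act tracelessly on both copies of \<open>A\<close> by unimodularity; the last generator acts as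
  minus the identity on the second copy.
\<close>

lemma secondary_trace:
  fixes scl :: "'k::field \<Rightarrow> 'a::ab_group_add \<Rightarrow> 'a"
  assumes L: "lie_algebra scl bas bracket" and fr: "frame scl m e \<epsilon>"
    and unimod: "\<And>a. (\<Sum>i<m. \<epsilon> i (bracket a (e i))) = 0"
  defines "F \<equiv> \<lambda>j. if j < m then (e j, 0, 0) else if j < 2 * m then (0, e (j - m), 0) else (0, 0, 1)"
    and "\<Phi> \<equiv> \<lambda>j (v, v', s). if j < m then \<epsilon> j v else if j < 2 * m then \<epsilon> (j - m) v' else s"
  shows "(\<Sum>i<2 * m + 1. \<Phi> i (secondary_bracket scl bracket (v, v', s) (F i))) = - (of_nat m * s)"
proof -
  interpret lie_algebra scl bas bracket by (rule L)
  have b0: "bracket 0 w = 0" "bracket w 0 = 0" for w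
    using bracket_scale(1)[of 0 0 w] bracket_scale(2)[of w 0 0] by simp_all
  have \<epsilon>: "\<epsilon> i \<in> dual_space scl" and one: "\<epsilon> i (e i) = 1" if "i < m" for i using fr that by (simp_all add: frame_def)
  have 1: "(\<Sum>i<m. \<Phi> i (secondary_bracket scl bracket (v, v', s) (F i))) = 0"
  proof -
    have "(\<Sum>i<m. \<Phi> i (secondary_bracket scl bracket (v, v', s) (F i))) = (\<Sum>i<m. \<epsilon> i (bracket v (e i)))"
      by (intro sum.cong) (auto simp: \<Phi>_def F_def secondary_bracket_def)
    then show ?thesis using unimod by simp
  qed
  have 2: "(\<Sum>i<m. \<Phi> (m + i) (secondary_bracket scl bracket (v, v', s) (F (m + i)))) = - (of_nat m * s)"
  proof -
    have "(\<Sum>i<m. \<Phi> (m + i) (secondary_bracket scl bracket (v, v', s) (F (m + i))))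
        = (\<Sum>i<m. \<epsilon> i (bracket v (e i)) - s)"
      by (intro sum.cong refl) (auto simp: \<Phi>_def F_def secondary_bracket_def b0 dual_spaceD[OF \<epsilon>] one)
    then show ?thesis using unimod by (simp add: sum_subtractf)
  qed
  show ?thesis
    unfolding sum_secondary_split 1 2 by (simp add: \<Phi>_def F_def secondary_bracket_def)
qed

text \<open>
  Functionals \<open>b\<close> that vanish on the kernel are \<open>z \<circ> ad u\<close> with \<open>z = (x, y, 0)\<close>. Evaluating at \<open>(0, R, 0)\<close>
  recovers the last component of \<open>u\<close>, and with it the trace of \<open>ad u\<close>.
\<close>

lemma flat_secondary_trace:
  fixes scl :: "'k::field_char_0 \<Rightarrow> 'a::ab_group_add \<Rightarrow> 'a" and K :: "nat \<Rightarrow> nat \<Rightarrow> nat \<Rightarrow> 'k"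
  assumes L: "lie_algebra scl bas bracket" and fr: "frame scl m e \<epsilon>"
    and unimod: "\<And>a. (\<Sum>i<m. \<epsilon> i (bracket a (e i))) = 0"
    and x: "x \<in> dual_space scl" and y: "y \<in> dual_space scl"
    and R: "\<And>w. y (bracket R w) = 0" "y R = 1" "x R \<noteq> 0"
    and contact: "\<forall>u. (\<forall>w. y (bracket u w) = 0) \<longrightarrow> y u = 0 \<longrightarrow> u = 0"
  defines "F \<equiv> \<lambda>j. if j < m then (e j, 0, 0) else if j < 2 * m then (0, e (j - m), 0) else (0, 0, 1)"
    and "\<Phi> \<equiv> \<lambda>j (v, v', s). if j < m then \<epsilon> j v else if j < 2 * m then \<epsilon> (j - m) v' else s"
  assumes sym: "\<And>k r u. k < 2 * m + 1 \<Longrightarrow> r < 2 * m + 1 \<Longrightarrow> u < 2 * m + 1 \<Longrightarrow> K k r u = K r k u"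
    and flat: "\<And>r u w. r < 2 * m + 1 \<Longrightarrow> u < 2 * m + 1 \<Longrightarrow> w < 2 * m + 1 \<Longrightarrow>
      (\<Sum>k<2 * m + 1. K k r u * (\<lambda>(v, v', s). x v + y v') (secondary_bracket scl bracket (F k) (F w)))
      + (\<Sum>k<2 * m + 1. K k r w * (\<lambda>(v, v', s). x v + y v') (secondary_bracket scl bracket (F u) (F k)))
      + \<Phi> r (secondary_bracket scl bracket (F u) (F w)) = 0"
  shows "\<exists>v'. \<forall>b\<in>dual_space (secondary_scale scl). b (R, v', 0) = 0 \<longrightarrow>
    (\<Sum>r<2 * m + 1. b (F r) * (\<Sum>i<2 * m + 1. K i r i)) = - (of_nat m * b (0, R, 0))"
proof -
  let ?X = "\<lambda>(v, v', s). x v + y v'" and ?B = "secondary_bracket scl bracket"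
  obtain B where "lie_algebra (secondary_scale scl) B ?B" using lie_algebra_secondary(1)[OF L] by blast
  then interpret B: lie_algebra "secondary_scale scl" B ?B .
  interpret lie_algebra scl bas bracket by (rule L)
  have b0: "bracket 0 w = 0" "bracket w 0 = 0" for w
    using bracket_scale(1)[of 0 0 w] bracket_scale(2)[of w 0 0] by simp_all
  note frB = secondary_frame[OF L fr, folded F_def \<Phi>_def]
  have X: "?X \<in> dual_space (secondary_scale scl)" by (rule secondary_functional_dual[OF L x y])
  obtain v' where ker: "\<And>w. ?X (?B (R, v', 0) w) = 0" and val: "?X (R, v', 0) = x R"
    and line: "\<forall>u. (\<forall>w. ?X (?B u w) = 0) \<longrightarrow> (\<exists>l. u = secondary_scale scl l (R, v', 0))"
    using secondary_kernel[OF L fr x y R(1,2) contact] by blast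
  have Xc: "?X (R, v', 0) \<noteq> 0" using val R(3) by simp
  have nz: "(R, v', 0) \<noteq> (0 :: 'a \<times> 'a \<times> 'k)" using R(2) dual_spaceD(3)[OF y] by (auto simp: zero_prod_def)
  have "(\<Sum>r<2 * m + 1. b (F r) * (\<Sum>i<2 * m + 1. K i r i)) = - (of_nat m * b (0, R, 0))"
    if b: "b \<in> dual_space (secondary_scale scl)" "b (R, v', 0) = 0" for b
  proof -
    obtain u where u: "\<And>w. ?X (?B u w) = b w" by (rule B.coadjoint_image[OF frB X ker nz line b]) (rule that)
    obtain a a' s where ua: "u = (a, a', s)" by (cases u)
    have "(\<Sum>r<2 * m + 1. ?X (?B u (F r)) * (\<Sum>i<2 * m + 1. K i r i)) = - (\<Sum>i<2 * m + 1. \<Phi> i (?B u (F i)))"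
      by (rule B.flat_connection_trace[OF frB X sym flat ker Xc line]) auto
    also have "(\<Sum>i<2 * m + 1. \<Phi> i (?B u (F i))) = - (of_nat m * s)"
      unfolding ua F_def \<Phi>_def by (rule secondary_trace[OF L fr unimod])
    finally have 1: "(\<Sum>r<2 * m + 1. b (F r) * (\<Sum>i<2 * m + 1. K i r i)) = of_nat m * s"
      unfolding u by simp
    have "y (bracket a R) = 0"
      using R(1)[of a] bracket_swap[of a R] by (simp add: dual_spaceD[OF y])
    then have "b (0, R, 0) = - s"
      using u[of "(0, R, 0)"] R(2)
      by (simp add: ua secondary_bracket_def b0 dual_spaceD[OF x] dual_spaceD[OF y])
    with 1 show ?thesis by simp
  qed
  then show ?thesis by blast
qed

text \<open>
  The hypothesis says that \<open>R\<close> and \<open>R'\<close> are linearly independent.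
\<close>

lemma separating_functionals:
  fixes scl :: "'k::field \<Rightarrow> 'a::ab_group_add \<Rightarrow> 'a"
  assumes fr: "frame scl m e \<epsilon>" and y: "y \<in> dual_space scl" "y R = 1"
    and ind: "R' \<noteq> scl (y R') R"
  obtains a b where "a \<in> dual_space scl" "b \<in> dual_space scl" "a R = 1" "a R' = 0" "b R = 0" "b R' = 1"
proof -
  have vs: "vector_space scl" using fr by (simp add: frame_def)
  note iff = dual_space_iff[OF vs]
  obtain i where i: "i < m" "\<epsilon> i R' \<noteq> \<epsilon> i (scl (y R') R)"
    using frame_vector_eqI[OF fr, of R' "scl (y R') R"] ind by blast
  have \<epsilon>: "\<epsilon> i \<in> dual_space scl" using fr i(1) by (simp add: frame_def)
  define g where "g = \<epsilon> i R' - y R' * \<epsilon> i R"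
  have g: "g \<noteq> 0" using i(2) by (simp add: g_def dual_spaceD[OF \<epsilon>])
  define b where "b = (\<lambda>x. (\<epsilon> i x - \<epsilon> i R * y x) / g)"
  define a where "a = (\<lambda>x. y x - y R' * b x)"
  have b: "b \<in> dual_space scl"
    unfolding iff b_def by (simp add: dual_spaceD[OF \<epsilon>] dual_spaceD[OF y(1)] add_divide_distrib diff_divide_distrib algebra_simps)
  have a: "a \<in> dual_space scl"
    unfolding iff a_def by (simp add: dual_spaceD[OF b] dual_spaceD[OF y(1)] algebra_simps)
  have "b R = 0" "b R' = 1" using g y(2) by (simp_all add: b_def g_def mult.commute)
  then show thesis using a b y(2) by (intro that[of a b]) (simp_all add: a_def)
qed

lemma two_form_lie_poisson:
  assumes "lie_algebra scl bas bracket" "q \<in> dual_space scl"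
  shows "two_form scl (lie_poisson bracket q)"
proof -
  interpret lie_algebra scl bas bracket by fact
  have "lie_poisson bracket q = (\<lambda>a b. q (bracket a b))"
    by (simp add: fun_eq_iff lie_poisson_def)
  then show ?thesis
    using functional_bracket_dual[OF assms(2)] dual_spaceD(3)[OF assms(2)]
    by (auto simp: two_form_def dual_space_def bracket_same)
qed

text \<open>
  The trace of the connection is one linear function of \<open>b\<close>, whereas the preceding formula evaluates
  it through \<open>R\<close> for the parameter \<open>t\<close> and through \<open>R'\<close> for \<open>t'\<close>.
\<close>

lemma secondary_pair_not_flat:
  fixes scl :: "'k::real_or_complex \<Rightarrow> 'a::ab_group_add \<Rightarrow> 'a"
  assumes L: "lie_algebra scl bas bracket" and fr: "frame scl m e \<epsilon>" and m: "m > 0"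
    and dim: "vector_space.dim scl UNIV = m"
    and unimod: "\<And>a. (\<Sum>i<m. \<epsilon> i (bracket a (e i))) = 0"
    and p: "p\<^sub>1 \<in> dual_space scl" and q: "q\<^sub>0 \<in> dual_space scl" "q\<^sub>1 \<in> dual_space scl"
    and R: "\<And>w. p\<^sub>1 (bracket R w) + t * q\<^sub>1 (bracket R w) = 0" "p\<^sub>1 R + t * q\<^sub>1 R = 1" "t * q\<^sub>0 R \<noteq> 0"
    and contact: "\<forall>u. (\<forall>w. p\<^sub>1 (bracket u w) + t * q\<^sub>1 (bracket u w) = 0) \<longrightarrow> p\<^sub>1 u + t * q\<^sub>1 u = 0 \<longrightarrow> u = 0"
    and R': "\<And>w. p\<^sub>1 (bracket R' w) + t' * q\<^sub>1 (bracket R' w) = 0" "p\<^sub>1 R' + t' * q\<^sub>1 R' = 1" "t' * q\<^sub>0 R' \<noteq> 0"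
    and contact': "\<forall>u. (\<forall>w. p\<^sub>1 (bracket u w) + t' * q\<^sub>1 (bracket u w) = 0) \<longrightarrow> p\<^sub>1 u + t' * q\<^sub>1 u = 0 \<longrightarrow> u = 0"
    and ind: "\<nexists>l. R' = scl l R"
  shows "\<not> flat_at (secondary_scale scl) (lie_poisson (secondary_bracket scl bracket))
    (\<lambda>_. lie_poisson (secondary_bracket scl bracket) (\<lambda>(v, v', s). q\<^sub>0 v + q\<^sub>1 v')) (\<lambda>(v, v', s). p\<^sub>1 v')"
proof
  let ?B = "secondary_bracket scl bracket" and ?S = "secondary_scale scl"
  let ?P = "\<lambda>(v :: 'a, v' :: 'a, s :: 'k). p\<^sub>1 v'" and ?Q = "\<lambda>(v :: 'a, v' :: 'a, s :: 'k). q\<^sub>0 v + q\<^sub>1 v'"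
  assume "flat_at ?S (lie_poisson ?B) (\<lambda>_. lie_poisson ?B ?Q) ?P"
  then obtain U x where loc: "local_coordinates ?S ?P U x"
    and cc: "constant_coefficients ?S (lie_poisson ?B) U x" "constant_coefficients ?S (\<lambda>_. lie_poisson ?B ?Q) U x"
    unfolding flat_at_def by blast
  obtain BB where LB: "lie_algebra ?S BB ?B" using lie_algebra_secondary(1)[OF L] by blast
  interpret B: lie_algebra ?S BB ?B by (rule LB)
  interpret lie_algebra scl bas bracket by (rule L)
  define F where "F = (\<lambda>j. if j < m then (e j, 0, 0) else if j < 2 * m then (0, e (j - m), 0) else (0, 0, 1 :: 'k))"
  define \<Phi> where "\<Phi> = (\<lambda>j (v, v', s :: 'k). if j < m then \<epsilon> j v else if j < 2 * m then \<epsilon> (j - m) v' else s)"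
  have frB: "frame ?S (2 * m + 1) F \<Phi>" unfolding F_def \<Phi>_def by (rule secondary_frame[OF L fr])
  have dimB: "vector_space.dim ?S UNIV = 2 * m + 1" using lie_algebra_secondary(2)[OF L] dim by simp
  have Q: "?Q \<in> dual_space ?S" by (rule secondary_functional_dual[OF L q])
  obtain K where sym: "\<And>k r u. k < 2 * m + 1 \<Longrightarrow> r < 2 * m + 1 \<Longrightarrow> u < 2 * m + 1 \<Longrightarrow> K k r u = K r k u"
    and flat: "\<And>A A'. constant_coefficients ?S A U x \<Longrightarrow> (\<forall>q\<in>dual_space ?S. two_form ?S (A q)) \<Longrightarrow>
      (\<forall>r<2 * m + 1. \<forall>k<2 * m + 1. \<forall>l<2 * m + 1. has_directional_derivative (\<lambda>q. A q (F k) (F l)) ?P (\<Phi> r) (A' r k l)) \<Longrightarrow>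
      (\<forall>r<2 * m + 1. \<forall>u<2 * m + 1. \<forall>w<2 * m + 1. (\<Sum>k<2 * m + 1. K k r u * A ?P (F k) (F w))
        + (\<Sum>k<2 * m + 1. K k r w * A ?P (F u) (F k)) + A' r u w = 0)"
    using flat_connection[OF frB dimB loc] by blast
  have flatP: "\<forall>r<2 * m + 1. \<forall>u<2 * m + 1. \<forall>w<2 * m + 1. (\<Sum>k<2 * m + 1. K k r u * lie_poisson ?B ?P (F k) (F w))
        + (\<Sum>k<2 * m + 1. K k r w * lie_poisson ?B ?P (F u) (F k)) + \<Phi> r (?B (F u) (F w)) = 0"
  proof (rule flat[OF cc(1)])
    show "\<forall>q\<in>dual_space ?S. two_form ?S (lie_poisson ?B q)" using two_form_lie_poisson[OF LB] by blast
    have "has_directional_derivative (\<lambda>q. lie_poisson ?B q (F k) (F l)) ?P (\<Phi> r) (\<Phi> r (?B (F k) (F l)))" for r k l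
      unfolding has_directional_derivative_def lie_poisson_def
      by (auto intro!: derivative_eq_intros)
    then show "\<forall>r<2 * m + 1. \<forall>k<2 * m + 1. \<forall>l<2 * m + 1.
      has_directional_derivative (\<lambda>q. lie_poisson ?B q (F k) (F l)) ?P (\<Phi> r) (\<Phi> r (?B (F k) (F l)))" by blast
  qed
  have flatQ: "\<forall>r<2 * m + 1. \<forall>u<2 * m + 1. \<forall>w<2 * m + 1. (\<Sum>k<2 * m + 1. K k r u * lie_poisson ?B ?Q (F k) (F w))
        + (\<Sum>k<2 * m + 1. K k r w * lie_poisson ?B ?Q (F u) (F k)) + 0 = 0"
  proof (rule flat[OF cc(2), of "\<lambda>_ _ _. 0"])
    show "\<forall>q\<in>dual_space ?S. two_form ?S (lie_poisson ?B ?Q)" using two_form_lie_poisson[OF LB Q] by blast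
  qed (simp add: has_directional_derivative_def)
  have pencil: "\<exists>v'. \<forall>b\<in>dual_space ?S. b (S, v', 0) = 0 \<longrightarrow>
      (\<Sum>r<2 * m + 1. b (F r) * (\<Sum>i<2 * m + 1. K i r i)) = - (of_nat m * b (0, S, 0))"
    if S: "\<And>w. p\<^sub>1 (bracket S w) + \<tau> * q\<^sub>1 (bracket S w) = 0" "p\<^sub>1 S + \<tau> * q\<^sub>1 S = 1" "\<tau> * q\<^sub>0 S \<noteq> 0"
      and con: "\<forall>u. (\<forall>w. p\<^sub>1 (bracket u w) + \<tau> * q\<^sub>1 (bracket u w) = 0) \<longrightarrow> p\<^sub>1 u + \<tau> * q\<^sub>1 u = 0 \<longrightarrow> u = 0"
    for S \<tau>
  proof -
    have xd: "(\<lambda>v. \<tau> * q\<^sub>0 v) \<in> dual_space scl" and yd: "(\<lambda>v. p\<^sub>1 v + \<tau> * q\<^sub>1 v) \<in> dual_space scl"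
      by (simp_all add: dual_space_iff[OF vector_space_axioms] dual_spaceD[OF p] dual_spaceD[OF q(1)]
          dual_spaceD[OF q(2)] algebra_simps)
    have X: "(\<lambda>(v, v', s). \<tau> * q\<^sub>0 v + (p\<^sub>1 v' + \<tau> * q\<^sub>1 v')) z = lie_poisson (\<lambda>_. id) ?P z z + \<tau> * ?Q z"
      for z :: "'a \<times> 'a \<times> 'k"
      by (cases z) (simp add: lie_poisson_def algebra_simps)
    have eq: "(\<lambda>(v, v', s). \<tau> * q\<^sub>0 v + (p\<^sub>1 v' + \<tau> * q\<^sub>1 v')) (?B a b) = lie_poisson ?B ?P a b + \<tau> * lie_poisson ?B ?Q a b"
      for a b unfolding X by (simp add: lie_poisson_def)
    have fl: "(\<Sum>k<2 * m + 1. K k r u * (\<lambda>(v, v', s). \<tau> * q\<^sub>0 v + (p\<^sub>1 v' + \<tau> * q\<^sub>1 v')) (?B (F k) (F w)))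
        + (\<Sum>k<2 * m + 1. K k r w * (\<lambda>(v, v', s). \<tau> * q\<^sub>0 v + (p\<^sub>1 v' + \<tau> * q\<^sub>1 v')) (?B (F u) (F k)))
        + \<Phi> r (?B (F u) (F w)) = 0" if *: "r < 2 * m + 1" "u < 2 * m + 1" "w < 2 * m + 1" for r u w
    proof -
      have "(\<Sum>k<2 * m + 1. K k r u * (lie_poisson ?B ?P (F k) (F w) + \<tau> * lie_poisson ?B ?Q (F k) (F w)))
        + (\<Sum>k<2 * m + 1. K k r w * (lie_poisson ?B ?P (F u) (F k) + \<tau> * lie_poisson ?B ?Q (F u) (F k))) + \<Phi> r (?B (F u) (F w))
        = ((\<Sum>k<2 * m + 1. K k r u * lie_poisson ?B ?P (F k) (F w))
        + (\<Sum>k<2 * m + 1. K k r w * lie_poisson ?B ?P (F u) (F k)) + \<Phi> r (?B (F u) (F w)))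
        + \<tau> * ((\<Sum>k<2 * m + 1. K k r u * lie_poisson ?B ?Q (F k) (F w))
        + (\<Sum>k<2 * m + 1. K k r w * lie_poisson ?B ?Q (F u) (F k)) + 0)"
        unfolding distrib_left sum.distrib sum_distrib_left by (simp add: mult_ac)
      also have "\<dots> = 0" using flatP flatQ * by (simp only: ) simp
      finally show ?thesis unfolding eq .
    qed
    show ?thesis
      unfolding F_def
      by (rule flat_secondary_trace[OF L fr unimod xd yd S(1,2,3) con sym fl[unfolded F_def \<Phi>_def]])
  qed
  obtain v where v: "\<And>b. b \<in> dual_space ?S \<Longrightarrow> b (R, v, 0) = 0 \<Longrightarrow>
      (\<Sum>r<2 * m + 1. b (F r) * (\<Sum>i<2 * m + 1. K i r i)) = - (of_nat m * b (0, R, 0))"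
    using pencil[OF R contact] by blast
  obtain v' where v': "\<And>b. b \<in> dual_space ?S \<Longrightarrow> b (R', v', 0) = 0 \<Longrightarrow>
      (\<Sum>r<2 * m + 1. b (F r) * (\<Sum>i<2 * m + 1. K i r i)) = - (of_nat m * b (0, R', 0))"
    using pencil[OF R' contact'] by blast
  have yd: "(\<lambda>v. p\<^sub>1 v + t * q\<^sub>1 v) \<in> dual_space scl"
    by (simp add: dual_space_iff[OF vector_space_axioms] dual_spaceD[OF p] dual_spaceD[OF q(2)] algebra_simps)
  obtain a b where ab: "a \<in> dual_space scl" "b \<in> dual_space scl" "a R = 1" "a R' = 0" "b R = 0" "b R' = 1"
    by (rule separating_functionals[OF fr yd R(2), of R']) (use ind that in auto)
  let ?b = "\<lambda>(u, u', s :: 'k). (- a v * a u - a v' * b u) + a u'"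
  \<comment> \<open>the first component is chosen so that \<open>b\<close> vanishes on both kernel vectors\<close>
  have "(\<lambda>u. - a v * a u - a v' * b u) \<in> dual_space scl"
    by (simp add: dual_space_iff[OF vector_space_axioms] dual_spaceD[OF ab(1)] dual_spaceD[OF ab(2)] algebra_simps)
  then have bd: "?b \<in> dual_space ?S" by (rule secondary_functional_dual[OF L _ ab(1)])
  have "of_nat m * ?b (0, R, 0) = of_nat m * ?b (0, R', 0)"
    using v[OF bd] v'[OF bd] ab by simp
  then show False using ab m by (simp add: dual_spaceD[OF ab(1)] dual_spaceD[OF ab(2)])
qed

section \<open>Contact functionals\<close>

text \<open>
  An enumeration of the basis, in which the trace becomes the usual sum of diagonal entries.
\<close>

lemma lie_algebra_frame:
  assumes L: "lie_algebra scl bas bracket" and dim: "vector_space.dim scl UNIV = m"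
  obtains e \<epsilon> where "frame scl m e \<epsilon>" "\<And>f. trace_on scl bas f = (\<Sum>i<m. \<epsilon> i (f (e i)))"
proof -
  interpret lie_algebra scl bas bracket by (rule L)
  have "card bas = m"
    using dim_eq_card[OF _ independent_Basis, of UNIV] span_Basis dim by simp
  then obtain e where e: "bij_betw e {..<m} bas"
    using ex_bij_betw_nat_finite[OF finite_Basis] by (auto simp: lessThan_atLeast0)
  define \<epsilon> where "\<epsilon> i x = representation bas x (e i)" for i x
  have in_span: "x \<in> span bas" for x using span_Basis by simp
  have eb: "e i \<in> bas" if "i < m" for i using e that by (auto simp: bij_betw_def)
  have "frame scl m e \<epsilon>"
    unfolding frame_def
  proof (intro conjI allI impI)
    show "vector_space scl" by (rule vector_space_axioms)
    fix i assume i: "i < m"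
    show "\<epsilon> i \<in> dual_space scl"
      unfolding dual_space_iff[OF vector_space_axioms] \<epsilon>_def
      using representation_add[OF independent_Basis in_span in_span]
        representation_scale[OF independent_Basis in_span] by simp
    fix j assume j: "j < m"
    have "e i = e j \<longleftrightarrow> i = j" using e i j by (auto simp: bij_betw_def inj_on_def)
    then show "\<epsilon> i (e j) = (if i = j then 1 else 0)"
      using representation_basis[OF independent_Basis eb[OF j]] by (auto simp: \<epsilon>_def)
  next
    fix x
    have "x = (\<Sum>b\<in>bas. scl (representation bas x b) b)"
      using sum_representation_eq[OF independent_Basis in_span finite_Basis subset_refl] by simp
    also have "\<dots> = (\<Sum>i<m. scl (\<epsilon> i x) (e i))"
      unfolding \<epsilon>_def by (rule sum.reindex_bij_betw[OF e, symmetric])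
    finally show "x = (\<Sum>i<m. scl (\<epsilon> i x) (e i))" .
  qed
  moreover have "trace_on scl bas f = (\<Sum>i<m. \<epsilon> i (f (e i)))" for f
    unfolding trace_on_def \<epsilon>_def by (rule sum.reindex_bij_betw[OF e, symmetric])
  ultimately show thesis by (rule that)
qed

text \<open>
  The kernels of \<open>y\<close> and \<open>dy\<close> meet only in zero. In odd dimension this is the contact condition.
\<close>

definition contact_functional :: "('a \<Rightarrow> 'a \<Rightarrow> 'a) \<Rightarrow> ('a::ab_group_add \<Rightarrow> 'k::field) \<Rightarrow> bool"
  where "contact_functional bracket y \<longleftrightarrow> (\<forall>u. (\<forall>w. y (bracket u w) = 0) \<longrightarrow> y u = 0 \<longrightarrow> u = 0)"

context lie_algebra
begin

lemma d_one_bilinear: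
  assumes "y \<in> dual_space scl" and h: "\<And>a b. h (a + b) = h a + h b" "\<And>a b. h (a * b) = h a * h b"
  shows "bilinear_alternating scl h (\<lambda>a b. h (d_one bracket y a b))"
proof -
  have h0: "h 0 = 0" using h(1)[of 0 0] by simp
  have hm: "h (- a) = - h a" for a using h(1)[of "- a" a] h0 by (simp add: eq_neg_iff_add_eq_0)
  have "h (a - b) = h a - h b" for a b using h(1)[of a "- b"] hm by simp
  with hm show ?thesis
    unfolding bilinear_alternating_def d_one_def
    by (simp add: bracket_add bracket_scale bracket_same dual_spaceD[OF assms(1)] h h0)
qed

lemma relation_among_many_vectors:
  assumes fr: "frame scl m e \<epsilon>" and N: "m < N"
  obtains l where "\<exists>i<N. l i \<noteq> 0" "(\<Sum>i<N. scl (l i) (g i)) = 0"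
proof -
  obtain l where l: "\<exists>i<N. l i \<noteq> 0" "\<And>j. j < m \<Longrightarrow> (\<Sum>i<N. \<epsilon> j (g i) * l i) = 0"
    by (rule underdetermined_system[OF N, of "\<lambda>j i. \<epsilon> j (g i)"]) (rule that)
  have "(\<Sum>i<N. scl (l i) (g i)) = 0"
  proof (rule frame_vector_eqI[OF fr])
    fix j assume j: "j < m"
    have "\<epsilon> j \<in> dual_space scl" using fr j by (simp add: frame_def)
    then show "\<epsilon> j (\<Sum>i<N. scl (l i) (g i)) = \<epsilon> j 0"
      using l(2)[OF j] by (simp add: dual_spaceD mult.commute)
  qed
  with l(1) show thesis by (rule that)
qed

end

text \<open>
  The vectors at which the top form does not vanish span the space, and a vector in both kernels is
  in its radical.
\<close>

lemma contact_form_functional: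
  fixes scl :: "'k::field_char_0 \<Rightarrow> 'a::ab_group_add \<Rightarrow> 'a"
  assumes L: "lie_algebra scl bas bracket" and fr: "frame scl m e \<epsilon>" and dim: "vector_space.dim scl UNIV = m"
    and \<rho>: "contact_form scl bracket \<rho>"
  shows "contact_functional bracket \<rho>"
  unfolding contact_functional_def
proof (intro allI impI)
  interpret lie_algebra scl bas bracket by (rule L)
  fix u assume u: "\<forall>w. \<rho> (bracket u w) = 0" "\<rho> u = 0"
  have \<rho>d: "\<rho> \<in> dual_space scl" using \<rho> by (simp add: contact_form_def)
  obtain n v where n: "n \<ge> 1" "m = 2 * n - 1"
    and nz: "wedge 1 (2 * (n - 1)) (\<lambda>v. \<rho> (v 0)) (two_form_power (d_one bracket \<rho>) (n - 1)) v \<noteq> 0"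
    using \<rho> dim unfolding contact_form_def by auto
  define k where "k = n - 1"
  have m: "1 + 2 * k = m" using n by (simp add: k_def)
  let ?\<theta> = "wedge 1 (2 * k) (\<lambda>v. \<rho> (v 0)) (two_form_power (d_one bracket \<rho>) k)"
  have ba: "bilinear_alternating scl (\<lambda>c. c) (d_one bracket \<rho>)"
    by (rule d_one_bilinear[OF \<rho>d, of "\<lambda>c. c"]) auto
  have one: "multilinear_form scl (\<lambda>c. c) 1 (\<lambda>v. \<rho> (v 0))"
    by (auto simp: multilinear_form_def dual_spaceD[OF \<rho>d])
  have ml: "multilinear_form scl (\<lambda>c. c) (1 + 2 * k) ?\<theta>"
    by (rule multilinear_form_wedge[OF one multilinear_two_form_power[OF ba]])
  have alt: "alternating_form (1 + 2 * k) ?\<theta>" by (rule alternating_form_wedge)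
  obtain l where l: "\<exists>i<Suc m. l i \<noteq> 0" "(\<Sum>i<Suc m. scl (l i) (if i < m then v i else u)) = 0"
    by (rule relation_among_many_vectors[OF fr lessI, of "\<lambda>i. if i < m then v i else u"]) (rule that)
  have rel: "(\<Sum>i<1 + 2 * k. scl (l i) (v i)) + scl (l m) u = 0"
    using l(2) unfolding m by simp
  have r0: "\<rho> (bracket (- scl (l m) u) w) = 0" "\<rho> (bracket w (- scl (l m) u)) = 0" "\<rho> (- scl (l m) u) = 0" for w
    using u bracket_swap[of w u] by (simp_all add: bracket_minus bracket_scale dual_spaceD[OF \<rho>d])
  have rad: "?\<theta> w = 0" if j: "j < 1 + 2 * k" "w j = - scl (l m) u" for w j
  proof (rule wedge_radical[where r = "- scl (l m) u"])
    show "\<rho> (v 0) = 0" if "j < 1" "v j = - scl (l m) u" for v and j :: nat using that r0(3) by simp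
    show "two_form_power (d_one bracket \<rho>) k v = 0" if "j < 2 * k" "v j = - scl (l m) u" for v and j :: nat
      by (rule two_form_power_radical[where r = "- scl (l m) u"]) (use that r0 in \<open>simp_all add: d_one_def\<close>)
  qed (use j in auto)
  have "l i = 0" if "i < m" for i
    using independent_of_nonzero_value[where h = "\<lambda>c. c" and c = l and j = i, OF ml alt rel rad nz[folded k_def]]
      that unfolding m by simp
  then have "l m \<noteq> 0" and "scl (l m) u = 0"
    using l less_Suc_eq by auto
  then show "u = 0" by simp
qed

definition contact_matrix ::
  "('a \<Rightarrow> 'a \<Rightarrow> 'a) \<Rightarrow> (nat \<Rightarrow> 'a) \<Rightarrow> ('a \<Rightarrow> 'k::field) \<Rightarrow> nat \<Rightarrow> nat \<Rightarrow> 'k"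
  where "contact_matrix bracket e y i j = y (bracket (e i) (e j)) + y (e i) * y (e j)"

text \<open>
  In odd dimension \<open>dy\<close> always has a kernel vector, on which a contact functional does not vanish.
\<close>

lemma contact_functional_iff:
  fixes scl :: "'k::field_char_0 \<Rightarrow> 'a::ab_group_add \<Rightarrow> 'a"
  assumes L: "lie_algebra scl bas bracket" and fr: "frame scl m e \<epsilon>" and odd: "odd m" and y: "y \<in> dual_space scl"
  shows "contact_functional bracket y \<longleftrightarrow> nonsingular m (contact_matrix bracket e y)"
proof -
  interpret lie_algebra scl bas bracket by (rule L)
  note yD = dual_spaceD[OF y]
  let ?W = "\<lambda>i j. y (bracket (e i) (e j))"
  have sk: "skew_matrix m ?W" unfolding skew_matrix_def using bracket_swap yD(4) by metis
  have vec: "(\<Sum>j<m. y (e j) * a j) = y (\<Sum>j<m. scl (a j) (e j))" for a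
    by (simp add: yD(2,6) mult.commute)
  have row: "(\<Sum>j<m. ?W i j * a j) = y (bracket (e i) (\<Sum>j<m. scl (a j) (e j)))" for i a
    by (simp add: bracket_sum bracket_scale yD(2,6) mult.commute)
  have ker: "kernel_vec m ?W a \<longleftrightarrow> (\<forall>w. y (bracket (\<Sum>j<m. scl (a j) (e j)) w) = 0)" for a
  proof
    let ?v = "\<Sum>j<m. scl (a j) (e j)"
    assume k: "kernel_vec m ?W a"
    have vanish: "y (bracket ?v (e i)) = 0" if "i < m" for i
      using k that bracket_swap[of ?v "e i"] by (simp add: kernel_vec_def row yD(4))
    show "\<forall>w. y (bracket ?v w) = 0"
    proof
      fix w
      have "y (bracket ?v w) = (\<Sum>i<m. \<epsilon> i w * y (bracket ?v (e i)))"
        by (rule frame_functional[OF fr functional_bracket_dual(1)[OF y]])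
      also have "\<dots> = 0" using vanish by (intro sum.neutral) auto
      finally show "y (bracket ?v w) = 0" .
    qed
  next
    assume "\<forall>w. y (bracket (\<Sum>j<m. scl (a j) (e j)) w) = 0"
    then show "kernel_vec m ?W a"
      unfolding kernel_vec_def row using bracket_swap yD(3,4) by metis
  qed
  have coord: "(\<Sum>j<m. scl (\<epsilon> j u) (e j)) = u" for u using fr unfolding frame_def by metis
  have zero: "(\<Sum>j<m. scl (a j) (e j)) = 0 \<Longrightarrow> i < m \<Longrightarrow> a i = 0" for a i
    using frame_coordinates_of_combination[OF fr, of i a] dual_spaceD(3)[of "\<epsilon> i" scl] fr by (simp add: frame_def)
  show ?thesis
  proof
    assume con: "contact_functional bracket y"
    obtain c where c: "kernel_vec m ?W c" "\<exists>j<m. c j \<noteq> 0" by (rule odd_skew_singular[OF sk odd]) (rule that)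
    have triv: "\<forall>j<m. a j = 0" if "kernel_vec m ?W a" "(\<Sum>i<m. y (e i) * a i) = 0" for a
      using con that zero unfolding contact_functional_def ker vec by blast
    have "(\<Sum>i<m. y (e i) * c i) \<noteq> 0" using triv[OF c(1)] c(2) by blast
    from contact_matrix_nonsingular[OF sk triv c(1) this]
    show "nonsingular m (contact_matrix bracket e y)" unfolding contact_matrix_def .
  next
    assume ns: "nonsingular m (contact_matrix bracket e y)"
    show "contact_functional bracket y"
      unfolding contact_functional_def
    proof (intro allI impI)
      fix u assume u: "\<forall>w. y (bracket u w) = 0" "y u = 0"
      have kv: "kernel_vec m ?W (\<lambda>j. \<epsilon> j u)" unfolding ker coord by (rule u(1))
      have "kernel_vec m (contact_matrix bracket e y) (\<lambda>j. \<epsilon> j u)"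
        unfolding kernel_vec_def contact_matrix_def
      proof (intro allI impI)
        fix i assume "i < m"
        have "(\<Sum>j<m. (y (bracket (e i) (e j)) + y (e i) * y (e j)) * \<epsilon> j u)
          = (\<Sum>j<m. y (bracket (e i) (e j)) * \<epsilon> j u) + y (e i) * (\<Sum>j<m. y (e j) * \<epsilon> j u)"
          by (simp add: distrib_right sum.distrib sum_distrib_left mult.assoc)
        then show "(\<Sum>j<m. (y (bracket (e i) (e j)) + y (e i) * y (e j)) * \<epsilon> j u) = 0"
          using kv \<open>i < m\<close> u(2) unfolding vec coord kernel_vec_def by simp
      qed
      then have "\<epsilon> i u = 0" if "i < m" for i using ns that unfolding nonsingular_def by blast
      then have "(\<Sum>j<m. scl (\<epsilon> j u) (e j)) = 0" by (intro sum.neutral) auto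
      then show "u = 0" unfolding coord .
    qed
  qed
qed

lemma contact_pencil_finite:
  fixes scl :: "'k::field_char_0 \<Rightarrow> 'a::ab_group_add \<Rightarrow> 'a"
  assumes L: "lie_algebra scl bas bracket" and fr: "frame scl m e \<epsilon>" and odd: "odd m"
    and y: "y \<in> dual_space scl" "y' \<in> dual_space scl" and con: "contact_functional bracket y"
  shows "finite {z. \<not> contact_functional bracket (\<lambda>v. y v + z * y' v)}"
proof -
  interpret lie_algebra scl bas bracket by (rule L)
  have d: "(\<lambda>v. y v + z * y' v) \<in> dual_space scl" for z
    by (simp add: dual_space_iff[OF vector_space_axioms] dual_spaceD[OF y(1)] dual_spaceD[OF y(2)] algebra_simps)
  let ?M = "\<lambda>i j. [:y (bracket (e i) (e j)), y' (bracket (e i) (e j)):] + [:y (e i), y' (e i):] * [:y (e j), y' (e j):]"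
  have M: "poly (?M i j) z = contact_matrix bracket e (\<lambda>v. y v + z * y' v) i j" for i j z
    by (simp add: contact_matrix_def algebra_simps)
  have "nonsingular m (\<lambda>i j. poly (?M i j) 0)"
    unfolding M using con contact_functional_iff[OF L fr odd d, of 0] by simp
  from singular_parameters_finite[OF this]
  show ?thesis unfolding M contact_functional_iff[OF L fr odd d] .
qed

lemma alternating_form_vanishes_on_family:
  fixes v :: "nat \<Rightarrow> 'v"
  assumes alt: "alternating_form k \<theta>" and loc: "\<And>w w'. (\<And>i. i < k \<Longrightarrow> w i = w' i) \<Longrightarrow> \<theta> w = \<theta> w'"
    and v: "\<theta> v = 0" and w: "\<And>i. i < k \<Longrightarrow> w i \<in> v ` {..<k}"
  shows "\<theta> w = 0"
proof -
  have "\<exists>s. i < k \<longrightarrow> s < k \<and> w i = v s" for i using w[of i] by auto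
  then obtain s where s: "\<And>i. i < k \<Longrightarrow> s i < k" "\<And>i. i < k \<Longrightarrow> w i = v (s i)" by metis
  show ?thesis
  proof (cases "inj_on s {..<k}")
    case True
    define \<sigma> where "\<sigma> i = (if i < k then s i else i)" for i
    have "inj_on \<sigma> {..<k}" using True by (auto simp: inj_on_def \<sigma>_def)
    moreover have "\<sigma> ` {..<k} \<subseteq> {..<k}" using s(1) by (auto simp: \<sigma>_def)
    ultimately have "bij_betw \<sigma> {..<k} {..<k}"
      by (simp add: bij_betw_def endo_inj_surj)
    then have "\<sigma> permutes {..<k}" by (rule bij_imp_permutes) (simp add: \<sigma>_def)
    then have "\<theta> (\<lambda>i. v (\<sigma> i)) = of_int (sign \<sigma>) * \<theta> v"
      using alt unfolding alternating_form_def by blast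
    moreover have "\<theta> w = \<theta> (\<lambda>i. v (\<sigma> i))" by (rule loc) (simp add: s(2) \<sigma>_def)
    ultimately show ?thesis using v by simp
  next
    case False
    then obtain i j where "i < k" "j < k" "i \<noteq> j" "s i = s j" by (auto simp: inj_on_def)
    then show ?thesis using alternating_form_repeated[OF alt, of i j w] s(2) by simp
  qed
qed

text \<open>
  Take \<open>v\<close> with a nonzero value of the top power of \<open>dy'\<close>. At \<open>v\<close> the top power of \<open>dy + z dy'\<close> is a
  polynomial of positive degree in \<open>z\<close>, so it vanishes for some complex \<open>z\<close>. If all forms of the pencil
  had the radical vector \<open>R\<close>, then \<open>v\<close> and \<open>R\<close> would span the space and this top power would vanish
  identically.
\<close>

lemma no_common_kernel_vector:
  fixes scl :: "'k::real_or_complex \<Rightarrow> 'a::ab_group_add \<Rightarrow> 'a"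
  assumes L: "lie_algebra scl bas bracket" and fr: "frame scl (2 * k + 1) e \<epsilon>" and k: "k \<ge> 1"
    and y: "y \<in> dual_space scl" "y' \<in> dual_space scl"
    and gen: "\<And>s t :: complex. (s, t) \<noteq> (0, 0) \<Longrightarrow>
      \<exists>v. two_form_power (\<lambda>a b. s * to_complex (d_one bracket y a b) + t * to_complex (d_one bracket y' a b)) k v \<noteq> 0"
    and R: "\<And>w. y (bracket R w) = 0" "\<And>w. y' (bracket R w) = 0"
  shows "R = 0"
proof (rule ccontr)
  assume R0: "R \<noteq> 0"
  interpret lie_algebra scl bas bracket by (rule L)
  let ?h = "to_complex :: 'k \<Rightarrow> complex"
  let ?w = "\<lambda>a b. ?h (d_one bracket y a b)" and ?w' = "\<lambda>a b. ?h (d_one bracket y' a b)"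
  have ba: "bilinear_alternating scl ?h ?w" "bilinear_alternating scl ?h ?w'"
    by (rule d_one_bilinear; simp add: y to_complex_add to_complex_mult)+
  have baz: "bilinear_alternating scl ?h (\<lambda>a b. ?w a b + z * ?w' a b)" for z
    using ba unfolding bilinear_alternating_def by (simp add: algebra_simps)
  have radz: "?w R x + z * ?w' R x = 0" "?w x R + z * ?w' x R = 0" for x z
    using R bracket_swap[of x R]
    by (simp_all add: d_one_def to_complex_zero dual_spaceD[OF y(1)] dual_spaceD[OF y(2)])
  have rad': "?w' (- scl c R) x = 0" "?w' x (- scl c R) = 0" for c x
    using R bracket_swap[of x R]
    by (simp_all add: d_one_def to_complex_zero bracket_scale bracket_minus dual_spaceD[OF y(2)])
  obtain v where v: "two_form_power ?w' k v \<noteq> 0" using gen[of 0 1] by auto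
  obtain P where P: "degree P \<le> k" "coeff P k = two_form_power ?w' k v"
    "\<And>z. poly P z = two_form_power (\<lambda>a b. ?w a b + z * ?w' a b) k v"
    using two_form_power_pencil[of k ?w' v ?w] by blast
  have "degree P = k" using P(1,2) v le_degree[of P k] by simp
  then have "\<not> constant (poly P)" using k by (simp add: constant_degree)
  then obtain z where z: "poly P z = 0" using fundamental_theorem_of_algebra by blast
  let ?\<theta> = "two_form_power (\<lambda>a b. ?w a b + z * ?w' a b) k"
  have ml: "multilinear_form scl ?h (2 * k) ?\<theta>" by (rule multilinear_two_form_power[OF baz])
  have span: "u \<in> span (insert R (v ` {..<2 * k}))" for u
  proof -
    obtain l where l: "\<exists>i<2 * k + 2. l i \<noteq> 0"
      "(\<Sum>i<2 * k + 2. scl (l i) (if i < 2 * k then v i else if i = 2 * k then R else u)) = 0"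
      by (rule relation_among_many_vectors[OF fr, of "2 * k + 2" "\<lambda>i. if i < 2 * k then v i else if i = 2 * k then R else u"])
        (simp, rule that)
    have rel: "(\<Sum>i<2 * k. scl (l i) (v i)) + scl (l (2 * k)) R + scl (l (Suc (2 * k))) u = 0"
      using l(2) by simp
    have "l (Suc (2 * k)) \<noteq> 0"
    proof
      assume n0: "l (Suc (2 * k)) = 0"
      then have rel': "(\<Sum>i<2 * k. scl (l i) (v i)) + scl (l (2 * k)) R = 0" using rel by simp
      have li: "l i = 0" if i: "i < 2 * k" for i
      proof -
        have "?h (l i) = 0"
        proof (rule independent_of_nonzero_value[OF multilinear_two_form_power[OF ba(2)] alternating_two_form_power rel' _ v i])
          fix w j assume "j < 2 * k" "w j = - scl (l (2 * k)) R"
          then show "two_form_power ?w' k w = 0"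
            by (intro two_form_power_radical[where r = "- scl (l (2 * k)) R" and j = j]) (use rad' in auto)
        qed
        then show ?thesis using to_complex_inject[of "l i" 0] by (simp add: to_complex_zero)
      qed
      then have "scl (l (2 * k)) R = 0" using rel' by simp
      then have "l (2 * k) = 0" using R0 by simp
      moreover obtain i where "i < 2 * k + 2" "l i \<noteq> 0" using l(1) by blast
      ultimately show False using li n0 by (metis add_2_eq_Suc' less_SucE)
    qed
    then have "u = scl (1 / l (Suc (2 * k))) (scl (l (Suc (2 * k))) u)" by simp
    also have "scl (l (Suc (2 * k))) u = - ((\<Sum>i<2 * k. scl (l i) (v i)) + scl (l (2 * k)) R)"
      using rel by (metis add.commute eq_neg_iff_add_eq_0)
    also have "scl (1 / l (Suc (2 * k))) \<dots> \<in> span (insert R (v ` {..<2 * k}))"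
      by (intro span_scale span_neg span_add span_sum span_base) auto
    finally show ?thesis .
  qed
  obtain v' where v': "?\<theta> v' \<noteq> 0" using gen[of 1 z] by auto
  have "?\<theta> v' = 0"
  proof (rule multilinear_form_vanishes_on_span[OF vector_space_axioms ml _ span])
    fix w assume w: "\<And>i. i < 2 * k \<Longrightarrow> w i \<in> insert R (v ` {..<2 * k})"
    show "?\<theta> w = 0"
    proof (cases "\<exists>i<2 * k. w i = R")
      case True
      then obtain i where "i < 2 * k" "w i = R" by blast
      then show ?thesis by (intro two_form_power_radical[where r = R and j = i]) (use radz in auto)
    next
      case False
      show ?thesis
        by (rule alternating_form_vanishes_on_family[OF alternating_two_form_power multilinear_formD(1)[OF ml], of v])
          (use w False z P(3) in auto)
    qed
  qed
  with v' show False by simp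
qed

text \<open>
  The admissible triples \<open>(\<delta>, s, t)\<close>, for which the pencil of \<open>\<alpha> + \<delta> \<rho>\<close> and \<open>\<beta>\<close> has a nonzero power, form an
  open set that contains \<open>{0}\<close> times the unit sphere, hence a tube around it. Inside the tube \<open>\<delta> = 1 / j\<close>
  is chosen such that \<open>\<rho> + j \<alpha>\<close> is a contact functional, which fails for finitely many \<open>j\<close> only.
\<close>

lemma contact_perturbation:
  fixes scl :: "'k::real_or_complex \<Rightarrow> 'a::ab_group_add \<Rightarrow> 'a"
  assumes L: "lie_algebra scl bas bracket" and fr: "frame scl m e \<epsilon>" and odd: "odd m"
    and \<rho>: "\<rho> \<in> dual_space scl" "contact_functional bracket \<rho>"
    and y: "\<alpha> \<in> dual_space scl" "\<beta> \<in> dual_space scl"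
    and gen: "\<And>s t :: complex. (s, t) \<noteq> (0, 0) \<Longrightarrow>
      \<exists>v. two_form_power (\<lambda>a b. s * to_complex (d_one bracket \<alpha> a b) + t * to_complex (d_one bracket \<beta> a b)) k v \<noteq> 0"
  obtains p where "p \<in> dual_space scl" "contact_functional bracket p"
    "\<And>s t :: complex. (s, t) \<noteq> (0, 0) \<Longrightarrow>
      \<exists>v. two_form_power (\<lambda>a b. s * to_complex (d_one bracket p a b) + t * to_complex (d_one bracket \<beta> a b)) k v \<noteq> 0"
proof -
  interpret lie_algebra scl bas bracket by (rule L)
  define w where "w = (\<lambda>(\<delta> :: real, s :: complex, t :: complex) a b.
    s * (to_complex (d_one bracket \<alpha> a b) + of_real \<delta> * to_complex (d_one bracket \<rho> a b)) + t * to_complex (d_one bracket \<beta> a b))"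
  define O' where "O' = (\<Union>v. (\<lambda>x. two_form_power (w x) k v) -` (- {0}))"
  have "continuous_on UNIV (\<lambda>x. w x a b)" for a b
    unfolding w_def case_prod_unfold by (intro continuous_intros)
  then have "continuous_on UNIV (\<lambda>x. two_form_power (w x) k v)" for v
    by (rule continuous_on_two_form_power)
  then have "open O'" unfolding O'_def by (intro open_UN ballI open_vimage) auto
  moreover have "{0} \<times> sphere 0 1 \<subseteq> O'"
  proof
    fix x assume "x \<in> {0 :: real} \<times> sphere (0 :: complex \<times> complex) 1"
    then have x0: "fst x = 0" and sn: "snd x \<in> sphere 0 1" by (simp_all add: mem_Times_iff)
    obtain s t where st: "snd x = (s, t)" by (cases "snd x")
    have "norm (s, t) = 1" using sn unfolding st by (simp only: mem_sphere_0)
    then have "(s, t) \<noteq> 0" by (metis norm_zero zero_neq_one)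
    then have x: "x = (0, s, t)" "(s, t) \<noteq> (0, 0)" using x0 st by (simp_all add: prod_eq_iff zero_prod_def)
    obtain v where "two_form_power (\<lambda>a b. s * to_complex (d_one bracket \<alpha> a b) + t * to_complex (d_one bracket \<beta> a b)) k v \<noteq> 0"
      using gen[OF x(2)] by blast
    then show "x \<in> O'" unfolding O'_def x(1) w_def by auto
  qed
  moreover have "compact (sphere (0 :: complex \<times> complex) 1)" by simp
  ultimately have "\<exists>X. 0 \<in> X \<and> open X \<and> X \<times> sphere 0 1 \<subseteq> O'"
    by (intro Elementary_Topology.tube_lemma)
  then obtain X where X: "0 \<in> X" "open X" "X \<times> sphere 0 1 \<subseteq> O'" by blast
  obtain r where r: "r > 0" "ball 0 r \<subseteq> X" using X(1,2) by (auto simp: open_contains_ball)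
  obtain N :: nat where N: "N > 0" "1 / real N < r" using r(1) by (metis nat_approx_posE of_nat_Suc zero_less_Suc)
  have fin: "finite {z. \<not> contact_functional bracket (\<lambda>v. \<rho> v + z * \<alpha> v)}"
    by (rule contact_pencil_finite[OF L fr odd \<rho>(1) y(1) \<rho>(2)])
  have "finite {j :: nat. \<not> contact_functional bracket (\<lambda>v. \<rho> v + of_nat j * \<alpha> v)}"
    using finite_vimageI[OF fin, of "of_nat :: nat \<Rightarrow> 'k"] by (simp add: inj_on_def vimage_def)
  then have "infinite ({N..} - {j. \<not> contact_functional bracket (\<lambda>v. \<rho> v + of_nat j * \<alpha> v)})"
    by (simp add: infinite_Ici)
  then obtain j where j: "j \<ge> N" "contact_functional bracket (\<lambda>v. \<rho> v + of_nat j * \<alpha> v)"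
    by (metis (no_types, lifting) DiffE atLeast_iff finite.emptyI mem_Collect_eq ex_in_conv)
  have j0: "real j > 0" using j(1) N(1) by simp
  define \<delta> where "\<delta> = 1 / real j"
  have "\<delta> \<le> 1 / real N" unfolding \<delta>_def using j(1) N(1) by (intro divide_left_mono) auto
  then have \<delta>X: "\<delta> \<in> X" using N(2) r(2) j0 by (auto simp: \<delta>_def)
  define p where "p = (\<lambda>v. \<alpha> v + of_real \<delta> * \<rho> v)"
  have pd: "p \<in> dual_space scl"
    unfolding p_def by (simp add: dual_space_iff[OF vector_space_axioms] dual_spaceD[OF \<rho>(1)] dual_spaceD[OF y(1)] algebra_simps)
  have pj: "of_nat j * p v = \<rho> v + of_nat j * \<alpha> v" for v
    using j0 by (simp add: p_def \<delta>_def distrib_left)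
  have con: "contact_functional bracket p"
    unfolding contact_functional_def
  proof (intro allI impI)
    fix u assume "\<forall>w. p (bracket u w) = 0" "p u = 0"
    then have "\<forall>w. \<rho> (bracket u w) + of_nat j * \<alpha> (bracket u w) = 0" "\<rho> u + of_nat j * \<alpha> u = 0"
      unfolding pj[symmetric] by auto
    then show "u = 0" using j(2) unfolding contact_functional_def by blast
  qed
  have tcr: "to_complex (of_real \<delta> * a) = of_real \<delta> * to_complex a" for a :: 'k
    using to_complex_scaleR[of \<delta> a] by (simp add: scaleR_conv_of_real)
  have dp: "to_complex (d_one bracket p a b) = to_complex (d_one bracket \<alpha> a b) + of_real \<delta> * to_complex (d_one bracket \<rho> a b)" for a b
    unfolding tcr[symmetric] to_complex_add[symmetric] by (simp add: d_one_def p_def algebra_simps)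
  show thesis
  proof (rule that[OF pd con])
    fix s t :: complex assume st: "(s, t) \<noteq> (0, 0)"
    define n where "n = norm (s, t)"
    have n: "n > 0" using st by (simp add: n_def zero_prod_def[symmetric])
    have eq: "(s / of_real n, t / of_real n) = (1 / n) *\<^sub>R (s, t)"
      by (simp add: scaleR_conv_of_real field_simps)
    have "norm (s / of_real n, t / of_real n) = 1"
      unfolding eq norm_scaleR using n by (simp only: n_def[symmetric]) simp
    then have "(s / of_real n, t / of_real n) \<in> sphere 0 1" by (simp only: mem_sphere_0)
    then have "(\<delta>, s / of_real n, t / of_real n) \<in> O'"
      using X(3) \<delta>X by blast
    then obtain v where v: "two_form_power (w (\<delta>, s / of_real n, t / of_real n)) k v \<noteq> 0" by (auto simp: O'_def)
    have "(\<lambda>a b. s * to_complex (d_one bracket p a b) + t * to_complex (d_one bracket \<beta> a b))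
        = (\<lambda>a b. of_real n * w (\<delta>, s / of_real n, t / of_real n) a b)"
      using n by (simp add: w_def dp fun_eq_iff distrib_left)
    then show "\<exists>v. two_form_power (\<lambda>a b. s * to_complex (d_one bracket p a b) + t * to_complex (d_one bracket \<beta> a b)) k v \<noteq> 0"
      using v n by (intro exI[of _ v]) (simp add: two_form_power_scale)
  qed
qed

section \<open>Genericity on the dual of the secondary algebra\<close>

lemma structure_constants_complex:
  fixes scl :: "'k::real_or_complex \<Rightarrow> 'a::ab_group_add \<Rightarrow> 'a"
  assumes L: "lie_algebra scl bas bracket" and fr: "frame scl m e \<epsilon>"
    and unimod: "\<And>a. (\<Sum>i<m. \<epsilon> i (bracket a (e i))) = 0"
  shows "structure_constants m (\<lambda>i j k. if k < m then to_complex (\<epsilon> k (bracket (e i) (e j))) else 0)"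
proof -
  interpret lie_algebra scl bas bracket by (rule L)
  have \<epsilon>: "\<epsilon> i \<in> dual_space scl" if "i < m" for i using fr that by (simp add: frame_def)
  have tc_sum: "to_complex (\<Sum>i\<in>I. g i) = (\<Sum>i\<in>I. to_complex (g i))" for g :: "nat \<Rightarrow> 'k" and I
    by (induction I rule: infinite_finite_induct) (simp_all add: to_complex_zero to_complex_add)
  have expand: "(\<Sum>i<m. \<epsilon> i v * w (e i)) = w v" if "w \<in> dual_space scl" for w v
    using frame_functional[OF fr that, of v] by simp
  show ?thesis
  proof
    fix i j k assume ij: "i < m" "j < m"
    show "(if k < m then to_complex (\<epsilon> k (bracket (e i) (e j))) else 0)
        = - (if k < m then to_complex (\<epsilon> k (bracket (e j) (e i))) else 0)"
    proof (cases "k < m")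
      case True
      have "\<epsilon> k (bracket (e i) (e j)) = 0 - \<epsilon> k (bracket (e j) (e i))"
        using bracket_swap[of "e i" "e j"] dual_spaceD(4)[OF \<epsilon>[OF True]] by simp
      then have "to_complex (\<epsilon> k (bracket (e i) (e j))) = 0 - to_complex (\<epsilon> k (bracket (e j) (e i)))"
        by (simp only: to_complex_diff to_complex_zero)
      with True show ?thesis by simp
    qed simp
  next
    fix i j k n assume *: "i < m" "j < m" "k < m" "n < m"
    note d = functional_bracket_dual(1)[OF \<epsilon>[OF *(4)]]
    have "(\<Sum>l<m. \<epsilon> l (bracket (e j) (e k)) * \<epsilon> n (bracket (e i) (e l)) + \<epsilon> l (bracket (e k) (e i)) * \<epsilon> n (bracket (e j) (e l))
        + \<epsilon> l (bracket (e i) (e j)) * \<epsilon> n (bracket (e k) (e l))) = \<epsilon> n (bracket (e i) (bracket (e j) (e k))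
        + bracket (e j) (bracket (e k) (e i)) + bracket (e k) (bracket (e i) (e j)))"
      unfolding sum.distrib expand[OF d] by (simp add: dual_spaceD(1)[OF \<epsilon>[OF *(4)]])
    also have "\<dots> = 0" unfolding jacobi by (rule dual_spaceD(3)[OF \<epsilon>[OF *(4)]])
    finally have "to_complex (\<Sum>l<m. \<epsilon> l (bracket (e j) (e k)) * \<epsilon> n (bracket (e i) (e l)) + \<epsilon> l (bracket (e k) (e i)) * \<epsilon> n (bracket (e j) (e l))
        + \<epsilon> l (bracket (e i) (e j)) * \<epsilon> n (bracket (e k) (e l))) = 0" by (simp only: to_complex_zero)
    then have "(\<Sum>l<m. to_complex (\<epsilon> l (bracket (e j) (e k))) * to_complex (\<epsilon> n (bracket (e i) (e l)))
        + to_complex (\<epsilon> l (bracket (e k) (e i))) * to_complex (\<epsilon> n (bracket (e j) (e l)))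
        + to_complex (\<epsilon> l (bracket (e i) (e j))) * to_complex (\<epsilon> n (bracket (e k) (e l)))) = 0"
      by (simp only: tc_sum to_complex_add to_complex_mult)
    then show "(\<Sum>l<m. (if l < m then to_complex (\<epsilon> l (bracket (e j) (e k))) else 0) * (if n < m then to_complex (\<epsilon> n (bracket (e i) (e l))) else 0)
        + (if l < m then to_complex (\<epsilon> l (bracket (e k) (e i))) else 0) * (if n < m then to_complex (\<epsilon> n (bracket (e j) (e l))) else 0)
        + (if l < m then to_complex (\<epsilon> l (bracket (e i) (e j))) else 0) * (if n < m then to_complex (\<epsilon> n (bracket (e k) (e l))) else 0)) = 0"
      using *(4) by simp
  next
    fix i assume "i < m"
    have "(\<Sum>j<m. to_complex (\<epsilon> j (bracket (e i) (e j)))) = 0"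
      unfolding tc_sum[symmetric] unimod by (rule to_complex_zero)
    then show "(\<Sum>j<m. if j < m then to_complex (\<epsilon> j (bracket (e i) (e j))) else 0) = 0" by simp
  qed
qed

text \<open>
  Each hyperplane contains only finitely many points of the moment curve \<open>(1, z, z\<^sup>2, \<dots>)\<close>, because a
  nonzero polynomial has finitely many roots. Natural parameters give a functional over the ground
  field.
\<close>

lemma moment_functional:
  fixes S :: "(nat \<Rightarrow> complex) set"
  assumes "finite S" and nz: "\<And>c. c \<in> S \<Longrightarrow> \<exists>i<m. c i \<noteq> 0"
  obtains n :: nat where "\<And>c. c \<in> S \<Longrightarrow> (\<Sum>i<m. of_nat n ^ i * c i) \<noteq> 0"
proof -
  define P where "P c = (\<Sum>i<m. monom (c i) i)" for c :: "nat \<Rightarrow> complex"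
  have "P c \<noteq> 0" if c: "c \<in> S" for c
  proof -
    obtain i where i: "i < m" "c i \<noteq> 0" using nz[OF c] by blast
    have "coeff (P c) i = c i" using i(1) by (simp add: P_def coeff_sum)
    with i(2) show ?thesis by auto
  qed
  then have fin: "finite (\<Union>c\<in>S. {z. poly (P c) z = 0})" using assms(1) poly_roots_finite by blast
  have "finite ((of_nat :: nat \<Rightarrow> complex) -` (\<Union>c\<in>S. {z. poly (P c) z = 0}))"
    by (rule finite_vimageI[OF fin]) (simp add: inj_on_def)
  from ex_new_if_finite[OF infinite_UNIV_nat this]
  obtain n :: nat where n: "of_nat n \<notin> (\<Union>c\<in>S. {z. poly (P c) z = 0})" by (elim exE) (simp only: vimage_eq)
  show thesis
  proof (rule that[of n])
    fix c assume "c \<in> S"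
    then have "poly (P c) (of_nat n) \<noteq> 0" using n by blast
    then show "(\<Sum>i<m. of_nat n ^ i * c i) \<noteq> 0" by (simp add: P_def poly_sum poly_monom mult.commute)
  qed
qed

text \<open>
  The image of an inverse matrix is an inverse matrix.
\<close>

lemma nonsingular_to_complex:
  fixes M :: "nat \<Rightarrow> nat \<Rightarrow> 'k::real_or_complex"
  assumes "nonsingular m M"
  shows "nonsingular m (\<lambda>i j. to_complex (M i j))"
proof -
  have tc_sum: "to_complex (\<Sum>i\<in>I. g i) = (\<Sum>i\<in>I. to_complex (g i))" for g :: "nat \<Rightarrow> 'k" and I
    by (induction I rule: infinite_finite_induct) (simp_all add: to_complex_zero to_complex_add)
  obtain T where "\<And>i k. i < m \<Longrightarrow> k < m \<Longrightarrow> (\<Sum>j<m. M i j * T j k) = (if i = k then 1 else 0)"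
    and T: "\<And>i k. i < m \<Longrightarrow> k < m \<Longrightarrow> (\<Sum>j<m. T i j * M j k) = (if i = k then 1 else 0)"
    by (rule nonsingular_inverse[OF assms]) (rule that)
  show ?thesis
  proof (rule right_inverse_nonsingular_transpose[of m "\<lambda>i j. to_complex (T i j)"])
    fix i k assume "i < m" "k < m"
    from arg_cong[OF T[OF this], of to_complex]
    show "(\<Sum>j<m. to_complex (T i j) * to_complex (M j k)) = (if i = k then 1 else 0)"
      by (simp add: tc_sum to_complex_mult to_complex_zero to_complex_one split: if_splits)
  qed
qed

lemma two_form_power_coordinates:
  fixes scl :: "'k::real_or_complex \<Rightarrow> 'a::ab_group_add \<Rightarrow> 'a"
  assumes fr: "frame scl m e \<epsilon>" and ba: "bilinear_alternating scl to_complex \<omega>"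
  shows "two_form_power (coordinate_form m (\<lambda>i j. \<omega> (e i) (e j))) k (\<lambda>i j. to_complex (\<epsilon> j (v i))) = two_form_power \<omega> k v"
proof (rule two_form_power_gram)
  fix i j
  have l: "\<omega> (a + b) c = \<omega> a c + \<omega> b c" "\<omega> c (a + b) = \<omega> c a + \<omega> c b"
    "\<omega> (scl r a) c = to_complex r * \<omega> a c" "\<omega> c (scl r a) = to_complex r * \<omega> c a" for a b c r
    using ba unfolding bilinear_alternating_def by blast+
  have z: "\<omega> 0 c = 0" "\<omega> c 0 = 0" for c using l(1)[of 0 0 c] l(2)[of c 0 0] by simp_all
  have s: "\<omega> (\<Sum>i\<in>I. g i) c = (\<Sum>i\<in>I. \<omega> (g i) c)" "\<omega> c (\<Sum>i\<in>I. g i) = (\<Sum>i\<in>I. \<omega> c (g i))" for I :: "nat set" and g c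
    by (induction I rule: infinite_finite_induct; simp add: z l)+
  have x: "x = (\<Sum>i<m. scl (\<epsilon> i x) (e i))" for x using fr unfolding frame_def by blast
  have "\<omega> (v i) (v j) = (\<Sum>a<m. to_complex (\<epsilon> a (v i)) * \<omega> (e a) (v j))"
    by (subst x[of "v i"]) (simp only: s l)
  moreover have "\<omega> c (v j) = (\<Sum>b<m. \<omega> c (e b) * to_complex (\<epsilon> b (v j)))" for c
    by (subst x[of "v j"]) (simp only: s l mult.commute)
  ultimately show "coordinate_form m (\<lambda>i j. \<omega> (e i) (e j)) (\<lambda>j. to_complex (\<epsilon> j (v i))) (\<lambda>ja. to_complex (\<epsilon> ja (v j))) = \<omega> (v i) (v j)"
    by (simp only: coordinate_form_def)
qed

lemma kernel_line_scale:
  assumes "kernel_line d W c" "r \<noteq> 0"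
  shows "kernel_line d (\<lambda>i j. r * W i j) c"
proof -
  have "kernel_vec d (\<lambda>i j. r * W i j) u \<longleftrightarrow> kernel_vec d W u" for u
    using assms(2) by (simp add: kernel_vec_def mult.assoc sum_distrib_left[symmetric])
  then show ?thesis using assms(1) by (simp add: kernel_line_def)
qed

text \<open>
  In odd dimension the differential has a kernel vector; on it a contact functional is nonzero and
  can be normalised.
\<close>

lemma contact_functional_reeb:
  fixes scl :: "'k::field_char_0 \<Rightarrow> 'a::ab_group_add \<Rightarrow> 'a"
  assumes L: "lie_algebra scl bas bracket" and fr: "frame scl m e \<epsilon>" and odd: "odd m"
    and y: "y \<in> dual_space scl" and con: "contact_functional bracket y"
  obtains R where "\<And>w. y (bracket R w) = 0" "y R = 1"
proof -
  interpret lie_algebra scl bas bracket by (rule L)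
  note yD = dual_spaceD[OF y]
  have sk: "skew_matrix m (\<lambda>i j. y (bracket (e i) (e j)))"
    unfolding skew_matrix_def using bracket_swap yD(4) by metis
  obtain c where c: "kernel_vec m (\<lambda>i j. y (bracket (e i) (e j))) c" "\<exists>j<m. c j \<noteq> 0"
    by (rule odd_skew_singular[OF sk odd]) (rule that)
  define u where "u = (\<Sum>j<m. scl (c j) (e j))"
  have "y (bracket (e i) u) = 0" if "i < m" for i
    using c(1) that by (simp add: kernel_vec_def u_def bracket_sum bracket_scale yD(2,6) mult.commute)
  then have ue: "y (bracket u (e i)) = 0" if "i < m" for i
    using that bracket_swap[of u "e i"] by (simp add: yD(4))
  have uw: "y (bracket u w) = 0" for w
  proof -
    have "y (bracket u w) = (\<Sum>i<m. \<epsilon> i w * y (bracket u (e i)))"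
      by (rule frame_functional[OF fr functional_bracket_dual(1)[OF y]])
    also have "\<dots> = 0" using ue by (intro sum.neutral) auto
    finally show ?thesis .
  qed
  have "u \<noteq> 0"
  proof
    assume u0: "u = 0"
    obtain j where j: "j < m" "c j \<noteq> 0" using c(2) by blast
    have "\<epsilon> j \<in> dual_space scl" using fr j(1) by (simp add: frame_def)
    then have "c j = 0"
      using frame_coordinates_of_combination[OF fr j(1), of c] u0 by (simp add: u_def dual_spaceD(3))
    with j(2) show False ..
  qed
  then have yu: "y u \<noteq> 0" using con uw unfolding contact_functional_def by blast
  show thesis
    by (rule that[of "scl (1 / y u) u"]) (use uw yu in \<open>simp_all add: bracket_scale yD\<close>)
qed

text \<open>
  The matrix of the Lie--Poisson form at \<open>s p + t q\<close> in the basis of \<open>B\<close> is the one treated by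
  \<open>secondary_kernel_line\<close>, with \<open>x = t q\<^sub>0\<close> and \<open>y = s p\<^sub>1 + t q\<^sub>1\<close>.
\<close>

lemma secondary_pair_generic:
  fixes scl :: "'k::real_or_complex \<Rightarrow> 'a::ab_group_add \<Rightarrow> 'a"
  assumes L: "lie_algebra scl bas bracket" and fr: "frame scl m e \<epsilon>" and m: "m \<ge> 2"
    and dim: "vector_space.dim scl UNIV = m"
    and unimod: "\<And>a. (\<Sum>i<m. \<epsilon> i (bracket a (e i))) = 0"
    and p: "p\<^sub>1 \<in> dual_space scl" and q: "q\<^sub>0 \<in> dual_space scl" "q\<^sub>1 \<in> dual_space scl"
    and line: "\<And>s t :: complex. (s, t) \<noteq> (0, 0) \<Longrightarrow> \<exists>c.
      kernel_line m (\<lambda>i j. s * to_complex (p\<^sub>1 (bracket (e i) (e j))) + t * to_complex (q\<^sub>1 (bracket (e i) (e j)))) c \<and>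
      (dot m (\<lambda>i. s * to_complex (p\<^sub>1 (e i)) + t * to_complex (q\<^sub>1 (e i))) c \<noteq> 0
       \<or> dot m (\<lambda>i. t * to_complex (q\<^sub>0 (e i))) c \<noteq> 0)"
  shows "generic_couple (secondary_scale scl)
    (lie_poisson (secondary_bracket scl bracket) (\<lambda>(v, v', s). p\<^sub>1 v'))
    (lie_poisson (secondary_bracket scl bracket) (\<lambda>(v, v', s). q\<^sub>0 v + q\<^sub>1 v'))"
proof -
  let ?B = "secondary_bracket scl bracket" and ?S = "secondary_scale scl"
  let ?P = "\<lambda>(v :: 'a, v' :: 'a, s :: 'k). p\<^sub>1 v'" and ?Q = "\<lambda>(v :: 'a, v' :: 'a, s :: 'k). q\<^sub>0 v + q\<^sub>1 v'"
  obtain BB where LB: "lie_algebra ?S BB ?B" using lie_algebra_secondary(1)[OF L] by blast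
  interpret lie_algebra scl bas bracket by (rule L)
  interpret S: structure_constants m "\<lambda>i j k. if k < m then to_complex (\<epsilon> k (bracket (e i) (e j))) else 0"
    by (rule structure_constants_complex[OF L fr unimod])
  note p1D = dual_spaceD[OF p] and q0D = dual_spaceD[OF q(1)] and q1D = dual_spaceD[OF q(2)]
  have zero_dual: "(\<lambda>v. 0) \<in> dual_space scl" by (simp add: dual_space_iff[OF vector_space_axioms])
  have P: "?P \<in> dual_space ?S" using secondary_functional_dual[OF L zero_dual p] by simp
  have Q: "?Q \<in> dual_space ?S" by (rule secondary_functional_dual[OF L q])
  have tc_sum: "to_complex (\<Sum>i\<in>I. g i) = (\<Sum>i\<in>I. to_complex (g i))" for g :: "nat \<Rightarrow> 'k" and I
    by (induction I rule: infinite_finite_induct) (simp_all add: to_complex_zero to_complex_add)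
  have tc_minus: "to_complex (- a) = - to_complex a" for a :: 'k
    using to_complex_diff[of 0 a] by (simp add: to_complex_zero)
  have lf: "(\<Sum>k<m. to_complex (w (e k)) * (if k < m then to_complex (\<epsilon> k v) else 0)) = to_complex (w v)"
    if "w \<in> dual_space scl" for w v
    using frame_functional[OF fr that, of v] by (simp add: tc_sum to_complex_mult mult.commute)
  define F where "F = (\<lambda>j. if j < m then (e j, 0, 0) else if j < 2 * m then (0, e (j - m), 0) else (0, 0, 1 :: 'k))"
  have b0: "bracket 0 w = 0" "bracket w 0 = 0" for w
    using bracket_scale(1)[of 0 0 w] bracket_scale(2)[of w 0 0] by simp_all
  have main: "\<exists>v. two_form_power (\<lambda>a b. s * to_complex (lie_poisson ?B ?P a b) + t * to_complex (lie_poisson ?B ?Q a b)) m v \<noteq> 0"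
    if st: "(s, t) \<noteq> (0, 0)" for s t :: complex
  proof -
    define x where "x = (\<lambda>i. t * to_complex (q\<^sub>0 (e i)))"
    define y where "y = (\<lambda>i. s * to_complex (p\<^sub>1 (e i)) + t * to_complex (q\<^sub>1 (e i)))"
    have lfx: "S.lie_form x i j = t * to_complex (q\<^sub>0 (bracket (e i) (e j)))" for i j
      unfolding S.lie_form_def x_def mult.assoc sum_distrib_left[symmetric] lf[OF q(1)] by (rule refl)
    have lfy: "S.lie_form y i j = s * to_complex (p\<^sub>1 (bracket (e i) (e j))) + t * to_complex (q\<^sub>1 (bracket (e i) (e j)))" for i j
      unfolding S.lie_form_def y_def distrib_right sum.distrib mult.assoc sum_distrib_left[symmetric]
        lf[OF p] lf[OF q(2)] by (rule refl)
    have "S.lie_form y = (\<lambda>i j. s * to_complex (p\<^sub>1 (bracket (e i) (e j))) + t * to_complex (q\<^sub>1 (bracket (e i) (e j))))"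
      by (intro ext lfy)
    then have "\<exists>c. kernel_line m (S.lie_form y) c \<and> (dot m y c \<noteq> 0 \<or> dot m x c \<noteq> 0)"
      using line[OF st] by (simp only: x_def y_def)
    then obtain c where c: "kernel_line m (S.lie_form y) c" "dot m y c \<noteq> 0 \<or> dot m x c \<noteq> 0"
      by (elim exE conjE) (rule that)
    obtain k where k: "kernel_line (2 * m + 1) (S.secondary_matrix x y) k"
      by (rule S.secondary_kernel_line[OF m c]) (rule that)
    have "\<exists>\<phi>. (\<forall>i. \<phi> i < 2 * m + 1) \<and> two_form_power (S.secondary_matrix x y) m \<phi> \<noteq> 0"
      by (rule two_form_power_nonzero_of_kernel_line[OF S.skew_secondary_matrix k]) simp
    then obtain \<phi> where \<phi>0: "\<forall>i. \<phi> i < 2 * m + 1" and \<phi>2: "two_form_power (S.secondary_matrix x y) m \<phi> \<noteq> 0"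
      by (elim exE conjE) (rule that)
    note \<phi> = \<phi>0[rule_format] \<phi>2
    have entry: "s * to_complex (lie_poisson ?B ?P (F i) (F j)) + t * to_complex (lie_poisson ?B ?Q (F i) (F j))
        = S.secondary_matrix x y i j" if ij: "i < 2 * m + 1" "j < 2 * m + 1" for i j
    proof -
      have sw: "bracket (e j) v = - bracket v (e j)" for v by (rule bracket_swap)
      note simps = F_def lie_poisson_def secondary_bracket_def b0 lfx[unfolded x_def] lfy[unfolded y_def] x_def y_def to_complex_zero
        S.secondary_matrix_def p1D q0D q1D tc_minus
      consider "i < m" | "\<not> i < m" "i < 2 * m" | "i = 2 * m" using ij(1) by fastforce
      note ci = this
      consider "j < m" | "\<not> j < m" "j < 2 * m" | "j = 2 * m" using ij(2) by fastforce
      note cj = this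
      from ci show ?thesis
      proof cases
        case 1
        from cj show ?thesis by cases (use 1 in \<open>simp_all add: simps\<close>)
      next
        case 2
        from cj show ?thesis
        proof cases
          case 1
          then show ?thesis using 2 sw[of "e (i - m)"] by (simp add: simps)
        qed (use 2 in \<open>simp_all add: simps\<close>)
      next
        case 3
        from cj show ?thesis by cases (use 3 in \<open>simp_all add: simps\<close>)
      qed
    qed
    have gram: "two_form_power (\<lambda>a b. s * to_complex (lie_poisson ?B ?P a b) + t * to_complex (lie_poisson ?B ?Q a b)) m (\<lambda>i. F (\<phi> i))
      = two_form_power (S.secondary_matrix x y) m \<phi>"
      by (rule two_form_power_gram) (rule entry[OF \<phi>(1) \<phi>(1)])
    show ?thesis
      by (rule exI[of _ "\<lambda>i. F (\<phi> i)"]) (unfold gram, rule \<phi>(2))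
  qed
  have dimB: "vector_space.dim ?S UNIV = 2 * (m + 1) - 1" using lie_algebra_secondary(2)[OF L] dim by simp
  show ?thesis
    unfolding generic_couple_def
  proof (intro conjI exI[of _ "m + 1"] allI impI)
    fix s t :: complex assume "(s, t) \<noteq> (0, 0)"
    from main[OF this] show "\<exists>v. two_form_power (\<lambda>a b. s * to_complex (lie_poisson ?B ?P a b)
      + t * to_complex (lie_poisson ?B ?Q a b)) (m + 1 - 1) v \<noteq> 0" by simp
  qed (rule two_form_lie_poisson[OF LB P] two_form_lie_poisson[OF LB Q] dimB | use m in simp)+
qed

section \<open>Existence of a non-flat generic pair\<close>

theorem proposition5:
  fixes scl :: "'k::real_or_complex \<Rightarrow> 'a::ab_group_add \<Rightarrow> 'a"
    and bas :: "'a set" and bracket :: "'a \<Rightarrow> 'a \<Rightarrow> 'a" and m n :: nat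
  assumes "lie_algebra scl bas bracket"
    and "unimodular scl bas bracket"
    and "vector_space.dim scl UNIV = m" and "m = 2 * n - 1" and "m \<ge> 3"
    and "\<exists>\<rho>. contact_form scl bracket \<rho>"
    and "\<exists>\<alpha>\<in>dual_space scl. \<exists>\<beta>\<in>dual_space scl.
           generic_couple scl (d_one bracket \<alpha>) (d_one bracket \<beta>)"
  shows "\<exists>\<Lambda> \<Lambda>\<^sub>1. linear_poisson_pair (secondary_scale scl) (secondary_bracket scl bracket) \<Lambda> \<Lambda>\<^sub>1
           \<and> generic_pair (secondary_scale scl) \<Lambda> \<Lambda>\<^sub>1
           \<and> \<not> flat_pair (secondary_scale scl) \<Lambda> \<Lambda>\<^sub>1"
proof -
  note L = assms(1) and dim = assms(3)
  interpret lie_algebra scl bas bracket by (rule L)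
  let ?B = "secondary_bracket scl bracket" and ?S = "secondary_scale scl"
  obtain e \<epsilon> where fr: "frame scl m e \<epsilon>" and tr: "\<And>f. trace_on scl bas f = (\<Sum>i<m. \<epsilon> i (f (e i)))"
    by (rule lie_algebra_frame[OF L dim]) (rule that)
  have \<epsilon>: "\<epsilon> i \<in> dual_space scl" if "i < m" for i using fr that by (simp add: frame_def)
  have unimod: "(\<Sum>i<m. \<epsilon> i (bracket a (e i))) = 0" for a
    using assms(2) tr[of "bracket a"] by (simp add: unimodular_def)
  define k where "k = n - 1"
  have mk: "m = 2 * k + 1" and k1: "k \<ge> 1" using assms(4,5) by (auto simp: k_def)
  have odd: "odd m" by (simp add: mk)
  have frk: "frame scl (2 * k + 1) e \<epsilon>" using fr by (simp only: mk)
  obtain \<rho> where "contact_form scl bracket \<rho>" using assms(6) by blast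
  then have \<rho>: "\<rho> \<in> dual_space scl" "contact_functional bracket \<rho>"
    using contact_form_functional[OF L fr dim] by (auto simp: contact_form_def)
  obtain \<alpha> q\<^sub>1 where \<alpha>: "\<alpha> \<in> dual_space scl" and q1: "q\<^sub>1 \<in> dual_space scl"
    and gc: "generic_couple scl (d_one bracket \<alpha>) (d_one bracket q\<^sub>1)" using assms(7) by blast
  obtain n' where "m = 2 * n' - 1" "n' \<ge> 2" and gen0: "\<And>s t :: complex. (s, t) \<noteq> (0, 0) \<Longrightarrow>
      \<exists>v. two_form_power (\<lambda>a b. s * to_complex (d_one bracket \<alpha> a b) + t * to_complex (d_one bracket q\<^sub>1 a b)) (n' - 1) v \<noteq> 0"
    using gc dim unfolding generic_couple_def by auto
  then have nk: "n' - 1 = k" using mk by simp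
  note gen0 = gen0[unfolded nk]
  obtain p\<^sub>1 where p1: "p\<^sub>1 \<in> dual_space scl" "contact_functional bracket p\<^sub>1"
    and gen: "\<And>s t :: complex. (s, t) \<noteq> (0, 0) \<Longrightarrow>
      \<exists>v. two_form_power (\<lambda>a b. s * to_complex (d_one bracket p\<^sub>1 a b) + t * to_complex (d_one bracket q\<^sub>1 a b)) k v \<noteq> 0"
    by (rule contact_perturbation[OF L fr odd \<rho> \<alpha> q1 gen0]) (assumption | rule that)+
  note p1D = dual_spaceD[OF p1(1)] and q1D = dual_spaceD[OF q1]
  have tc_minus: "to_complex (- a) = - to_complex a" for a :: 'k
    using to_complex_diff[of 0 a] by (simp add: to_complex_zero)
  define W where "W s t = (\<lambda>i j. s * to_complex (p\<^sub>1 (bracket (e i) (e j))) + t * to_complex (q\<^sub>1 (bracket (e i) (e j))))"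
    for s t :: complex
  have line: "\<exists>c. kernel_line m (W s t) c" if st: "(s, t) \<noteq> (0, 0)" for s t
  proof -
    let ?w = "\<lambda>a b. - s * to_complex (d_one bracket p\<^sub>1 a b) + - t * to_complex (d_one bracket q\<^sub>1 a b)"
    obtain v where v: "two_form_power ?w k v \<noteq> 0" using gen[of "- s" "- t"] st by auto
    have "bilinear_alternating scl to_complex (\<lambda>a b. to_complex (d_one bracket p\<^sub>1 a b))"
      "bilinear_alternating scl to_complex (\<lambda>a b. to_complex (d_one bracket q\<^sub>1 a b))"
      by (rule d_one_bilinear; simp add: p1 q1 to_complex_add to_complex_mult)+
    then have ba: "bilinear_alternating scl to_complex ?w"
      unfolding bilinear_alternating_def by (simp add: algebra_simps)
    have Ww: "(\<lambda>i j. ?w (e i) (e j)) = W s t" by (simp add: W_def d_one_def tc_minus)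
    have sk: "skew_matrix m (W s t)"
      unfolding skew_matrix_def
    proof (intro allI impI)
      fix i j
      have "bracket (e i) (e j) = - bracket (e j) (e i)" by (rule bracket_swap)
      then show "W s t i j = - W s t j i" by (simp add: W_def p1D q1D tc_minus)
    qed
    have nz: "two_form_power (coordinate_form m (W s t)) k (\<lambda>i j. to_complex (\<epsilon> j (v i))) \<noteq> 0"
      using v two_form_power_coordinates[OF fr ba, of k v] unfolding Ww by simp
    obtain c where "kernel_line (2 * k + 1) (W s t) c"
      by (rule kernel_line_of_two_form_power[OF sk[unfolded mk] nz[unfolded mk]]) (rule that)
    then show ?thesis unfolding mk by blast
  qed
  \<comment> \<open>two parameters \<open>t\<close> and \<open>t'\<close> at which the pencil consists of contact functionals\<close>
  have fin: "finite {z. \<not> contact_functional bracket (\<lambda>v. p\<^sub>1 v + z * q\<^sub>1 v)}"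
    by (rule contact_pencil_finite[OF L fr odd p1(1) q1 p1(2)])
  have "finite ((of_nat :: nat \<Rightarrow> 'k) -` {z. \<not> contact_functional bracket (\<lambda>v. p\<^sub>1 v + z * q\<^sub>1 v)})"
    by (rule finite_vimageI[OF fin]) (simp add: inj_on_def)
  then have fin_nat: "finite (insert 0 ((of_nat :: nat \<Rightarrow> 'k) -` {z. \<not> contact_functional bracket (\<lambda>v. p\<^sub>1 v + z * q\<^sub>1 v)}))"
    by simp
  have "\<exists>j. j \<notin> insert 0 ((of_nat :: nat \<Rightarrow> 'k) -` {z. \<not> contact_functional bracket (\<lambda>v. p\<^sub>1 v + z * q\<^sub>1 v)})"
    by (rule ex_new_if_finite[OF infinite_UNIV_nat fin_nat])
  then obtain j where j_new: "j \<notin> insert 0 ((of_nat :: nat \<Rightarrow> 'k) -` {z. \<not> contact_functional bracket (\<lambda>v. p\<^sub>1 v + z * q\<^sub>1 v)})" ..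
  have j: "j \<noteq> 0" "contact_functional bracket (\<lambda>v. p\<^sub>1 v + of_nat j * q\<^sub>1 v)" using j_new by simp_all
  have "\<exists>j'. j' \<notin> insert j (insert 0 ((of_nat :: nat \<Rightarrow> 'k) -` {z. \<not> contact_functional bracket (\<lambda>v. p\<^sub>1 v + z * q\<^sub>1 v)}))"
    by (rule ex_new_if_finite[OF infinite_UNIV_nat finite.insertI[OF fin_nat]])
  then obtain j' where j'_new: "j' \<notin> insert j (insert 0 ((of_nat :: nat \<Rightarrow> 'k) -` {z. \<not> contact_functional bracket (\<lambda>v. p\<^sub>1 v + z * q\<^sub>1 v)}))" ..
  have j': "j' \<noteq> j" "j' \<noteq> 0" "contact_functional bracket (\<lambda>v. p\<^sub>1 v + of_nat j' * q\<^sub>1 v)" using j'_new by simp_all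
  define t where "t = (of_nat j :: 'k)"
  define t' where "t' = (of_nat j' :: 'k)"
  have tt': "t \<noteq> 0" "t' \<noteq> 0" "t \<noteq> t'" using j j' by (auto simp: t_def t'_def)
  have yd: "(\<lambda>v. p\<^sub>1 v + z * q\<^sub>1 v) \<in> dual_space scl" for z
    by (simp add: dual_space_iff[OF vector_space_axioms] p1D q1D algebra_simps)
  have con: "contact_functional bracket (\<lambda>v. p\<^sub>1 v + t * q\<^sub>1 v)" "contact_functional bracket (\<lambda>v. p\<^sub>1 v + t' * q\<^sub>1 v)"
    using j j' by (auto simp: t_def t'_def)
  obtain R where R: "\<And>w. p\<^sub>1 (bracket R w) + t * q\<^sub>1 (bracket R w) = 0" "p\<^sub>1 R + t * q\<^sub>1 R = 1"
    by (rule contact_functional_reeb[OF L fr odd yd con(1)]) (rule that)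
  obtain R' where R': "\<And>w. p\<^sub>1 (bracket R' w) + t' * q\<^sub>1 (bracket R' w) = 0" "p\<^sub>1 R' + t' * q\<^sub>1 R' = 1"
    by (rule contact_functional_reeb[OF L fr odd yd con(2)]) (rule that)
  have nonzero: "\<exists>i<m. to_complex (\<epsilon> i u) \<noteq> 0" if "u \<noteq> 0" for u
  proof (rule ccontr)
    assume "\<not> ?thesis"
    then have "\<epsilon> i u = \<epsilon> i 0" if "i < m" for i
      using that to_complex_inject[of "\<epsilon> i u" 0] dual_spaceD(3)[OF \<epsilon>[OF that]] by (simp add: to_complex_zero)
    then have "u = 0" by (rule frame_vector_eqI[OF fr])
    with that show False ..
  qed
  have RR0: "R \<noteq> 0" "R' \<noteq> 0" using R(2) R'(2) p1D(3) q1D(3) by auto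
  have ind: "\<nexists>l. R' = scl l R"
  proof
    assume "\<exists>l. R' = scl l R"
    then obtain l where l: "R' = scl l R" by blast
    then have l0: "l \<noteq> 0" using RR0(2) by auto
    have 1: "p\<^sub>1 (bracket R w) + t' * q\<^sub>1 (bracket R w) = 0" for w
    proof -
      have "l * (p\<^sub>1 (bracket R w) + t' * q\<^sub>1 (bracket R w)) = 0"
        using R'(1)[of w] by (simp add: l bracket_scale p1D q1D algebra_simps)
      then show ?thesis using l0 by simp
    qed
    have q0: "q\<^sub>1 (bracket R w) = 0" for w
    proof -
      have "(t - t') * q\<^sub>1 (bracket R w)
        = (p\<^sub>1 (bracket R w) + t * q\<^sub>1 (bracket R w)) - (p\<^sub>1 (bracket R w) + t' * q\<^sub>1 (bracket R w))"
        by (simp add: algebra_simps)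
      also have "\<dots> = 0" by (simp only: R(1) 1 diff_self)
      finally have "(t - t') * q\<^sub>1 (bracket R w) = 0" .
      then show ?thesis using tt'(3) by simp
    qed
    have p0: "p\<^sub>1 (bracket R w) = 0" for w using 1[of w] q0[of w] by simp
    have "R = 0" by (rule no_common_kernel_vector[OF L frk k1 p1(1) q1 gen p0 q0])
    with RR0(1) show False ..
  qed
  let ?M = "\<lambda>i j. [:to_complex (p\<^sub>1 (bracket (e i) (e j))), to_complex (q\<^sub>1 (bracket (e i) (e j))):]
    + [:to_complex (p\<^sub>1 (e i)), to_complex (q\<^sub>1 (e i)):] * [:to_complex (p\<^sub>1 (e j)), to_complex (q\<^sub>1 (e j)):]"
  define Z where "Z = {z. \<not> nonsingular m (\<lambda>i j. poly (?M i j) z)}"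
  have M0: "(\<lambda>i j. poly (?M i j) 0) = (\<lambda>i j. to_complex (contact_matrix bracket e p\<^sub>1 i j))"
    by (simp add: contact_matrix_def to_complex_add to_complex_mult mult.commute)
  have ns0: "nonsingular m (\<lambda>i j. poly (?M i j) 0)"
    unfolding M0 by (rule nonsingular_to_complex[OF contact_functional_iff[OF L fr odd p1(1), THEN iffD1, OF p1(2)]])
  have Z: "finite Z" unfolding Z_def by (rule singular_parameters_finite[OF ns0])
  have Z0: "0 \<notin> Z" using ns0 by (simp add: Z_def)
  have "\<forall>z. \<exists>c. kernel_line m (W 1 z) c" using line by simp
  then obtain C where C: "\<And>z. kernel_line m (W 1 z) (C z)" by metis
  obtain c' where c': "kernel_line m (W 0 1) c'" using line[of 0 1] by auto
  \<comment> \<open>vectors on which \<open>q\<^sub>0\<close> must not vanish: the kernels of the non-contact members of the pencil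
    and of \<open>dq\<^sub>1\<close> for genericity, and the two Reeb vectors for non-flatness\<close>
  define S where "S = insert c' (insert (\<lambda>i. to_complex (\<epsilon> i R)) (insert (\<lambda>i. to_complex (\<epsilon> i R')) (C ` Z)))"
  have fS: "finite S" using Z by (simp add: S_def)
  have nzS: "\<exists>i<m. c i \<noteq> 0" if "c \<in> S" for c
    using that C c' nonzero[OF RR0(1)] nonzero[OF RR0(2)] by (auto simp: S_def kernel_line_def)
  have "\<exists>N :: nat. \<forall>c\<in>S. (\<Sum>i<m. of_nat N ^ i * c i) \<noteq> 0"
    by (rule moment_functional[OF fS]) (erule nzS, blast)
  then obtain N :: nat where N: "\<And>c. c \<in> S \<Longrightarrow> (\<Sum>i<m. of_nat N ^ i * c i) \<noteq> 0"
    by blast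
  define q\<^sub>0 where "q\<^sub>0 = (\<lambda>v. \<Sum>i<m. of_nat N ^ i * \<epsilon> i v)"
  have q0: "q\<^sub>0 \<in> dual_space scl"
    unfolding q\<^sub>0_def dual_space_iff[OF vector_space_axioms] using dual_spaceD(1,2)[OF \<epsilon>]
    by (auto simp: sum_distrib_left sum.distrib algebra_simps intro!: sum.cong)
  have tc_sum: "to_complex (\<Sum>i\<in>I. g i) = (\<Sum>i\<in>I. to_complex (g i))" for g :: "nat \<Rightarrow> 'k" and I
    by (induction I rule: infinite_finite_induct) (simp_all add: to_complex_zero to_complex_add)
  have tc_nat: "to_complex (of_nat N ^ i :: 'k) = of_nat N ^ i" for i
  proof -
    have "to_complex (of_nat a :: 'k) = of_nat a" for a
      by (induction a) (simp_all add: to_complex_zero to_complex_add to_complex_one)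
    then show ?thesis by (induction i) (simp_all add: to_complex_one to_complex_mult)
  qed
  have q0R: "q\<^sub>0 u \<noteq> 0" if "(\<lambda>i. to_complex (\<epsilon> i u)) \<in> S" for u
  proof
    assume "q\<^sub>0 u = 0"
    then have "to_complex (q\<^sub>0 u) = 0" by (simp add: to_complex_zero)
    then show False using N[OF that] by (simp add: q\<^sub>0_def tc_sum to_complex_mult tc_nat)
  qed
  have q0e: "to_complex (q\<^sub>0 (e i)) = of_nat N ^ i" if i: "i < m" for i
  proof -
    have "q\<^sub>0 (e i) = (\<Sum>k<m. of_nat N ^ k * (if k = i then 1 else 0))"
      unfolding q\<^sub>0_def using fr i by (auto simp: frame_def intro!: sum.cong)
    then have "q\<^sub>0 (e i) = of_nat N ^ i" unfolding sum_delta_mult(2)[OF i] .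
    then show ?thesis by (simp only: tc_nat)
  qed
  have dot0: "dot m (\<lambda>i. r * to_complex (q\<^sub>0 (e i))) c \<noteq> 0" if "c \<in> S" "r \<noteq> 0" for r c
  proof -
    have "dot m (\<lambda>i. r * to_complex (q\<^sub>0 (e i))) c = r * (\<Sum>i<m. of_nat N ^ i * c i)"
      unfolding dot_def sum_distrib_left by (intro sum.cong refl) (simp add: q0e mult.assoc)
    then show ?thesis using N[OF that(1)] that(2) by simp
  qed
  have gline: "\<exists>c. kernel_line m (W s r) c \<and>
      (dot m (\<lambda>i. s * to_complex (p\<^sub>1 (e i)) + r * to_complex (q\<^sub>1 (e i))) c \<noteq> 0
       \<or> dot m (\<lambda>i. r * to_complex (q\<^sub>0 (e i))) c \<noteq> 0)" if sr: "(s, r) \<noteq> (0, 0)" for s r :: complex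
  proof (cases "s = 0")
    case True
    then have r: "r \<noteq> 0" using sr by simp
    have "W s r = (\<lambda>i j. r * W 0 1 i j)" by (simp add: W_def True)
    then have "kernel_line m (W s r) c'" using kernel_line_scale[OF c' r] by simp
    moreover have "c' \<in> S" by (simp add: S_def)
    ultimately show ?thesis using dot0 r by blast
  next
    case False
    define z where "z = r / s"
    have r: "r = s * z" using False by (simp add: z_def)
    have "W s r = (\<lambda>i j. s * W 1 z i j)" by (simp add: W_def r distrib_left mult.assoc)
    then have kl: "kernel_line m (W s r) (C z)" using kernel_line_scale[OF C False] by simp
    show ?thesis
    proof (cases "z \<in> Z")
      case True
      then have "r \<noteq> 0" using Z0 False r by auto
      moreover have "C z \<in> S" using True by (simp add: S_def)
      ultimately show ?thesis using kl dot0 by blast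
    next
      case zZ: False
      let ?y = "\<lambda>i. to_complex (p\<^sub>1 (e i)) + z * to_complex (q\<^sub>1 (e i))"
      have "dot m ?y (C z) \<noteq> 0"
      proof
        assume d0: "dot m ?y (C z) = 0"
        have "kernel_vec m (\<lambda>i j. poly (?M i j) z) (C z)"
          unfolding kernel_vec_def
        proof (intro allI impI)
          fix i assume i: "i < m"
          have "(\<Sum>j<m. poly (?M i j) z * C z j) = (\<Sum>j<m. W 1 z i j * C z j) + ?y i * dot m ?y (C z)"
            unfolding dot_def sum_distrib_left sum.distrib[symmetric]
            by (intro sum.cong refl) (simp add: W_def algebra_simps)
          also have "(\<Sum>j<m. W 1 z i j * C z j) = 0" using C[of z] i by (simp add: kernel_line_def kernel_vec_def)
          finally show "(\<Sum>j<m. poly (?M i j) z * C z j) = 0" using d0 by simp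
        qed
        moreover have "nonsingular m (\<lambda>i j. poly (?M i j) z)" using zZ by (simp add: Z_def)
        ultimately have "\<forall>j<m. C z j = 0" unfolding nonsingular_def by blast
        then show False using C[of z] by (auto simp: kernel_line_def)
      qed
      moreover have "dot m (\<lambda>i. s * to_complex (p\<^sub>1 (e i)) + r * to_complex (q\<^sub>1 (e i))) (C z) = s * dot m ?y (C z)"
        unfolding dot_def sum_distrib_left by (intro sum.cong refl) (simp add: r algebra_simps)
      ultimately show ?thesis using kl False by auto
    qed
  qed
  let ?P = "\<lambda>(v :: 'a, v' :: 'a, s :: 'k). p\<^sub>1 v'" and ?Q = "\<lambda>(v :: 'a, v' :: 'a, s :: 'k). q\<^sub>0 v + q\<^sub>1 v'"
  have m2: "m \<ge> 2" and m0: "m > 0" using assms(5) by auto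
  have zero_dual: "(\<lambda>v. 0) \<in> dual_space scl" by (simp add: dual_space_iff[OF vector_space_axioms])
  have P: "?P \<in> dual_space ?S" using secondary_functional_dual[OF L zero_dual p1(1)] by simp
  have Q: "?Q \<in> dual_space ?S" by (rule secondary_functional_dual[OF L q0 q1])
  have generic: "generic_at ?S (lie_poisson ?B) (\<lambda>_. lie_poisson ?B ?Q) ?P"
    unfolding generic_at_def
    by (rule secondary_pair_generic[OF L fr m2 dim unimod p1(1) q0 q1]) (use gline in \<open>simp add: W_def\<close>)
  have tq: "t * q\<^sub>0 R \<noteq> 0" "t' * q\<^sub>0 R' \<noteq> 0" using tt' q0R[of R] q0R[of R'] by (simp_all add: S_def)
  have not_flat: "\<not> flat_at ?S (lie_poisson ?B) (\<lambda>_. lie_poisson ?B ?Q) ?P"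
    by (rule secondary_pair_not_flat[OF L fr m0 dim unimod p1(1) q0 q1 R tq(1)
          con(1)[unfolded contact_functional_def] R' tq(2) con(2)[unfolded contact_functional_def] ind])
  obtain BB where LB: "lie_algebra ?S BB ?B" using lie_algebra_secondary(1)[OF L] by blast
  interpret B: lie_algebra ?S BB ?B by (rule LB)
  have closed: "d_two ?B (lie_poisson ?B ?Q) a b c = 0" for a b c
  proof -
    have "?B (?B a b) c - ?B (?B a c) b + ?B (?B b c) a = 0"
      using B.bracket_derivation[of a b c] B.bracket_swap[of "?B b c" a] B.bracket_swap[of "?B a c" b] by simp
    from arg_cong[OF this, of ?Q] show ?thesis
      unfolding d_two_def lie_poisson_def dual_spaceD(1,3,5)[OF Q] by (simp add: algebra_simps)
  qed
  have "linear_poisson_pair ?S ?B (lie_poisson ?B) (\<lambda>_. lie_poisson ?B ?Q)"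
    unfolding linear_poisson_pair_def using two_form_lie_poisson[OF LB Q] closed by blast
  moreover have "generic_pair ?S (lie_poisson ?B) (\<lambda>_. lie_poisson ?B ?Q)"
    unfolding generic_pair_def using generic P by blast
  moreover have "\<not> flat_pair ?S (lie_poisson ?B) (\<lambda>_. lie_poisson ?B ?Q)"
    unfolding flat_pair_def using generic P not_flat by blast
  ultimately show ?thesis by blast
qed

end
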